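(* Let $n\ge 1$, let $\beta_1,\dots,\beta_n>1$, and let $Q=(q_{j,j'})_{j,j'\le n}$ be any symmetric nonnegative definite matrix with $q_{j,j'}\in[-1,1]$ and $q_{j,j}=1$. Let $r_1,\dots,r_n$ be the eigenvalues of the matrix $\tilde Q=(\sqrt{\beta_j\beta_{j'}}\,q_{j,j'})_{j,j'\le n}$. Then, for the pure 2-spin spherical model without external field, $$\limsup_{\varepsilon\to 0}\limsup_{N\to\infty}F_N(Q_\varepsilon)\le \frac12\sum_{j\le n}\bigl(f(r_j)-\log\beta_j\bigr).$$ Moreover, the right-hand side is strictly less than $\sum_{j\le n}\mathcal P(\beta_j)$ if the smallest eigenvalue satisfies $\min_j r_j<1$.
   Context: $S_N$ is the sphere of radius $\sqrt N$ in $\mathbb R^N$ centered at $0$, and $\lambda_N$ is the uniform probability measure on $S_N$. The pure 2-spin Hamiltonian is $$H_N(\boldsymbol\sigma)=\frac{1}{\sqrt{2}\,N^{1/2}}\sum_{1\le i_1,i_2\le N}g_{i_1,i_2}\sigma_{i_1}\sigma_{i_2},$$ with $(g_{i_1,i_2})$ i.i.d. standard Gaussian. For $\boldsymbol\sigma^1,\dots,\boldsymbol\sigma^n\in S_N$ the overlaps are $R_{j,j'}=N^{-1}\sum_{i\le N}\sigma_i^j\sigma_i^{j'}$. For $\varepsilon>0$, $$Q_\varepsilon=\{(\boldsymbol\sigma^1,\dots,\boldsymbol\sigma^n)\in S_N^n: R_{j,j'}\in[q_{j,j'}-\varepsilon,q_{j,j'}+\varepsilon]\text{ for all }j,j'\le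 n\},$$ and (no external field, same $H_N$ for all copies) $$F_N(Q_\varepsilon)=\frac1N\mathbb E\log\int_{Q_\varepsilon}\exp\Bigl(\sum_{j\le n}\beta_jH_N(\boldsymbol\sigma^j)\Bigr)d\lambda_N^n .$$ The function $f$ is $f(r)=\log r+\frac12r^2$ for $0<r\le1$ and $f(r)=2r-\frac32$ for $r\ge1$, with the convention $f(0)=-\infty$. For $\beta>1$, $\mathcal P(\beta)=\frac12\bigl(2\beta-\frac32-\log\beta\bigr)$, which is the value of $\lim_{N\to\infty}\frac1N\mathbb E\log\int_{S_N}\exp(\beta H_N)\,d\lambda_N$. *)

theory Defs
  imports
    "HOL-Probability.Probability"
    "Jordan_Normal_Form.Char_Poly"
begin

text \<open>Vectors of \<open>\<real>\<^sup>N\<close> are extensional functions on \<open>{..<N}\<close>,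
  so that \<open>N\<close> may tend to infinity; all indices start at 0.\<close>

definition sphere_set :: "nat \<Rightarrow> (nat \<Rightarrow> real) set" where
  "sphere_set N = {\<sigma> \<in> {..<N} \<rightarrow>\<^sub>E UNIV. L2_set \<sigma> {..<N} = sqrt (real N)}"

text \<open>The uniform probability measure on the sphere \<open>sphere_set N\<close>, as the image of the normalised
  Lebesgue measure of the unit ball under the radial projection \<open>x \<mapsto> sqrt N * x / \<parallel>x\<parallel>\<close>
  (the origin, where the projection is not defined, is a null set for \<open>N \<ge> 1\<close>).
  It is a measure on all of \<open>\<real>\<^sup>N\<close>, carried by \<open>sphere_set N\<close>.\<close>

definition sphere_measure :: "nat \<Rightarrow> (nat \<Rightarrow> real) measure" where
  "sphere_measure N =
     distr (uniform_measure (\<Pi>\<^sub>M i\<in>{..<N}. lborel) {x \<in> {..<N} \<rightarrow>\<^sub>E UNIV. L2_set x {..<N} \<le> 1})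
       (\<Pi>\<^sub>M i\<in>{..<N}. borel)
       (\<lambda>x. \<lambda>i\<in>{..<N}. sqrt (real N) * x i / L2_set x {..<N})"

definition hamiltonian :: "nat \<Rightarrow> (nat \<Rightarrow> nat \<Rightarrow> real) \<Rightarrow> (nat \<Rightarrow> real) \<Rightarrow> real" where
  "hamiltonian N G \<sigma> = 1 / (sqrt 2 * sqrt (real N)) * (\<Sum>i<N. \<Sum>k<N. G i k * \<sigma> i * \<sigma> k)"

definition overlap :: "nat \<Rightarrow> (nat \<Rightarrow> real) \<Rightarrow> (nat \<Rightarrow> real) \<Rightarrow> real" where
  "overlap N \<sigma> \<tau> = (\<Sum>i<N. \<sigma> i * \<tau> i) / real N"

definition overlap_set :: "nat \<Rightarrow> real mat \<Rightarrow> real \<Rightarrow> nat \<Rightarrow> (nat \<Rightarrow> nat \<Rightarrow> real) set" where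
  "overlap_set n Q \<epsilon> N =
     {\<sigma> \<in> {..<n} \<rightarrow>\<^sub>E sphere_set N. \<forall>j<n. \<forall>k<n. overlap N (\<sigma> j) (\<sigma> k) \<in> {Q $$ (j, k) - \<epsilon> .. Q $$ (j, k) + \<epsilon>}}"

text \<open>Logarithm with \<open>log 0 = -\<infinity>\<close>, and the expectation of an extended real random variable
  as the difference of the integrals of its positive and negative parts. They are needed because
  \<open>overlap_set\<close> may be a null set for small \<open>N\<close>.\<close>

definition elog :: "real \<Rightarrow> ereal" where
  "elog x = (if x \<le> 0 then - \<infinity> else ereal (ln x))"

definition eexpectation :: "'a measure \<Rightarrow> ('a \<Rightarrow> ereal) \<Rightarrow> ereal" where
  "eexpectation M X =
     enn2ereal (\<integral>\<^sup>+ \<omega>. e2ennreal (X \<omega>) \<partial>M) - enn2ereal (\<integral>\<^sup>+ \<omega>. e2ennreal (- X \<omega>) \<partial>M)"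

definition partition_function ::
  "nat \<Rightarrow> (nat \<Rightarrow> real) \<Rightarrow> nat \<Rightarrow> (nat \<Rightarrow> nat \<Rightarrow> real) \<Rightarrow> (nat \<Rightarrow> nat \<Rightarrow> real) set \<Rightarrow> real" where
  "partition_function n \<beta> N G A =
     (LINT \<sigma>:A|(\<Pi>\<^sub>M j\<in>{..<n}. sphere_measure N). exp (\<Sum>j<n. \<beta> j * hamiltonian N G (\<sigma> j)))"

definition free_energy ::
  "'a measure \<Rightarrow> (nat \<Rightarrow> nat \<Rightarrow> 'a \<Rightarrow> real) \<Rightarrow> nat \<Rightarrow> (nat \<Rightarrow> real) \<Rightarrow> nat
     \<Rightarrow> (nat \<Rightarrow> nat \<Rightarrow> real) set \<Rightarrow> ereal" where
  "free_energy M g n \<beta> N A =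
     ereal (1 / real N) *
     eexpectation M (\<lambda>\<omega>. elog (partition_function n \<beta> N (\<lambda>i k. g i k \<omega>) A))"

definition iid_std_gaussian :: "'a measure \<Rightarrow> (nat \<Rightarrow> nat \<Rightarrow> 'a \<Rightarrow> real) \<Rightarrow> bool" where
  "iid_std_gaussian M g \<longleftrightarrow>
     prob_space M \<and>
     prob_space.indep_vars M (\<lambda>_. borel) (\<lambda>(i, k). g i k) UNIV \<and>
     (\<forall>i k. distributed M lborel (g i k) std_normal_density)"

definition nonneg_definite :: "real mat \<Rightarrow> bool" where
  "nonneg_definite A \<longleftrightarrow> (\<forall>v \<in> carrier_vec (dim_row A). 0 \<le> v \<bullet> (A *\<^sub>v v))"

text \<open>Values at negative arguments are irrelevant: \<open>spin_f\<close> is only applied to eigenvalues of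
  nonnegative definite matrices.\<close>

definition spin_f :: "real \<Rightarrow> ereal" where
  "spin_f r = (if r \<le> 0 then - \<infinity> else if r \<le> 1 then ereal (ln r + r\<^sup>2 / 2) else ereal (2 * r - 3 / 2))"

definition parisi :: "real \<Rightarrow> real" where
  "parisi \<beta> = 1 / 2 * (2 * \<beta> - 3 / 2 - ln \<beta>)"

end

theory Submission
  imports Defs "HOL-Real_Asymp.Real_Asymp"
begin

text \<open>Diagonalise \<open>Qt\<close> by an orthogonal matrix \<open>u\<close> and replace the configurations by
  \<open>v k = \<Sum>j. u j k * sqrt (\<beta> j) * \<sigma> j\<close>. Then \<open>\<Sum>j. \<beta> j * H (\<sigma> j) = \<Sum>k. H (v k)\<close>, and on the overlap set the
  \<open>v k\<close> are almost orthogonal with \<open>\<parallel>v k\<parallel>\<^sup>2\<close> close to \<open>N * r k\<close>. With \<open>q k = max (r k - 1) 0\<close>, the increments of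
  this Gaussian process are bounded by those of the linear field \<open>\<Sum>k. sqrt (q k) * (g k \<bullet> v k)\<close> up to
  \<open>N * (\<Sum>k. (min (r k) 1)\<^sup>2)\<close>, because \<open>r\<^sup>2 - m\<^sup>2 - 2 * q * (r - m) \<le> (r - q)\<^sup>2\<close>. A Gaussian comparison
  inequality for free energies, obtained by exchanging the two fields in many small independent
  pieces, therefore reduces the bound to the free energy of the linear field on the overlap set.
  There the overlap constraint is relaxed by a quadratic exponential tilt \<open>\<theta> k\<close>, after which
  everything is an explicit Gaussian integral. The choice \<open>\<theta> k = 1 / min (r k) 1\<close> (with \<open>\<theta> k \<rightarrow> \<infinity>\<close> when
  \<open>r k = 0\<close>) gives the claim.\<close>

section \<open>Standard Gaussian product measures\<close>

text \<open>The values of q and \<theta> come from one scalar problem. For free q and \<theta>, the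
  comparison and the tilt bound the share of an eigenvalue r, apart from the \<beta> terms, by
  \<theta> r / 2 - (ln \<theta>) / 2 - 1/2 + q / (2 \<theta>) + (r - q)^2 / 4. Stationarity in q
  gives \<theta> = 1 / (r - q); inserted into stationarity in \<theta>, this leaves q = q (r - q)^2,
  so q = 0 or r - q = 1. This is the switch of f at r = 1. Taking q = 0 throughout is the annealed
  bound: it gives ln r + r^2 / 2, which exceeds 2 r - 3/2 when r > 1, so the linear field has to
  absorb the excess r - 1.

  The exchange in discrete pieces uses only a second-order cumulant expansion with a cubic error,
  and neither a derivative in an interpolation parameter nor Gaussian integration by parts. Only
  increments enter it, because the first-order cumulant has mean zero. After the exchange the field
  is linear, and the tilt bounds its partition function pointwise in the disorder; hence averaging
  the logarithm costs nothing more.\<close>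

definition std_gauss :: "real measure" where
  "std_gauss = density lborel std_normal_density"

lemma sets_std_gauss [simp, measurable_cong]: "sets std_gauss = sets borel"
  by (simp add: std_gauss_def)

lemma space_std_gauss [simp]: "space std_gauss = UNIV"
  by (simp add: std_gauss_def)

interpretation std_gauss: prob_space std_gauss
  unfolding std_gauss_def by (rule prob_space_normal_density) simp

interpretation gauss_prod: product_sigma_finite "\<lambda>_. std_gauss"
  by unfold_locales

lemma nn_integral_std_gauss:
  assumes [measurable]: "f \<in> borel_measurable borel"
  shows "(\<integral>\<^sup>+ z. f z \<partial>std_gauss) = (\<integral>\<^sup>+ z. ennreal (std_normal_density z) * f z \<partial>lborel)"
  unfolding std_gauss_def by (subst nn_integral_density) auto

text \<open>Completing the square turns a tilted Gaussian density into a multiple of another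
  Gaussian density, and the multiple is the value of the integral. The two explicit integrals that
  follow are instances.\<close>

lemma nn_integral_std_gauss_tilt:
  fixes \<phi> :: "real \<Rightarrow> real"
  assumes "\<And>z. std_normal_density z * \<phi> z = c * normal_density m s z" "0 < s" "0 \<le> c"
    and [measurable]: "\<phi> \<in> borel_measurable borel" and "\<And>z. 0 \<le> \<phi> z"
  shows "(\<integral>\<^sup>+ z. ennreal (\<phi> z) \<partial>std_gauss) = ennreal c"
proof -
  have "(\<integral>\<^sup>+ z. ennreal (\<phi> z) \<partial>std_gauss) = (\<integral>\<^sup>+ z. ennreal (c * normal_density m s z) \<partial>lborel)"
    using assms by (subst nn_integral_std_gauss) (auto simp: ennreal_mult[symmetric])
  also have "\<dots> = ennreal c * (\<integral>\<^sup>+ z. ennreal (normal_density m s z) \<partial>lborel)"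
    using assms by (simp add: ennreal_mult nn_integral_cmult)
  also have "(\<integral>\<^sup>+ z. ennreal (normal_density m s z) \<partial>lborel) = 1"
    using \<open>0 < s\<close> by (subst nn_integral_eq_integral) auto
  finally show ?thesis by simp
qed

lemma nn_integral_exp_std_gauss:
  "(\<integral>\<^sup>+ z. ennreal (exp (c * z)) \<partial>std_gauss) = ennreal (exp (c\<^sup>2 / 2))"
proof (rule nn_integral_std_gauss_tilt[where m = c and s = 1])
  fix z :: real
  have "- z\<^sup>2 / 2 + c * z = c\<^sup>2 / 2 + - (z - c)\<^sup>2 / 2"
    by (simp add: field_simps power2_eq_square)
  then have "exp (- z\<^sup>2 / 2) * exp (c * z) = exp (c\<^sup>2 / 2) * exp (- (z - c)\<^sup>2 / 2)"
    by (simp only: exp_add[symmetric])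
  then show "std_normal_density z * exp (c * z) = exp (c\<^sup>2 / 2) * normal_density c 1 z"
    by (simp add: normal_density_def)
qed auto

text \<open>The coefficient of \<open>z\<^sup>2\<close> in the total exponent is -\<theta> / (2 T),
  so \<theta> > 0 is exactly what makes the integral finite. Averaging over the auxiliary variable
  thus replaces T by \<theta> in the denominator of the exponent.\<close>

lemma nn_integral_exp_square_std_gauss:
  assumes "0 < \<theta>" "\<theta> \<le> T" "\<tau>\<^sup>2 = T - \<theta>"
  shows "(\<integral>\<^sup>+ z. ennreal (exp ((b + \<tau> * z)\<^sup>2 / (2 * T))) \<partial>std_gauss)
    = ennreal (sqrt (T / \<theta>) * exp (b\<^sup>2 / (2 * \<theta>)))"
proof (rule nn_integral_std_gauss_tilt[where m = "b * \<tau> / \<theta>" and s = "sqrt (T / \<theta>)"])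
  fix z :: real
  have T: "T = \<tau>\<^sup>2 + \<theta>" "T > 0" using assms by auto
  have "(b + \<tau> * z)\<^sup>2 * \<theta> - T * \<theta> * z\<^sup>2 = b\<^sup>2 * T - (\<theta> * z - b * \<tau>)\<^sup>2"
    unfolding T(1) by (simp add: power2_eq_square algebra_simps)
  moreover have "(z - b * \<tau> / \<theta>)\<^sup>2 = (\<theta> * z - b * \<tau>)\<^sup>2 / \<theta>\<^sup>2"
    using assms by (simp add: power_divide[symmetric] diff_divide_distrib)
  ultimately have *: "(z - b * \<tau> / \<theta>)\<^sup>2 = (b\<^sup>2 * T - (b + \<tau> * z)\<^sup>2 * \<theta> + T * \<theta> * z\<^sup>2) / \<theta>\<^sup>2"
    by simp
  have "- z\<^sup>2 / 2 + (b + \<tau> * z)\<^sup>2 / (2 * T) =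
      b\<^sup>2 / (2 * \<theta>) + - (z - b * \<tau> / \<theta>)\<^sup>2 / (2 * (T / \<theta>))"
    unfolding * using assms(1) T(2) by (simp add: field_simps power2_eq_square)
  then have "exp (- z\<^sup>2 / 2) * exp ((b + \<tau> * z)\<^sup>2 / (2 * T)) =
      exp (b\<^sup>2 / (2 * \<theta>)) * exp (- (z - b * \<tau> / \<theta>)\<^sup>2 / (2 * (T / \<theta>)))"
    by (simp only: exp_add[symmetric])
  moreover have nd: "normal_density (b * \<tau> / \<theta>) (sqrt (T / \<theta>)) z =
      exp (- (z - b * \<tau> / \<theta>)\<^sup>2 / (2 * (T / \<theta>))) / (sqrt (2 * pi) * sqrt (T / \<theta>))"
    using assms(1) T(2) real_sqrt_mult[of "2 * pi" "T / \<theta>"] by (simp add: normal_density_def)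
  ultimately show "std_normal_density z * exp ((b + \<tau> * z)\<^sup>2 / (2 * T)) =
      sqrt (T / \<theta>) * exp (b\<^sup>2 / (2 * \<theta>)) * normal_density (b * \<tau> / \<theta>) (sqrt (T / \<theta>)) z"
    unfolding nd using assms(1) T(2) by (simp add: normal_density_def divide_simps)
qed (use assms in auto)

abbreviation gauss_PiM :: "'i set \<Rightarrow> ('i \<Rightarrow> real) measure" where
  "gauss_PiM I \<equiv> \<Pi>\<^sub>M i\<in>I. std_gauss"

lemma nn_integral_exp_gauss_PiM:
  assumes "finite I"
  shows "(\<integral>\<^sup>+ z. ennreal (exp (\<Sum>i\<in>I. c i * z i)) \<partial>gauss_PiM I) = ennreal (exp ((\<Sum>i\<in>I. (c i)\<^sup>2) / 2))"
proof -
  have "(\<integral>\<^sup>+ z. ennreal (exp (\<Sum>i\<in>I. c i * z i)) \<partial>gauss_PiM I)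
      = (\<integral>\<^sup>+ z. (\<Prod>i\<in>I. ennreal (exp (c i * z i))) \<partial>gauss_PiM I)"
    using assms by (simp add: exp_sum prod_ennreal)
  also have "\<dots> = (\<Prod>i\<in>I. ennreal (exp ((c i)\<^sup>2 / 2)))"
    using assms by (subst gauss_prod.product_nn_integral_prod) (auto simp: nn_integral_exp_std_gauss)
  also have "\<dots> = ennreal (exp ((\<Sum>i\<in>I. (c i)\<^sup>2) / 2))"
    using assms by (simp add: exp_sum prod_ennreal sum_divide_distrib)
  finally show ?thesis .
qed

lemma nn_integral_exp_square_gauss_PiM:
  assumes "finite I" "\<And>i. i \<in> I \<Longrightarrow> 0 < \<theta> i \<and> \<theta> i \<le> T \<and> (\<tau> i)\<^sup>2 = T - \<theta> i"
  shows "(\<integral>\<^sup>+ z. ennreal (exp ((\<Sum>i\<in>I. (b i + \<tau> i * z i)\<^sup>2) / (2 * T))) \<partial>gauss_PiM I)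
    = ennreal ((\<Prod>i\<in>I. sqrt (T / \<theta> i)) * exp (\<Sum>i\<in>I. (b i)\<^sup>2 / (2 * \<theta> i)))"
proof -
  have "(\<integral>\<^sup>+ z. ennreal (exp ((\<Sum>i\<in>I. (b i + \<tau> i * z i)\<^sup>2) / (2 * T))) \<partial>gauss_PiM I)
      = (\<integral>\<^sup>+ z. (\<Prod>i\<in>I. ennreal (exp ((b i + \<tau> i * z i)\<^sup>2 / (2 * T)))) \<partial>gauss_PiM I)"
    using assms(1) by (simp add: exp_sum prod_ennreal sum_divide_distrib)
  also have "\<dots> = (\<Prod>i\<in>I. ennreal (sqrt (T / \<theta> i) * exp ((b i)\<^sup>2 / (2 * \<theta> i))))"
    using assms
    by (subst gauss_prod.product_nn_integral_prod)
      (auto intro!: prod.cong nn_integral_exp_square_std_gauss)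
  also have "\<dots> = ennreal (\<Prod>i\<in>I. sqrt (T / \<theta> i) * exp ((b i)\<^sup>2 / (2 * \<theta> i)))"
    using assms(2) by (intro prod_ennreal) (force intro!: mult_nonneg_nonneg)
  also have "(\<Prod>i\<in>I. sqrt (T / \<theta> i) * exp ((b i)\<^sup>2 / (2 * \<theta> i))) =
      (\<Prod>i\<in>I. sqrt (T / \<theta> i)) * exp (\<Sum>i\<in>I. (b i)\<^sup>2 / (2 * \<theta> i))"
    using assms(1) by (simp add: prod.distrib exp_sum)
  finally show ?thesis .
qed

lemma integrable_exp_abs_std_gauss: "integrable std_gauss (\<lambda>z. exp \<bar>z\<bar>)"
proof (rule integrableI_nonneg)
  have "(\<integral>\<^sup>+ z. ennreal (exp \<bar>z\<bar>) \<partial>std_gauss)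
      \<le> (\<integral>\<^sup>+ z. ennreal (exp (1 * z)) + ennreal (exp ((-1) * z)) \<partial>std_gauss)"
    by (intro nn_integral_mono) (auto simp: abs_if simp flip: ennreal_plus)
  also have "\<dots> = ennreal (exp (1\<^sup>2 / 2)) + ennreal (exp ((-1)\<^sup>2 / 2))"
    by (subst nn_integral_add) (auto simp only: nn_integral_exp_std_gauss, measurable)
  also have "\<dots> < \<infinity>" by simp
  finally show "(\<integral>\<^sup>+ z. ennreal (exp \<bar>z\<bar>) \<partial>std_gauss) < \<infinity>" .
qed auto

lemma integrable_exp_abs_gauss_PiM:
  assumes "finite I"
  shows "integrable (gauss_PiM I) (\<lambda>z. exp (\<Sum>i\<in>I. \<bar>z i\<bar>))"
  using assms gauss_prod.product_integrable_prod[of I "\<lambda>_ z. exp \<bar>z\<bar>"] integrable_exp_abs_std_gauss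
  by (simp add: exp_sum)

lemma std_gauss_moments:
  "integrable std_gauss (\<lambda>z. z)" "integral\<^sup>L std_gauss (\<lambda>z. z) = 0"
  "integrable std_gauss (\<lambda>z. z\<^sup>2)" "integral\<^sup>L std_gauss (\<lambda>z. z\<^sup>2) = 1"
  using integrable_std_normal_moment[of 1] integrable_std_normal_moment[of 2]
    integral_std_normal_moment_even[of 1] integral_std_normal_moment_odd[of 0]
  by (auto simp: std_gauss_def integrable_real_density integral_real_density)

lemma gauss_PiM_moments:
  assumes "finite I" "i \<in> I"
  shows "integrable (gauss_PiM I) (\<lambda>z. z i)" "integral\<^sup>L (gauss_PiM I) (\<lambda>z. z i) = 0"
proof -
  define f where "f k x = (if k = i then x else (1::real))" for k x
  have eq: "(\<Prod>k\<in>I. f k (z k)) = z i" for z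
    using assms by (simp add: f_def prod.If_cases Int_absorb1)
  have int: "integrable std_gauss (f k)" for k
    by (cases "k = i") (simp_all add: f_def[abs_def] std_gauss_moments(1))
  have "integral\<^sup>L std_gauss (f i) = 0"
    by (simp add: f_def[abs_def] std_gauss_moments)
  then have "(\<Prod>k\<in>I. integral\<^sup>L std_gauss (f k)) = 0"
    using assms by (auto intro: prod_zero)
  then show "integrable (gauss_PiM I) (\<lambda>z. z i)" "integral\<^sup>L (gauss_PiM I) (\<lambda>z. z i) = 0"
    using gauss_prod.product_integrable_prod[of I f, OF assms(1) int]
      gauss_prod.product_integral_prod[of I f, OF assms(1) int] by (simp_all only: eq)
qed

lemma gauss_PiM_second_moments:
  assumes "finite I" "i \<in> I" "j \<in> I"
  shows "integrable (gauss_PiM I) (\<lambda>z. z i * z j)"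
    "integral\<^sup>L (gauss_PiM I) (\<lambda>z. z i * z j) = (if i = j then 1 else 0)"
proof -
  define f where "f k x = (if k = i then x else 1) * (if k = j then x else (1::real))" for k x
  have eq: "(\<Prod>k\<in>I. f k (z k)) = z i * z j" for z
    using assms by (simp add: prod.distrib f_def prod.If_cases Int_absorb1)
  have int: "integrable std_gauss (f k)" for k
    by (cases "k = i"; cases "k = j"; simp add: f_def[abs_def] power2_eq_square[symmetric] std_gauss_moments)
  have f: "integral\<^sup>L std_gauss (f k) = (if i = j then 1 else if k = i \<or> k = j then 0 else 1)" for k
    using std_gauss.prob_space by (cases "k = i"; cases "k = j"; simp add: f_def[abs_def] power2_eq_square[symmetric] std_gauss_moments)
  have "(\<Prod>k\<in>I. integral\<^sup>L std_gauss (f k)) = (if i = j then 1 else 0)"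
  proof (cases "i = j")
    case False
    then have "integral\<^sup>L std_gauss (f i) = 0" by (simp add: f)
    then show ?thesis using assms False by (auto intro: prod_zero)
  qed (simp add: f)
  then show "integrable (gauss_PiM I) (\<lambda>z. z i * z j)"
    "integral\<^sup>L (gauss_PiM I) (\<lambda>z. z i * z j) = (if i = j then 1 else 0)"
    using gauss_prod.product_integrable_prod[of I f, OF assms(1) int]
      gauss_prod.product_integral_prod[of I f, OF assms(1) int] by (simp_all only: eq)
qed

section \<open>Sums of independent Gaussian variables and vectors\<close>

lemma nn_integral_std_gauss_scale:
  assumes [measurable]: "f \<in> borel_measurable borel" and "0 < s"
  shows "(\<integral>\<^sup>+ x. f (s * x) \<partial>std_gauss) = (\<integral>\<^sup>+ x. ennreal (normal_density 0 s x) * f x \<partial>lborel)"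
proof -
  have "distributed std_gauss lborel (\<lambda>x. x) std_normal_density"
    by (simp add: distributed_def std_gauss_def distr_id2)
  then have "distributed std_gauss lborel (\<lambda>x. 0 + s * x) (normal_density (0 + s * 0) (\<bar>s\<bar> * 1))"
    using \<open>0 < s\<close> by (intro std_gauss.normal_density_affine) auto
  then have "distributed std_gauss lborel (\<lambda>x. s * x) (normal_density 0 s)"
    using \<open>0 < s\<close> by simp
  from distributed_nn_integral[OF this, of f] show ?thesis by simp
qed

lemma nn_integral_std_gauss_add:
  assumes [measurable]: "f \<in> borel_measurable borel" and "0 \<le> p" "0 \<le> q"
  shows "(\<integral>\<^sup>+ x. \<integral>\<^sup>+ y. f (p * x + q * y) \<partial>std_gauss \<partial>std_gauss)
    = (\<integral>\<^sup>+ x. f (sqrt (p\<^sup>2 + q\<^sup>2) * x) \<partial>std_gauss)"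
\<comment> \<open>The convolution formula for normal densities needs two positive standard
  deviations; a degenerate summand is treated separately.\<close>
proof (cases "p = 0 \<or> q = 0")
  case True
  with assms show ?thesis by (auto simp: std_gauss.emeasure_space_1[simplified])
next
  case False
  with assms have pq: "0 < p" "0 < q" by auto
  have shift: "(\<integral>\<^sup>+ y. ennreal (normal_density 0 q y) * f (x + y) \<partial>lborel)
      = (\<integral>\<^sup>+ u. ennreal (normal_density 0 q (u - x)) * f u \<partial>lborel)" for x
    by (subst nn_integral_real_affine[where t = "- x" and c = 1]) auto
  have "(\<integral>\<^sup>+ x. \<integral>\<^sup>+ y. f (p * x + q * y) \<partial>std_gauss \<partial>std_gauss)
      = (\<integral>\<^sup>+ x. ennreal (normal_density 0 p x) * (\<integral>\<^sup>+ y. f (x + q * y) \<partial>std_gauss) \<partial>lborel)"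
    using pq by (subst nn_integral_std_gauss_scale[symmetric]) auto
  also have "\<dots> = (\<integral>\<^sup>+ x. ennreal (normal_density 0 p x) *
      (\<integral>\<^sup>+ y. ennreal (normal_density 0 q y) * f (x + y) \<partial>lborel) \<partial>lborel)"
    using pq by (subst nn_integral_std_gauss_scale) auto
  also have "\<dots> = (\<integral>\<^sup>+ x. ennreal (normal_density 0 p x) *
      (\<integral>\<^sup>+ u. ennreal (normal_density 0 q (u - x)) * f u \<partial>lborel) \<partial>lborel)"
    by (simp only: shift)
  also have "\<dots> = (\<integral>\<^sup>+ x. \<integral>\<^sup>+ u. ennreal (normal_density 0 q (u - x) * normal_density 0 p x) * f u
      \<partial>lborel \<partial>lborel)"
    by (simp add: nn_integral_cmult[symmetric] ennreal_mult' mult_ac)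
  also have "\<dots> = (\<integral>\<^sup>+ u. \<integral>\<^sup>+ x. ennreal (normal_density 0 q (u - x) * normal_density 0 p x) * f u
      \<partial>lborel \<partial>lborel)"
    by (rule lborel_pair.Fubini') auto
  also have "\<dots> = (\<integral>\<^sup>+ u. (\<integral>\<^sup>+ x. ennreal (normal_density 0 q (u - x) * normal_density 0 p x) \<partial>lborel) * f u
      \<partial>lborel)"
    by (simp add: nn_integral_multc)
  also have "\<dots> = (\<integral>\<^sup>+ u. ennreal (normal_density 0 (sqrt (q\<^sup>2 + p\<^sup>2)) u) * f u \<partial>lborel)"
    by (simp add: conv_normal_density_zero_mean[OF pq(2,1), THEN fun_cong])
  also have "\<dots> = (\<integral>\<^sup>+ x. f (sqrt (p\<^sup>2 + q\<^sup>2) * x) \<partial>std_gauss)"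
    using pq by (subst nn_integral_std_gauss_scale) (auto simp: add.commute add_pos_pos)
  finally show ?thesis .
qed

lemma prob_space_gauss_PiM: "prob_space (gauss_PiM I)"
  by (intro prob_space_PiM std_gauss.prob_space_axioms)

text \<open>Read from right to left, this splits a Gaussian field into two independent ones with
  variances \<open>(p j)\<^sup>2\<close> and \<open>(q j)\<^sup>2\<close>. It is how a small piece
  is separated from the rest in the comparison. Both image measures are identified with the same
  product measure by their values on boxes.\<close>

lemma distr_gauss_PiM_add:
  fixes p q :: "'j \<Rightarrow> real"
  assumes J: "finite J" and pq: "\<And>j. j \<in> J \<Longrightarrow> 0 \<le> p j" "\<And>j. j \<in> J \<Longrightarrow> 0 \<le> q j"
  shows "distr (gauss_PiM J \<Otimes>\<^sub>M gauss_PiM J) (\<Pi>\<^sub>M j\<in>J. borel) (\<lambda>(z, y). \<lambda>j\<in>J. p j * z j + q j * y j)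
    = distr (gauss_PiM J) (\<Pi>\<^sub>M j\<in>J. borel) (\<lambda>z. \<lambda>j\<in>J. sqrt ((p j)\<^sup>2 + (q j)\<^sup>2) * z j)"
    (is "?L = ?R")
proof -
  define \<nu> where "\<nu> j = distr std_gauss borel (\<lambda>x. sqrt ((p j)\<^sup>2 + (q j)\<^sup>2) * x)" for j
  interpret \<nu>: prob_space "\<nu> j" for j
    unfolding \<nu>_def by (rule std_gauss.prob_space_distr) simp
  interpret \<nu>p: product_sigma_finite \<nu> ..
  interpret G: prob_space "gauss_PiM J" by (rule prob_space_gauss_PiM)
  have sets: "sets (\<Pi>\<^sub>M j\<in>J. (borel :: real measure)) = sets (\<Pi>\<^sub>M j\<in>J. \<nu> j)"
    by (rule sets_PiM_cong) (auto simp: \<nu>_def)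
  have ind: "(indicator (Pi\<^sub>E J A) (restrict x J) :: ennreal) = (\<Prod>j\<in>J. indicator (A j) (x j))"
    for A and x :: "'j \<Rightarrow> real"
    using J by (auto simp: indicator_def prod_zero_iff Pi_iff intro!: prod.neutral)
  have L: "?L = Pi\<^sub>M J \<nu>"
  proof (rule \<nu>p.PiM_eqI[OF J])
    fix A assume "\<And>j. j \<in> J \<Longrightarrow> A j \<in> sets (\<nu> j)"
    then have A[measurable]: "\<And>j. j \<in> J \<Longrightarrow> A j \<in> sets borel" by (simp add: \<nu>_def)
    have PA[measurable]: "Pi\<^sub>E J A \<in> sets (\<Pi>\<^sub>M j\<in>J. borel)"
      using J A by (intro sets_PiM_I_finite) auto
    have "emeasure ?L (Pi\<^sub>E J A) = (\<integral>\<^sup>+ x. indicator (Pi\<^sub>E J A) x \<partial>?L)"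
      by simp
    also have "\<dots> = (\<integral>\<^sup>+ zy. indicator (Pi\<^sub>E J A) (\<lambda>j\<in>J. p j * fst zy j + q j * snd zy j)
        \<partial>(gauss_PiM J \<Otimes>\<^sub>M gauss_PiM J))"
      by (subst nn_integral_distr) (auto simp: split_beta')
    also have "\<dots> = (\<integral>\<^sup>+ zy. (\<Prod>j\<in>J. indicator (A j) (p j * fst zy j + q j * snd zy j))
        \<partial>(gauss_PiM J \<Otimes>\<^sub>M gauss_PiM J))"
      by (simp add: ind)
    also have "\<dots> = (\<integral>\<^sup>+ z. \<integral>\<^sup>+ y. (\<Prod>j\<in>J. indicator (A j) (p j * z j + q j * y j))
        \<partial>gauss_PiM J \<partial>gauss_PiM J)"
      by (subst G.nn_integral_fst[symmetric]) auto
    also have "\<dots> = (\<integral>\<^sup>+ z. (\<Prod>j\<in>J. \<integral>\<^sup>+ y. indicator (A j) (p j * z j + q j * y) \<partial>std_gauss)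
        \<partial>gauss_PiM J)"
      using J by (subst gauss_prod.product_nn_integral_prod) auto
    also have "\<dots> = (\<Prod>j\<in>J. \<integral>\<^sup>+ x. \<integral>\<^sup>+ y. indicator (A j) (p j * x + q j * y) \<partial>std_gauss \<partial>std_gauss)"
      using J by (subst gauss_prod.product_nn_integral_prod
          [of J "\<lambda>j x. \<integral>\<^sup>+ y. indicator (A j) (p j * x + q j * y) \<partial>std_gauss"]) auto
    also have "\<dots> = (\<Prod>j\<in>J. emeasure (\<nu> j) (A j))"
    proof (rule prod.cong[OF refl])
      fix j assume j: "j \<in> J"
      have "emeasure (\<nu> j) (A j) = (\<integral>\<^sup>+ x. indicator (A j) x \<partial>\<nu> j)"
        using A[OF j] by (simp add: \<nu>_def)
      also have "\<dots> = (\<integral>\<^sup>+ x. indicator (A j) (sqrt ((p j)\<^sup>2 + (q j)\<^sup>2) * x) \<partial>std_gauss)"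
        using A[OF j] unfolding \<nu>_def by (subst nn_integral_distr) auto
      finally show "(\<integral>\<^sup>+ x. \<integral>\<^sup>+ y. indicator (A j) (p j * x + q j * y) \<partial>std_gauss \<partial>std_gauss)
          = emeasure (\<nu> j) (A j)"
        using pq[OF j] A[OF j] by (simp add: nn_integral_std_gauss_add[of "indicator (A j)"])
    qed
    finally show "emeasure ?L (Pi\<^sub>E J A) = (\<Prod>j\<in>J. emeasure (\<nu> j) (A j))" .
  qed (simp add: sets)
  have R: "?R = Pi\<^sub>M J \<nu>"
  proof (rule \<nu>p.PiM_eqI[OF J])
    fix A assume "\<And>j. j \<in> J \<Longrightarrow> A j \<in> sets (\<nu> j)"
    then have A[measurable]: "\<And>j. j \<in> J \<Longrightarrow> A j \<in> sets borel" by (simp add: \<nu>_def)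
    have PA[measurable]: "Pi\<^sub>E J A \<in> sets (\<Pi>\<^sub>M j\<in>J. borel)"
      using J A by (intro sets_PiM_I_finite) auto
    have "emeasure ?R (Pi\<^sub>E J A) = (\<integral>\<^sup>+ x. indicator (Pi\<^sub>E J A) x \<partial>?R)"
      by simp
    also have "\<dots> = (\<integral>\<^sup>+ z. (\<Prod>j\<in>J. indicator (A j) (sqrt ((p j)\<^sup>2 + (q j)\<^sup>2) * z j)) \<partial>gauss_PiM J)"
      by (subst nn_integral_distr) (auto simp: ind)
    also have "\<dots> = (\<Prod>j\<in>J. \<integral>\<^sup>+ x. indicator (A j) (sqrt ((p j)\<^sup>2 + (q j)\<^sup>2) * x) \<partial>std_gauss)"
      using J by (subst gauss_prod.product_nn_integral_prod
          [of J "\<lambda>j x. indicator (A j) (sqrt ((p j)\<^sup>2 + (q j)\<^sup>2) * x)"]) auto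
    also have "\<dots> = (\<Prod>j\<in>J. emeasure (\<nu> j) (A j))"
    proof (rule prod.cong[OF refl])
      fix j assume j: "j \<in> J"
      have "emeasure (\<nu> j) (A j) = (\<integral>\<^sup>+ x. indicator (A j) x \<partial>\<nu> j)"
        using A[OF j] by (simp add: \<nu>_def)
      also have "\<dots> = (\<integral>\<^sup>+ x. indicator (A j) (sqrt ((p j)\<^sup>2 + (q j)\<^sup>2) * x) \<partial>std_gauss)"
        using A[OF j] unfolding \<nu>_def by (subst nn_integral_distr) auto
      finally show "(\<integral>\<^sup>+ x. indicator (A j) (sqrt ((p j)\<^sup>2 + (q j)\<^sup>2) * x) \<partial>std_gauss) = emeasure (\<nu> j) (A j)"
        by simp
    qed
    finally show "emeasure ?R (Pi\<^sub>E J A) = (\<Prod>j\<in>J. emeasure (\<nu> j) (A j))" .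
  qed (simp add: sets)
  show ?thesis using L R by simp
qed

lemma integral_gauss_PiM_add:
  fixes p q :: "'j \<Rightarrow> real" and f :: "('j \<Rightarrow> real) \<Rightarrow> real"
  assumes J: "finite J" and pq: "\<And>j. j \<in> J \<Longrightarrow> 0 \<le> p j" "\<And>j. j \<in> J \<Longrightarrow> 0 \<le> q j"
    and f[measurable]: "f \<in> borel_measurable (\<Pi>\<^sub>M j\<in>J. borel)"
    and int: "integrable (gauss_PiM J) (\<lambda>z. f (\<lambda>j\<in>J. sqrt ((p j)\<^sup>2 + (q j)\<^sup>2) * z j))"
  shows "integrable (gauss_PiM J) (\<lambda>z. \<integral>y. f (\<lambda>j\<in>J. p j * z j + q j * y j) \<partial>gauss_PiM J)"
    and "(\<integral>z. f (\<lambda>j\<in>J. sqrt ((p j)\<^sup>2 + (q j)\<^sup>2) * z j) \<partial>gauss_PiM J)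
      = (\<integral>z. \<integral>y. f (\<lambda>j\<in>J. p j * z j + q j * y j) \<partial>gauss_PiM J \<partial>gauss_PiM J)"
proof -
  interpret G: prob_space "gauss_PiM J" by (rule prob_space_gauss_PiM)
  interpret GG: pair_prob_space "gauss_PiM J" "gauss_PiM J" ..
  note d = distr_gauss_PiM_add[of J p q, OF J pq]
  have int2: "integrable (gauss_PiM J \<Otimes>\<^sub>M gauss_PiM J) (\<lambda>(z, y). f (\<lambda>j\<in>J. p j * z j + q j * y j))"
  proof -
    have "integrable (distr (gauss_PiM J) (\<Pi>\<^sub>M j\<in>J. borel) (\<lambda>z. \<lambda>j\<in>J. sqrt ((p j)\<^sup>2 + (q j)\<^sup>2) * z j)) f"
      using int by (subst integrable_distr_eq) auto
    then have "integrable (distr (gauss_PiM J \<Otimes>\<^sub>M gauss_PiM J) (\<Pi>\<^sub>M j\<in>J. borel)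
        (\<lambda>(z, y). \<lambda>j\<in>J. p j * z j + q j * y j)) f"
      by (simp only: d)
    then show ?thesis
      by (subst (asm) integrable_distr_eq) (auto simp: split_beta')
  qed
  then show "integrable (gauss_PiM J) (\<lambda>z. \<integral>y. f (\<lambda>j\<in>J. p j * z j + q j * y j) \<partial>gauss_PiM J)"
    by (rule GG.integrable_fst)
  have "(\<integral>z. f (\<lambda>j\<in>J. sqrt ((p j)\<^sup>2 + (q j)\<^sup>2) * z j) \<partial>gauss_PiM J)
      = integral\<^sup>L (distr (gauss_PiM J) (\<Pi>\<^sub>M j\<in>J. borel) (\<lambda>z. \<lambda>j\<in>J. sqrt ((p j)\<^sup>2 + (q j)\<^sup>2) * z j)) f"
    by (subst integral_distr) auto
  also have "\<dots> = integral\<^sup>L (distr (gauss_PiM J \<Otimes>\<^sub>M gauss_PiM J) (\<Pi>\<^sub>M j\<in>J. borel)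
        (\<lambda>(z, y). \<lambda>j\<in>J. p j * z j + q j * y j)) f"
    by (simp only: d)
  also have "\<dots> = (\<integral>zy. f (\<lambda>j\<in>J. p j * fst zy j + q j * snd zy j) \<partial>(gauss_PiM J \<Otimes>\<^sub>M gauss_PiM J))"
    by (subst integral_distr) (auto simp: split_beta')
  also have "\<dots> = (\<integral>z. \<integral>y. f (\<lambda>j\<in>J. p j * z j + q j * y j) \<partial>gauss_PiM J \<partial>gauss_PiM J)"
    using GG.integral_fst'[OF int2] by (simp add: split_beta')
  finally show "(\<integral>z. f (\<lambda>j\<in>J. sqrt ((p j)\<^sup>2 + (q j)\<^sup>2) * z j) \<partial>gauss_PiM J)
      = (\<integral>z. \<integral>y. f (\<lambda>j\<in>J. p j * z j + q j * y j) \<partial>gauss_PiM J \<partial>gauss_PiM J)" .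
qed

section \<open>Second-order expansion of the cumulant generating function\<close>

lemma exp_taylor2_abs_le:
  fixes y :: real
  assumes "\<bar>y\<bar> \<le> 1"
  shows "\<bar>exp y - 1 - y - y\<^sup>2 / 2\<bar> \<le> \<bar>y\<bar> ^ 3 / 2"
proof -
  obtain t where t: "\<bar>t\<bar> \<le> \<bar>y\<bar>" "exp y = (\<Sum>m<3. y ^ m / fact m) + exp t / fact 3 * y ^ 3"
    using Maclaurin_exp_le[of y 3] by blast
  have "exp t \<le> exp 1" using t(1) assms by simp
  also have "\<dots> \<le> 3" by (rule exp_le)
  finally have e: "exp t \<le> 3" .
  have "exp y - 1 - y - y\<^sup>2 / 2 = exp t / 6 * y ^ 3"
    using t(2) by (simp add: numeral_eq_Suc)
  then have "\<bar>exp y - 1 - y - y\<^sup>2 / 2\<bar> = exp t / 6 * \<bar>y\<bar> ^ 3"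
    by (simp only: abs_mult power_abs abs_divide abs_exp_cancel abs_numeral)
  also have "\<dots> \<le> 3 / 6 * \<bar>y\<bar> ^ 3"
    using e by (intro mult_right_mono) auto
  finally show ?thesis by simp
qed

context prob_space
begin

lemma integrable_bounded:
  fixes X :: "'a \<Rightarrow> real"
  assumes "X \<in> borel_measurable M" "\<And>x. x \<in> space M \<Longrightarrow> \<bar>X x\<bar> \<le> m"
  shows "integrable M X"
  using assms by (intro integrable_const_bound[where B = m]) (auto intro!: AE_I2)

lemma expectation_abs_le:
  fixes X :: "'a \<Rightarrow> real"
  assumes "X \<in> borel_measurable M" "\<And>x. x \<in> space M \<Longrightarrow> \<bar>X x\<bar> \<le> m"
  shows "\<bar>expectation X\<bar> \<le> m"
proof -
  have "\<bar>expectation X\<bar> \<le> expectation (\<lambda>x. \<bar>X x\<bar>)" by (rule integral_abs_bound)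
  also have "\<dots> \<le> expectation (\<lambda>x. m)"
    using integrable_bounded[OF assms] assms(2) by (intro integral_mono) auto
  finally show ?thesis by (simp add: prob_space)
qed

lemma ln_expectation_exp_bounded:
  fixes X :: "'a \<Rightarrow> real"
  assumes [measurable]: "X \<in> borel_measurable M" and m: "\<And>x. x \<in> space M \<Longrightarrow> \<bar>X x\<bar> \<le> m"
  shows "exp (- m) \<le> expectation (\<lambda>x. exp (X x))" "expectation (\<lambda>x. exp (X x)) \<le> exp m"
    "\<bar>ln (expectation (\<lambda>x. exp (X x)))\<bar> \<le> m"
proof -
  have int: "integrable M (\<lambda>x. exp (X x))"
    using m by (intro integrable_bounded[where m = "exp m"]) (auto simp: abs_le_iff)
  have "expectation (\<lambda>x. exp (- m)) \<le> expectation (\<lambda>x. exp (X x))"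
    using m int by (intro integral_mono) (auto simp: abs_le_iff minus_le_iff)
  then show lo: "exp (- m) \<le> expectation (\<lambda>x. exp (X x))" by (simp add: prob_space)
  have "expectation (\<lambda>x. exp (X x)) \<le> expectation (\<lambda>x. exp m)"
    using m int by (intro integral_mono) (auto simp: abs_le_iff)
  then show hi: "expectation (\<lambda>x. exp (X x)) \<le> exp m" by (simp add: prob_space)
  have "0 < expectation (\<lambda>x. exp (X x))"
    using lo by (rule less_le_trans[OF exp_gt_zero])
  then show "\<bar>ln (expectation (\<lambda>x. exp (X x)))\<bar> \<le> m"
    using lo hi ln_ge_iff[of "expectation (\<lambda>x. exp (X x))" "- m"]
      ln_le_cancel_iff[of "expectation (\<lambda>x. exp (X x))" "exp m"] by (auto simp: abs_le_iff)
qed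

text \<open>The bound is needed for every \<open>m\<close>, because it is applied with
  \<open>m\<close> proportional to the unbounded sum of the \<bar>z j\<bar>. For 2 m > 1 the crude
  estimate 2 m + m^2 / 2 already lies below 16 m^3. Otherwise \<open>X\<close> is centred, so that
  it is bounded by d = 2 m \<le> 1, and both the Taylor error of exp and the error of ln (1 + u)
  \<approx> u are of order d^3; 16 m^3 is 2 d^3.\<close>

lemma ln_expectation_exp_approx:
  fixes X :: "'a \<Rightarrow> real"
  assumes [measurable]: "X \<in> borel_measurable M" and m: "\<And>x. x \<in> space M \<Longrightarrow> \<bar>X x\<bar> \<le> m"
  shows "\<bar>ln (expectation (\<lambda>x. exp (X x))) - expectation X
    - (expectation (\<lambda>x. (X x)\<^sup>2) - (expectation X)\<^sup>2) / 2\<bar> \<le> 16 * m ^ 3"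
proof -
  define e where "e = expectation X"
  define V where "V = expectation (\<lambda>x. (X x)\<^sup>2) - e\<^sup>2"
  have e: "\<bar>e\<bar> \<le> m" unfolding e_def by (rule expectation_abs_le) (use m in auto)
  then have m0: "0 \<le> m" by linarith
  have int: "integrable M X" by (rule integrable_bounded[OF _ m]) auto
  have int2: "integrable M (\<lambda>x. (X x)\<^sup>2)"
    by (rule integrable_bounded[where m = "m\<^sup>2"]) (use m m0 in \<open>auto simp: abs_le_square_iff[symmetric]\<close>)
  have intexp: "integrable M (\<lambda>x. exp (X x))"
    by (rule integrable_bounded[where m = "exp m"]) (use m in \<open>auto simp: abs_le_iff\<close>)
  have Y: "\<bar>X x - e\<bar> \<le> 2 * m" if "x \<in> space M" for x
    using m[OF that] e by linarith
  have intY2: "integrable M (\<lambda>x. (X x - e)\<^sup>2)"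
    using int int2 by (auto simp: power2_diff)
  have V: "V = expectation (\<lambda>x. (X x - e)\<^sup>2)"
    using int int2 by (simp add: power2_diff V_def e_def prob_space) (simp add: power2_eq_square)
  have "expectation (\<lambda>x. (X x)\<^sup>2) \<le> expectation (\<lambda>x. m\<^sup>2)"
    using int2 m m0 by (intro integral_mono) (auto simp: abs_le_square_iff[symmetric])
  then have Vm: "V \<le> m\<^sup>2" by (simp add: V_def prob_space) (smt (verit) zero_le_power2)
  have V0: "0 \<le> V" unfolding V by (rule Bochner_Integration.integral_nonneg) auto
  show ?thesis
  proof (cases "2 * m \<le> 1")
    case False
    have "\<bar>ln (expectation (\<lambda>x. exp (X x))) - e - V / 2\<bar> \<le> m + m + m\<^sup>2 / 2"
      using ln_expectation_exp_bounded(3)[OF assms(1) m] e Vm V0 by linarith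
    also have "\<dots> \<le> 16 * m ^ 3"
    proof -
      have "(1/2) * m \<le> m * m" "(1/2) * m\<^sup>2 \<le> m * m\<^sup>2"
        using False by (auto intro!: mult_right_mono)
      then show ?thesis using m0 by (simp add: power2_eq_square power3_eq_cube)
    qed
    finally show ?thesis unfolding V_def e_def .
  next
    case True
    define d where "d = 2 * m"
    have d: "0 \<le> d" "d \<le> 1" using True m0 by (auto simp: d_def)
    have Yd: "\<bar>X x - e\<bar> \<le> d" if "x \<in> space M" for x
      using Y[OF that] by (simp add: d_def)
    define u where "u = expectation (\<lambda>x. exp (X x - e)) - 1"
    have intE: "integrable M (\<lambda>x. exp (X x - e))"
      using intexp by (simp add: exp_diff)
    have R: "\<bar>exp (X x - e) - 1 - (X x - e) - (X x - e)\<^sup>2 / 2\<bar> \<le> d ^ 3 / 2" if "x \<in> space M" for x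
    proof -
      have "\<bar>exp (X x - e) - 1 - (X x - e) - (X x - e)\<^sup>2 / 2\<bar> \<le> \<bar>X x - e\<bar> ^ 3 / 2"
        using Yd[OF that] d by (intro exp_taylor2_abs_le) auto
      also have "\<dots> \<le> d ^ 3 / 2" using Yd[OF that] by (simp add: power_mono)
      finally show ?thesis .
    qed
    have "u - V / 2 = expectation (\<lambda>x. exp (X x - e) - 1 - (X x - e) - (X x - e)\<^sup>2 / 2)"
      using int intE intY2 by (simp add: u_def V prob_space e_def[symmetric])
    then have uV: "\<bar>u - V / 2\<bar> \<le> d ^ 3 / 2"
      using R by (simp only:) (rule expectation_abs_le, auto)
    have "d\<^sup>2 = 4 * m\<^sup>2" by (simp add: d_def power_mult_distrib)
    then have V4: "V \<le> d\<^sup>2"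
      using Vm zero_le_power2[of m] by linarith
    have d32: "d ^ 3 \<le> d\<^sup>2" using d by (intro power_decreasing) auto
    have u1: "u \<le> d\<^sup>2" using abs_le_D1[OF uV] V4 d32 by linarith
    have d21: "d\<^sup>2 \<le> 1" using d by (simp add: power_le_one)
    \<comment> \<open>Jensen's inequality for the centred variable: \<open>u\<close> is nonnegative,
      so ln (1 + u) lies between u - u^2 and u.\<close>
    have "expectation (\<lambda>x. 1 + (X x - e)) \<le> expectation (\<lambda>x. exp (X x - e))"
      using int intE by (intro integral_mono) (auto simp: exp_ge_add_one_self)
    then have u0: "0 \<le> u" using int by (simp add: u_def prob_space e_def[symmetric])
    have l1: "ln (1 + u) \<le> u" using u0 by (rule ln_add_one_self_le_self)
    have l2: "u - u\<^sup>2 \<le> ln (1 + u)" using u0 u1 d21 by (intro ln_one_plus_pos_lower_bound) auto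
    have "u\<^sup>2 \<le> (d\<^sup>2)\<^sup>2" using u0 u1 by (rule power_mono[rotated])
    also have "\<dots> \<le> d ^ 3" unfolding power_mult[symmetric] using d by (intro power_decreasing) auto
    finally have u2: "u\<^sup>2 \<le> d ^ 3" .
    have "expectation (\<lambda>x. exp (X x)) = exp e * (1 + u)"
      by (simp add: u_def exp_diff)
    then have "ln (expectation (\<lambda>x. exp (X x))) = e + ln (1 + u)"
      using u0 by (simp add: ln_mult)
    then have "\<bar>ln (expectation (\<lambda>x. exp (X x))) - e - V / 2\<bar> \<le> 2 * d ^ 3"
      using l1 l2 uV u2 d by (simp add: abs_le_iff) (smt (verit) zero_le_power)
    also have "\<dots> = 16 * m ^ 3" by (simp add: d_def power_mult_distrib)
    finally show ?thesis unfolding V_def e_def .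
  qed
qed

text \<open>Twice the variance of \<open>c j\<close> is the mean of
  \<open>(c j x - c j y)\<^sup>2\<close> over two independent copies x and y. The hypothesis is
  therefore integrated twice, and \<open>D\<close> becomes \<open>D / 2\<close>. The function
  \<open>\<phi> j\<close> is the inner average over y.\<close>

lemma variance_sum_le:
  fixes c :: "'j \<Rightarrow> 'a \<Rightarrow> real"
  assumes fin: "finite A" "finite B"
    and c[measurable]: "\<And>j. j \<in> A \<union> B \<Longrightarrow> c j \<in> borel_measurable M"
    and bd: "\<And>j x. j \<in> A \<union> B \<Longrightarrow> x \<in> space M \<Longrightarrow> \<bar>c j x\<bar> \<le> K"
    and le: "\<And>x y. x \<in> space M \<Longrightarrow> y \<in> space M \<Longrightarrow>
      (\<Sum>j\<in>A. (c j x - c j y)\<^sup>2) \<le> (\<Sum>j\<in>B. (c j x - c j y)\<^sup>2) + D"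
  shows "(\<Sum>j\<in>A. variance (c j)) \<le> (\<Sum>j\<in>B. variance (c j)) + D / 2"
proof -
  have int: "integrable M (c j)" if "j \<in> A \<union> B" for j
    by (rule integrable_bounded[OF c bd]) (use that in auto)
  have int2: "integrable M (\<lambda>x. (c j x)\<^sup>2)" if "j \<in> A \<union> B" for j
    by (rule integrable_bounded[where m = "K\<^sup>2"])
      (use that bd in \<open>auto simp: abs_le_square_iff[symmetric] intro: order_trans[OF _ abs_ge_self]\<close>)
  have inner: "integrable M (\<lambda>y. (c j x - c j y)\<^sup>2)"
    "expectation (\<lambda>y. (c j x - c j y)\<^sup>2) = (c j x)\<^sup>2 - 2 * c j x * expectation (c j) + expectation (\<lambda>y. (c j y)\<^sup>2)"
    if "j \<in> A \<union> B" for j x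
    using int[OF that] int2[OF that] by (simp_all add: power2_diff prob_space)
  define \<phi> where "\<phi> j x = (c j x)\<^sup>2 - 2 * c j x * expectation (c j) + expectation (\<lambda>y. (c j y)\<^sup>2)" for j x
  have outer: "integrable M (\<phi> j)" "expectation (\<phi> j) = 2 * variance (c j)" if "j \<in> A \<union> B" for j
    using int[OF that] int2[OF that] unfolding \<phi>_def[abs_def]
    by (simp_all add: prob_space variance_eq) (simp add: power2_eq_square)
  have "(\<Sum>j\<in>A. \<phi> j x) \<le> (\<Sum>j\<in>B. \<phi> j x) + D" if x: "x \<in> space M" for x
  proof -
    have "expectation (\<lambda>y. \<Sum>j\<in>A. (c j x - c j y)\<^sup>2) \<le> expectation (\<lambda>y. (\<Sum>j\<in>B. (c j x - c j y)\<^sup>2) + D)"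
      using le[OF x] inner by (intro integral_mono) auto
    then show ?thesis
      using inner by (simp add: Bochner_Integration.integral_sum \<phi>_def prob_space)
  qed
  then have "expectation (\<lambda>x. \<Sum>j\<in>A. \<phi> j x) \<le> expectation (\<lambda>x. (\<Sum>j\<in>B. \<phi> j x) + D)"
    using outer by (intro integral_mono) auto
  then have "(\<Sum>j\<in>A. 2 * variance (c j)) \<le> (\<Sum>j\<in>B. 2 * variance (c j)) + D"
    using outer by (simp add: Bochner_Integration.integral_sum prob_space)
  then show ?thesis by (simp add: sum_distrib_left[symmetric])
qed

end

section \<open>Comparison of Gaussian free energies\<close>

lemma power3_le_exp:
  fixes x :: real
  assumes "0 \<le> x"
  shows "x ^ 3 \<le> 27 * exp x"
proof -
  have "(x / 3) ^ 3 \<le> exp (x / 3) ^ 3"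
    using assms exp_ge_add_one_self[of "x / 3"] by (intro power_mono) linarith+
  also have "\<dots> = exp x" by (simp flip: exp_of_nat_mult)
  finally show ?thesis by (simp add: power_divide)
qed

text \<open>In the application \<open>\<mu>\<close> is the product of the sphere measures restricted
  to the overlap set, hence finite but not normalised, and the bound \<open>K\<close> holds because
  the overlap set lies on the spheres. Both fields of the comparison are indexed by subsets of the
  one set \<open>J\<close>, so that they live on one Gaussian space.\<close>

locale gauss_field = finite_measure \<mu> for \<mu> :: "'s measure" +
  fixes c :: "'j \<Rightarrow> 's \<Rightarrow> real" and J :: "'j set" and K :: real
  assumes fin: "finite J"
    and c_meas: "\<And>j. j \<in> J \<Longrightarrow> c j \<in> borel_measurable \<mu>"
    and c_bd: "\<And>j x. j \<in> J \<Longrightarrow> x \<in> space \<mu> \<Longrightarrow> \<bar>c j x\<bar> \<le> K"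
    and pos: "0 < measure \<mu> (space \<mu>)"
    and K: "0 \<le> K"
begin

definition fe :: "('s \<Rightarrow> real) \<Rightarrow> real" where
  "fe W = ln (\<integral>x. exp (W x) \<partial>\<mu>)"

lemma integrable_bounded:
  assumes "f \<in> borel_measurable \<mu>" "\<And>x. x \<in> space \<mu> \<Longrightarrow> \<bar>f x :: real\<bar> \<le> m"
  shows "integrable \<mu> f"
  using assms by (intro integrable_const_bound[where B = m]) (auto intro!: AE_I2)

lemma integral_exp_bounds:
  assumes [measurable]: "W \<in> borel_measurable \<mu>" and m: "\<And>x. x \<in> space \<mu> \<Longrightarrow> \<bar>W x\<bar> \<le> m"
  shows "integrable \<mu> (\<lambda>x. exp (W x))"
    "exp (- m) * measure \<mu> (space \<mu>) \<le> (\<integral>x. exp (W x) \<partial>\<mu>)"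
    "(\<integral>x. exp (W x) \<partial>\<mu>) \<le> exp m * measure \<mu> (space \<mu>)"
    "0 < (\<integral>x. exp (W x) \<partial>\<mu>)"
proof -
  show int: "integrable \<mu> (\<lambda>x. exp (W x))"
    using m by (intro integrable_bounded[where m = "exp m"]) (auto simp: abs_le_iff)
  have "(\<integral>x. exp (- m) \<partial>\<mu>) \<le> (\<integral>x. exp (W x) \<partial>\<mu>)"
    using m int by (intro integral_mono) (auto simp: abs_le_iff minus_le_iff)
  then show lo: "exp (- m) * measure \<mu> (space \<mu>) \<le> (\<integral>x. exp (W x) \<partial>\<mu>)" by (simp add: mult.commute)
  have "(\<integral>x. exp (W x) \<partial>\<mu>) \<le> (\<integral>x. exp m \<partial>\<mu>)"
    using m int by (intro integral_mono) (auto simp: abs_le_iff)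
  then show "(\<integral>x. exp (W x) \<partial>\<mu>) \<le> exp m * measure \<mu> (space \<mu>)" by (simp add: mult.commute)
  show "0 < (\<integral>x. exp (W x) \<partial>\<mu>)"
    by (rule less_le_trans[OF _ lo]) (simp add: pos)
qed

lemma fe_abs_le:
  assumes "W \<in> borel_measurable \<mu>" "\<And>x. x \<in> space \<mu> \<Longrightarrow> \<bar>W x\<bar> \<le> m"
  shows "\<bar>fe W\<bar> \<le> \<bar>ln (measure \<mu> (space \<mu>))\<bar> + m"
proof -
  note b = integral_exp_bounds[OF assms]
  have "ln (exp (- m) * measure \<mu> (space \<mu>)) \<le> fe W"
    unfolding fe_def using b(2,4) pos by (subst ln_le_cancel_iff) auto
  moreover have "fe W \<le> ln (exp m * measure \<mu> (space \<mu>))"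
    unfolding fe_def using b(3,4) pos by (subst ln_le_cancel_iff) auto
  ultimately show ?thesis using pos by (simp add: ln_mult)
qed

definition gibbs :: "('s \<Rightarrow> real) \<Rightarrow> 's measure" where
  "gibbs W = density \<mu> (\<lambda>x. ennreal (exp (W x) / (\<integral>x. exp (W x) \<partial>\<mu>)))"

lemma sets_gibbs [simp, measurable_cong]: "sets (gibbs W) = sets \<mu>"
  and space_gibbs [simp]: "space (gibbs W) = space \<mu>"
  by (simp_all add: gibbs_def)

lemma prob_space_gibbs:
  assumes [measurable]: "W \<in> borel_measurable \<mu>" and "\<And>x. x \<in> space \<mu> \<Longrightarrow> \<bar>W x\<bar> \<le> m"
  shows "prob_space (gibbs W)"
proof
  note b = integral_exp_bounds[OF assms]
  have "emeasure (gibbs W) (space (gibbs W)) = (\<integral>\<^sup>+ x. ennreal (exp (W x) / (\<integral>x. exp (W x) \<partial>\<mu>)) \<partial>\<mu>)"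
    unfolding gibbs_def by (subst emeasure_density) (auto intro!: nn_integral_cong)
  also have "\<dots> = ennreal (\<integral>x. exp (W x) / (\<integral>x. exp (W x) \<partial>\<mu>) \<partial>\<mu>)"
    using b by (intro nn_integral_eq_integral) (auto intro!: divide_nonneg_nonneg)
  also have "\<dots> = 1" using b by simp
  finally show "emeasure (gibbs W) (space (gibbs W)) = 1" .
qed

lemma fe_add:
  assumes W[measurable]: "W \<in> borel_measurable \<mu>" and Wm: "\<And>x. x \<in> space \<mu> \<Longrightarrow> \<bar>W x\<bar> \<le> m"
    and X[measurable]: "X \<in> borel_measurable \<mu>" and Xm: "\<And>x. x \<in> space \<mu> \<Longrightarrow> \<bar>X x\<bar> \<le> m'"
  shows "fe (\<lambda>x. W x + X x) = fe W + ln (\<integral>x. exp (X x) \<partial>gibbs W)"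
proof -
  define Z where "Z = (\<integral>x. exp (W x) \<partial>\<mu>)"
  have Z: "0 < Z" unfolding Z_def by (rule integral_exp_bounds[OF W Wm])
  interpret G: prob_space "gibbs W" by (rule prob_space_gibbs[OF W Wm])
  have E: "(\<integral>x. exp (X x) \<partial>gibbs W) = (\<integral>x. exp (W x + X x) \<partial>\<mu>) / Z"
    unfolding gibbs_def Z_def[symmetric] using Z
    by (subst integral_density) (auto simp: exp_add)
  have "0 < (\<integral>x. exp (W x + X x) \<partial>\<mu>)"
    by (rule integral_exp_bounds[where m = "m + m'"]) (use Wm Xm in \<open>auto intro: order_trans[OF abs_triangle_ineq add_mono]\<close>)
  then show ?thesis unfolding E using Z by (simp add: fe_def Z_def[symmetric] ln_div)
qed

definition abs_moment3 :: real where
  "abs_moment3 = (\<integral>z. (\<Sum>j\<in>J. \<bar>z j\<bar>) ^ 3 \<partial>gauss_PiM J)"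

lemma integrable_abs_moments:
  "integrable (gauss_PiM J) (\<lambda>z. \<Sum>j\<in>J. \<bar>z j\<bar>)"
  "integrable (gauss_PiM J) (\<lambda>z. (\<Sum>j\<in>J. \<bar>z j\<bar>) ^ 3)"
proof -
  have n: "0 \<le> (\<Sum>j\<in>J. \<bar>z j\<bar>)" for z :: "'j \<Rightarrow> real" by (simp add: sum_nonneg)
  show "integrable (gauss_PiM J) (\<lambda>z. \<Sum>j\<in>J. \<bar>z j\<bar>)"
  proof (rule Bochner_Integration.integrable_bound[OF integrable_exp_abs_gauss_PiM[OF fin]])
    show "AE z in gauss_PiM J. norm (\<Sum>j\<in>J. \<bar>z j\<bar>) \<le> norm (exp (\<Sum>j\<in>J. \<bar>z j\<bar>))"
      using n by (auto intro!: AE_I2 order_trans[OF _ exp_ge_add_one_self])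
  qed auto
  show "integrable (gauss_PiM J) (\<lambda>z. (\<Sum>j\<in>J. \<bar>z j\<bar>) ^ 3)"
  proof (rule Bochner_Integration.integrable_bound[OF integrable_mult_right[OF integrable_exp_abs_gauss_PiM[OF fin], of 27]])
    show "AE z in gauss_PiM J. norm ((\<Sum>j\<in>J. \<bar>z j\<bar>) ^ 3) \<le> norm (27 * exp (\<Sum>j\<in>J. \<bar>z j\<bar>))"
      using n power3_le_exp by (auto intro!: AE_I2 simp: power_abs)
  qed auto
qed

lemma fe_field_measurable:
  assumes [measurable]: "W \<in> borel_measurable \<mu>" and I: "I \<subseteq> J"
  shows "(\<lambda>z. fe (\<lambda>x. W x + (\<Sum>j\<in>I. a j * z j * c j x))) \<in> borel_measurable (\<Pi>\<^sub>M j\<in>J. borel)"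
proof -
  have c[measurable]: "\<And>j. j \<in> I \<Longrightarrow> c j \<in> borel_measurable \<mu>"
    using I c_meas by auto
  have z[measurable]: "\<And>j. j \<in> I \<Longrightarrow> (\<lambda>z. z j :: real) \<in> borel_measurable (\<Pi>\<^sub>M j\<in>J. borel)"
    using I by (auto intro: measurable_component_singleton)
  have "(\<lambda>(z, x). exp (W x + (\<Sum>j\<in>I. a j * z j * c j x))) \<in> borel_measurable ((\<Pi>\<^sub>M j\<in>J. borel) \<Otimes>\<^sub>M \<mu>)"
    unfolding split_beta'
    by (intro measurable_compose[OF _ borel_measurable_exp] borel_measurable_add borel_measurable_sum borel_measurable_times)
      (auto intro: measurable_compose[OF measurable_fst z] measurable_compose[OF measurable_snd c])
  then have "(\<lambda>z. \<integral>x. exp (W x + (\<Sum>j\<in>I. a j * z j * c j x)) \<partial>\<mu>) \<in> borel_measurable (\<Pi>\<^sub>M j\<in>J. borel)"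
    by (rule borel_measurable_lebesgue_integral)
  then show ?thesis
    unfolding fe_def by (rule borel_measurable_ln)
qed

lemma field_abs_le:
  assumes I: "I \<subseteq> J" and a: "\<And>j. j \<in> I \<Longrightarrow> \<bar>a j\<bar> \<le> s" and x: "x \<in> space \<mu>" and "0 \<le> s"
  shows "\<bar>\<Sum>j\<in>I. a j * z j * c j x\<bar> \<le> s * K * (\<Sum>j\<in>J. \<bar>z j\<bar>)"
proof -
  have "\<bar>\<Sum>j\<in>I. a j * z j * c j x\<bar> \<le> (\<Sum>j\<in>I. \<bar>a j\<bar> * \<bar>z j\<bar> * \<bar>c j x\<bar>)"
    by (rule order_trans[OF sum_abs]) (simp add: abs_mult)
  also have "\<dots> \<le> (\<Sum>j\<in>I. s * \<bar>z j\<bar> * K)"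
    using assms c_bd K by (intro sum_mono mult_mono) auto
  also have "\<dots> \<le> (\<Sum>j\<in>J. s * \<bar>z j\<bar> * K)"
    using assms K fin by (intro sum_mono2) auto
  finally show ?thesis by (simp add: sum_distrib_left mult_ac)
qed

lemma field_measurable:
  "I \<subseteq> J \<Longrightarrow> (\<lambda>x. \<Sum>j\<in>I. a j * z j * c j x) \<in> borel_measurable \<mu>"
  using c_meas by (intro borel_measurable_sum borel_measurable_times) auto

lemma fe_field_integrable:
  assumes W[measurable]: "W \<in> borel_measurable \<mu>" and Wm: "\<And>x. x \<in> space \<mu> \<Longrightarrow> \<bar>W x\<bar> \<le> m"
    and I: "I \<subseteq> J"
  shows "integrable (gauss_PiM J) (\<lambda>z. fe (\<lambda>x. W x + (\<Sum>j\<in>I. a j * z j * c j x)))"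
proof -
  define s where "s = (\<Sum>j\<in>I. \<bar>a j\<bar>)"
  have fI: "finite I" using I fin by (rule finite_subset)
  have s: "\<And>j. j \<in> I \<Longrightarrow> \<bar>a j\<bar> \<le> s" "0 \<le> s"
    unfolding s_def using fI by (auto intro: member_le_sum sum_nonneg)
  interpret G: prob_space "gauss_PiM J" by (rule prob_space_gauss_PiM)
  have bd: "\<bar>fe (\<lambda>x. W x + (\<Sum>j\<in>I. a j * z j * c j x))\<bar>
      \<le> \<bar>ln (measure \<mu> (space \<mu>))\<bar> + (m + s * K * (\<Sum>j\<in>J. \<bar>z j\<bar>))" for z
    using field_abs_le[of I a s] I s Wm field_measurable[OF I]
    by (intro fe_abs_le) (auto intro: order_trans[OF abs_triangle_ineq add_mono])
  show ?thesis
  proof (rule Bochner_Integration.integrable_bound)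
    show "integrable (gauss_PiM J) (\<lambda>z. \<bar>ln (measure \<mu> (space \<mu>))\<bar> + (m + s * K * (\<Sum>j\<in>J. \<bar>z j\<bar>)))"
      using integrable_abs_moments by auto
    show "AE z in gauss_PiM J. norm (fe (\<lambda>x. W x + (\<Sum>j\<in>I. a j * z j * c j x)))
        \<le> norm (\<bar>ln (measure \<mu> (space \<mu>))\<bar> + (m + s * K * (\<Sum>j\<in>J. \<bar>z j\<bar>)))"
      using order_trans[OF bd abs_ge_self] by (auto intro!: AE_I2)
    have "(\<lambda>z. fe (\<lambda>x. W x + (\<Sum>j\<in>I. a j * z j * c j x))) \<in> borel_measurable (\<Pi>\<^sub>M j\<in>J. borel)"
      by (rule fe_field_measurable) (use I in auto)
    then show "(\<lambda>z. fe (\<lambda>x. W x + (\<Sum>j\<in>I. a j * z j * c j x))) \<in> borel_measurable (gauss_PiM J)"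
      by (simp cong: measurable_cong_sets sets_PiM_cong)
  qed
qed

text \<open>Adding a small Gaussian field to \<open>W\<close> changes the free energy by the
  cumulant generating function of that field under the Gibbs measure of \<open>W\<close>. Averaged
  over the Gaussian coefficients, the linear term vanishes and, in the quadratic term, so do the
  covariances of distinct indices. Only the Gibbs variances remain; the cubic error is integrated
  through a third absolute moment.\<close>

lemma fe_perturb:
  assumes W[measurable]: "W \<in> borel_measurable \<mu>" and Wm: "\<And>x. x \<in> space \<mu> \<Longrightarrow> \<bar>W x\<bar> \<le> m"
    and I: "I \<subseteq> J" and s: "0 \<le> s"
  shows "\<bar>(\<integral>z. fe (\<lambda>x. W x + (\<Sum>j\<in>I. s * z j * c j x)) \<partial>gauss_PiM J) - fe W
     - s\<^sup>2 / 2 * (\<Sum>j\<in>I. prob_space.variance (gibbs W) (c j))\<bar> \<le> 16 * (s * K) ^ 3 * abs_moment3"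
proof -
  have fI: "finite I" using I fin by (rule finite_subset)
  interpret \<gamma>: prob_space "gauss_PiM J" by (rule prob_space_gauss_PiM)
  interpret G: prob_space "gibbs W" by (rule prob_space_gibbs[OF W Wm])
  have c[measurable]: "\<And>j. j \<in> I \<Longrightarrow> c j \<in> borel_measurable \<mu>"
    using I c_meas by auto
  have cK: "\<And>j x. j \<in> I \<Longrightarrow> x \<in> space \<mu> \<Longrightarrow> \<bar>c j x\<bar> \<le> K"
    using I c_bd by auto
  have int: "integrable (gibbs W) (c j)" if "j \<in> I" for j
    using that cK by (intro G.integrable_bounded[where m = K]) auto
  have int2: "integrable (gibbs W) (\<lambda>x. c i x * c j x)" if "i \<in> I" "j \<in> I" for i j
  proof (rule G.integrable_bounded[where m = "K * K"])
    show "\<bar>c i x * c j x\<bar> \<le> K * K" if "x \<in> space (gibbs W)" for x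
      unfolding abs_mult using cK \<open>i \<in> I\<close> \<open>j \<in> I\<close> that K by (intro mult_mono) auto
  qed (use that in auto)
  define X where "X z x = (\<Sum>j\<in>I. s * z j * c j x)" for z x
  have X[measurable]: "X z \<in> borel_measurable \<mu>" for z
    unfolding X_def using field_measurable[OF I, of "\<lambda>_. s" z] .
  define b where "b z = s * K * (\<Sum>j\<in>J. \<bar>z j\<bar>)" for z :: "'j \<Rightarrow> real"
  have Xb: "\<bar>X z x\<bar> \<le> b z" if "x \<in> space \<mu>" for z x
    unfolding X_def b_def using field_abs_le[OF I _ that s, of "\<lambda>_. s"] s by simp
  define e where "e j = G.expectation (c j)" for j
  define C where "C i j = G.expectation (\<lambda>x. c i x * c j x) - e i * e j" for i j
  have EX: "G.expectation (X z) = (\<Sum>j\<in>I. s * e j * z j)" for z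
    unfolding X_def[abs_def] e_def using int by (simp add: Bochner_Integration.integral_sum mult_ac)
  have EX2: "G.expectation (\<lambda>x. (X z x)\<^sup>2) - (G.expectation (X z))\<^sup>2 = (\<Sum>i\<in>I. \<Sum>j\<in>I. s\<^sup>2 * C i j * (z i * z j))" for z
  proof -
    have "G.expectation (\<lambda>x. (X z x)\<^sup>2) = G.expectation (\<lambda>x. \<Sum>i\<in>I. \<Sum>j\<in>I. (s\<^sup>2 * (z i * z j)) * (c i x * c j x))"
      unfolding X_def power2_eq_square sum_product by (simp add: mult_ac)
    also have "\<dots> = (\<Sum>i\<in>I. \<Sum>j\<in>I. (s\<^sup>2 * (z i * z j)) * G.expectation (\<lambda>x. c i x * c j x))"
      using int2 by (simp add: Bochner_Integration.integral_sum)
    finally show ?thesis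
      unfolding EX C_def power2_eq_square sum_product
      by (simp add: sum_subtractf[symmetric] algebra_simps)
  qed
  \<comment> \<open>The cumulant expansion up to order two, as a polynomial in the Gaussian
    coefficients.\<close>
  define g where "g z = (\<Sum>j\<in>I. s * e j * z j) + (\<Sum>i\<in>I. \<Sum>j\<in>I. s\<^sup>2 * C i j * (z i * z j)) / 2" for z
  have m1: "integrable (gauss_PiM J) (\<lambda>z. z j)" "(\<integral>z. z j \<partial>gauss_PiM J) = 0" if "j \<in> I" for j
    using gauss_PiM_moments[OF fin, of j] that I by auto
  have m2: "integrable (gauss_PiM J) (\<lambda>z. z i * z j)"
    "(\<integral>z. z i * z j \<partial>gauss_PiM J) = (if i = j then 1 else 0)" if "i \<in> I" "j \<in> I" for i j
    using gauss_PiM_second_moments[OF fin subsetD[OF I that(1)] subsetD[OF I that(2)]] by auto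
  have int1: "integrable (gauss_PiM J) (\<lambda>z. \<Sum>j\<in>I. s * e j * z j)"
    by (intro Bochner_Integration.integrable_sum integrable_mult_right m1)
  have int3: "integrable (gauss_PiM J) (\<lambda>z. (\<Sum>i\<in>I. \<Sum>j\<in>I. s\<^sup>2 * C i j * (z i * z j)) / 2)"
    by (intro Bochner_Integration.integrable_sum integrable_mult_right integrable_divide m2)
  have intg: "integrable (gauss_PiM J) g"
    unfolding g_def[abs_def] by (intro Bochner_Integration.integrable_add int1 int3)
  have Eg: "(\<integral>z. g z \<partial>gauss_PiM J) = s\<^sup>2 / 2 * (\<Sum>j\<in>I. G.variance (c j))"
  proof -
    have "(\<integral>z. g z \<partial>gauss_PiM J) = (\<Sum>j\<in>I. s * e j * (\<integral>z. z j \<partial>gauss_PiM J))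
        + (\<Sum>i\<in>I. \<Sum>j\<in>I. s\<^sup>2 * C i j * (\<integral>z. z i * z j \<partial>gauss_PiM J)) / 2"
      unfolding g_def Bochner_Integration.integral_add[OF int1 int3]
      using m1 m2 by (simp add: Bochner_Integration.integral_sum)
    also have "\<dots> = (\<Sum>i\<in>I. \<Sum>j\<in>I. s\<^sup>2 * C i j * (if i = j then 1 else 0)) / 2"
      using m1 m2 by simp
    also have "\<dots> = (\<Sum>i\<in>I. s\<^sup>2 * C i i) / 2"
      using fI by (simp add: if_distrib cong: if_cong)
    also have "(\<Sum>i\<in>I. s\<^sup>2 * C i i) = (\<Sum>i\<in>I. s\<^sup>2 * G.variance (c i))"
    proof (intro sum.cong refl)
      fix i assume "i \<in> I"
      then show "s\<^sup>2 * C i i = s\<^sup>2 * G.variance (c i)"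
        using G.variance_eq[of "c i"] int[of i] int2[of i i] unfolding C_def e_def power2_eq_square by simp
    qed
    finally show ?thesis by (simp add: sum_distrib_left[symmetric])
  qed
  have pw: "\<bar>fe (\<lambda>x. W x + X z x) - fe W - g z\<bar> \<le> 16 * (b z) ^ 3" for z
  proof -
    have "fe (\<lambda>x. W x + X z x) = fe W + ln (G.expectation (\<lambda>x. exp (X z x)))"
      by (rule fe_add[OF W Wm X Xb])
    moreover have "\<bar>ln (G.expectation (\<lambda>x. exp (X z x))) - G.expectation (X z)
        - (G.expectation (\<lambda>x. (X z x)\<^sup>2) - (G.expectation (X z))\<^sup>2) / 2\<bar> \<le> 16 * (b z) ^ 3"
      by (rule G.ln_expectation_exp_approx) (use Xb in auto)
    moreover have "g z = G.expectation (X z) + (G.expectation (\<lambda>x. (X z x)\<^sup>2) - (G.expectation (X z))\<^sup>2) / 2"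
      by (simp only: g_def EX2) (simp only: EX)
    ultimately show ?thesis by simp
  qed
  have intf: "integrable (gauss_PiM J) (\<lambda>z. fe (\<lambda>x. W x + X z x))"
    unfolding X_def using fe_field_integrable[OF W Wm I, of "\<lambda>_. s"] by simp
  have intb: "integrable (gauss_PiM J) (\<lambda>z. 16 * (b z) ^ 3)"
    unfolding b_def power_mult_distrib using integrable_abs_moments(2) by auto
  have "\<bar>(\<integral>z. fe (\<lambda>x. W x + X z x) - fe W - g z \<partial>gauss_PiM J)\<bar>
      \<le> (\<integral>z. \<bar>fe (\<lambda>x. W x + X z x) - fe W - g z\<bar> \<partial>gauss_PiM J)"
    by (rule integral_abs_bound)
  also have "\<dots> \<le> (\<integral>z. 16 * (b z) ^ 3 \<partial>gauss_PiM J)"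
    using intf intg intb pw by (intro integral_mono) auto
  also have "\<dots> = 16 * (s * K) ^ 3 * abs_moment3"
    unfolding b_def abs_moment3_def power_mult_distrib by simp
  finally show ?thesis
    using intf intg by (simp add: \<gamma>.prob_space Eg X_def)
qed

section \<open>Exchanging the two fields piece by piece\<close>

definition avg_fe :: "('j \<Rightarrow> real) \<Rightarrow> real" where
  "avg_fe a = (\<integral>z. fe (\<lambda>x. \<Sum>j\<in>J. a j * z j * c j x) \<partial>gauss_PiM J)"

text \<open>Both sides contain a common field with coefficients \<open>p\<close> and one fresh piece
  of size \<open>s\<close>, carried by \<open>A\<close> or by \<open>B\<close>. Given the common
  field, each piece contributes s^2 / 2 times a sum of variances under the same Gibbs measure, and
  these sums differ by at most \<open>D / 2\<close>; this gives s^2 D / 4. The two expansions each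
  cost an error with constant 16, together 32.\<close>

lemma avg_fe_step:
  assumes p: "\<And>j. j \<in> J \<Longrightarrow> 0 \<le> p j" and s: "0 \<le> s" and AB: "A \<subseteq> J" "B \<subseteq> J"
    and le: "\<And>x y. x \<in> space \<mu> \<Longrightarrow> y \<in> space \<mu> \<Longrightarrow>
      (\<Sum>j\<in>A. (c j x - c j y)\<^sup>2) \<le> (\<Sum>j\<in>B. (c j x - c j y)\<^sup>2) + D"
  shows "avg_fe (\<lambda>j. sqrt ((p j)\<^sup>2 + s\<^sup>2 * indicator A j)) \<le> avg_fe (\<lambda>j. sqrt ((p j)\<^sup>2 + s\<^sup>2 * indicator B j))
    + s\<^sup>2 * D / 4 + 32 * (s * K) ^ 3 * abs_moment3"
proof -
  interpret \<gamma>: prob_space "gauss_PiM J" by (rule prob_space_gauss_PiM)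
  define W where "W z x = (\<Sum>j\<in>J. p j * z j * c j x)" for z x
  define F where "F I z = (\<integral>y. fe (\<lambda>x. W z x + (\<Sum>j\<in>I. s * y j * c j x)) \<partial>gauss_PiM J)" for I z
  have W[measurable]: "W z \<in> borel_measurable \<mu>" for z
    unfolding W_def by (rule field_measurable) simp
  have Wm: "\<bar>W z x\<bar> \<le> (\<Sum>j\<in>J. p j) * K * (\<Sum>j\<in>J. \<bar>z j\<bar>)" if "x \<in> space \<mu>" for z x
    unfolding W_def using p fin that
    by (intro field_abs_le) (auto intro!: member_le_sum sum_nonneg)
  have avg: "avg_fe (\<lambda>j. sqrt ((p j)\<^sup>2 + s\<^sup>2 * indicator I j)) = (\<integral>z. F I z \<partial>gauss_PiM J)"
    "integrable (gauss_PiM J) (F I)" if I: "I \<subseteq> J" for I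
  proof -
    define q where "q j = s * indicator I j" for j
    define f where "f z = fe (\<lambda>x. \<Sum>j\<in>J. z j * c j x)" for z
    have f: "f \<in> borel_measurable (\<Pi>\<^sub>M j\<in>J. borel)"
      using fe_field_measurable[of "\<lambda>_. 0" J "\<lambda>_. 1"] by (simp add: f_def[abs_def])
    have fr: "f (\<lambda>j\<in>J. a j * z j) = fe (\<lambda>x. \<Sum>j\<in>J. a j * z j * c j x)" for a z
      unfolding f_def by (intro arg_cong[where f = fe] ext sum.cong) auto
    have q0: "0 \<le> q j" for j using s by (simp add: q_def)
    have sq: "sqrt ((p j)\<^sup>2 + (q j)\<^sup>2) = sqrt ((p j)\<^sup>2 + s\<^sup>2 * indicator I j)" for j
      by (simp add: q_def indicator_def)
    have int: "integrable (gauss_PiM J) (\<lambda>z. f (\<lambda>j\<in>J. sqrt ((p j)\<^sup>2 + (q j)\<^sup>2) * z j))"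
      unfolding fr using fe_field_integrable[of "\<lambda>_. 0" 0 J] by simp
    have FI: "f (\<lambda>j\<in>J. p j * z j + q j * y j) = fe (\<lambda>x. W z x + (\<Sum>j\<in>I. s * y j * c j x))" for z y
    proof -
      have "(\<Sum>j\<in>J. q j * y j * c j x) = (\<Sum>j\<in>I. s * y j * c j x)" for x
        using I fin by (intro sum.mono_neutral_cong_right) (auto simp: q_def)
      then show ?thesis
        unfolding f_def W_def
        by (intro arg_cong[where f = fe] ext) (simp add: distrib_right sum.distrib)
    qed
    show "avg_fe (\<lambda>j. sqrt ((p j)\<^sup>2 + s\<^sup>2 * indicator I j)) = (\<integral>z. F I z \<partial>gauss_PiM J)"
      using integral_gauss_PiM_add(2)[OF fin p q0 f int] unfolding fr FI sq F_def avg_fe_def .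
    show "integrable (gauss_PiM J) (F I)"
      using integral_gauss_PiM_add(1)[OF fin p q0 f int] unfolding FI F_def .
  qed
  define R where "R = 16 * (s * K) ^ 3 * abs_moment3"
  have "F A z \<le> F B z + s\<^sup>2 * D / 4 + 2 * R" for z
  proof -
    interpret G: prob_space "gibbs (W z)" by (rule prob_space_gibbs[OF W Wm])
    have "(\<Sum>j\<in>A. G.variance (c j)) \<le> (\<Sum>j\<in>B. G.variance (c j)) + D / 2"
    proof (rule G.variance_sum_le[where K = K])
      show "finite A" "finite B" using AB fin by (auto intro: finite_subset)
    qed (use AB le c_bd c_meas in auto)
    then have "s\<^sup>2 / 2 * (\<Sum>j\<in>A. G.variance (c j)) \<le> s\<^sup>2 / 2 * ((\<Sum>j\<in>B. G.variance (c j)) + D / 2)"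
      by (intro mult_left_mono) auto
    then have "s\<^sup>2 / 2 * (\<Sum>j\<in>A. G.variance (c j)) \<le> s\<^sup>2 / 2 * (\<Sum>j\<in>B. G.variance (c j)) + s\<^sup>2 * D / 4"
      by (simp add: algebra_simps)
    then show ?thesis
      using fe_perturb[OF W Wm AB(1) s, of z] fe_perturb[OF W Wm AB(2) s, of z]
      unfolding F_def R_def by linarith
  qed
  then have "(\<integral>z. F A z \<partial>gauss_PiM J) \<le> (\<integral>z. F B z + s\<^sup>2 * D / 4 + 2 * R \<partial>gauss_PiM J)"
    using avg(2) AB by (intro integral_mono) auto
  then show ?thesis
    using avg AB by (simp add: \<gamma>.prob_space R_def)
qed

text \<open>The Gaussian field with index set \<open>A\<close> is replaced by the one with index set \<open>B\<close>
  in \<open>N\<close> steps of variance \<open>1 / N\<close>; the error is of order \<open>N * N\<^sup>-\<^sup>3\<^sup>/\<^sup>2\<close>.\<close>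

theorem gaussian_comparison:
  assumes AB: "A \<subseteq> J" "B \<subseteq> J"
    and le: "\<And>x y. x \<in> space \<mu> \<Longrightarrow> y \<in> space \<mu> \<Longrightarrow>
      (\<Sum>j\<in>A. (c j x - c j y)\<^sup>2) \<le> (\<Sum>j\<in>B. (c j x - c j y)\<^sup>2) + D"
  shows "(\<integral>z. fe (\<lambda>x. \<Sum>j\<in>A. z j * c j x) \<partial>gauss_PiM J)
    \<le> (\<integral>z. fe (\<lambda>x. \<Sum>j\<in>B. z j * c j x) \<partial>gauss_PiM J) + D / 4"
proof -
  define E where "E = 32 * K ^ 3 * abs_moment3"
  have ind: "avg_fe (\<lambda>j. sqrt (indicator I j)) = (\<integral>z. fe (\<lambda>x. \<Sum>j\<in>I. z j * c j x) \<partial>gauss_PiM J)"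
    if "I \<subseteq> J" for I
  proof -
    have "(\<Sum>j\<in>J. sqrt (indicator I j) * z j * c j x) = (\<Sum>j\<in>I. z j * c j x)" for z x
      using that fin by (intro sum.mono_neutral_cong_right) auto
    then show ?thesis by (simp add: avg_fe_def)
  qed
  have N: "avg_fe (\<lambda>j. sqrt (indicator A j)) \<le> avg_fe (\<lambda>j. sqrt (indicator B j)) + D / 4 + E / sqrt (real N)"
    if N: "N > 0" for N :: nat
  proof -
    \<comment> \<open>The mixture of \<open>i\<close> pieces carried by \<open>A\<close> and
      \<open>N - i\<close> pieces carried by \<open>B\<close>, each of variance 1 / N. It starts at
      \<open>B\<close> for i = 0 and ends at \<open>A\<close> for i = N.\<close>
    define w where "w i = (\<lambda>j. sqrt (real i / N * indicator A j + real (N - i) / N * indicator B j))" for i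
    define h where "h = 1 / sqrt (real N)"
    have h: "0 \<le> h" "h\<^sup>2 = 1 / N" using N by (auto simp: h_def power_divide)
    have step: "avg_fe (w (Suc i)) \<le> avg_fe (w i) + (D / 4 + E * h) / N" if i: "i < N" for i
    proof -
      \<comment> \<open>The part shared by \<open>w i\<close> and \<open>w (Suc i)\<close>: one
        piece is withheld, hence \<open>N - Suc i\<close>. Giving the missing piece to
        \<open>A\<close> yields \<open>w (Suc i)\<close>, giving it to \<open>B\<close> yields
        \<open>w i\<close>.\<close>
      define p where "p j = sqrt (real i / N * indicator A j + real (N - Suc i) / N * indicator B j)" for j
      have p2: "(p j)\<^sup>2 = real i / N * indicator A j + real (N - Suc i) / N * indicator B j" for j
        unfolding p_def by (intro real_sqrt_pow2 add_nonneg_nonneg mult_nonneg_nonneg) auto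
      have A: "(\<lambda>j. sqrt ((p j)\<^sup>2 + h\<^sup>2 * indicator A j)) = w (Suc i)"
        unfolding p2 w_def h using N by (intro ext arg_cong[where f = sqrt]) (simp add: field_simps)
      have B: "(\<lambda>j. sqrt ((p j)\<^sup>2 + h\<^sup>2 * indicator B j)) = w i"
        unfolding p2 w_def h using N i
        by (intro ext arg_cong[where f = sqrt]) (simp add: field_simps of_nat_diff)
      have "avg_fe (w (Suc i)) \<le> avg_fe (w i) + h\<^sup>2 * D / 4 + 32 * (h * K) ^ 3 * abs_moment3"
        using avg_fe_step[of p h A B D, OF _ h(1) AB le] unfolding A B by (simp add: p_def)
      also have "32 * (h * K) ^ 3 * abs_moment3 = E * h * h\<^sup>2"
        by (simp add: E_def power_mult_distrib power2_eq_square power3_eq_cube)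
      finally show ?thesis unfolding h by (simp add: add_divide_distrib)
    qed
    define d where "d = (D / 4 + E * h) / N"
    have "avg_fe (w i) \<le> avg_fe (w 0) + i * d" if "i \<le> N" for i
      using that
    proof (induction i)
      case (Suc i)
      then show ?case using step[of i] unfolding d_def[symmetric] by (simp add: algebra_simps)
    qed simp
    from this[of N] show ?thesis using N by (simp add: w_def h_def d_def)
  qed
  have "(\<lambda>N. E / sqrt (real N)) \<longlonglongrightarrow> 0"
    by real_asymp
  then have "(\<lambda>N. avg_fe (\<lambda>j. sqrt (indicator B j)) + D / 4 + E / sqrt (real N))
      \<longlonglongrightarrow> avg_fe (\<lambda>j. sqrt (indicator B j)) + D / 4 + 0"
    by (intro tendsto_add tendsto_const)
  then have "avg_fe (\<lambda>j. sqrt (indicator A j)) \<le> avg_fe (\<lambda>j. sqrt (indicator B j)) + D / 4 + 0"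
    by (rule LIMSEQ_le_const) (use N in \<open>auto intro!: exI[of _ 1]\<close>)
  then show ?thesis using ind AB by simp
qed

end

section \<open>Exponential moments on the sphere\<close>

lemma nn_integral_exp_quadratic_lborel:
  assumes "0 < T"
  shows "(\<integral>\<^sup>+ x. ennreal (exp (w * x - T * x\<^sup>2 / 2)) \<partial>lborel) = ennreal (sqrt (2 * pi / T) * exp (w\<^sup>2 / (2 * T)))"
proof -
  have "exp (w * x - T * x\<^sup>2 / 2)
      = (sqrt (2 * pi / T) * exp (w\<^sup>2 / (2 * T))) * normal_density (w / T) (sqrt (1 / T)) x" for x
  proof -
    have "w * x - T * x\<^sup>2 / 2 = w\<^sup>2 / (2 * T) + - (x - w / T)\<^sup>2 / (2 * (1 / T))"
      using assms by (simp add: field_simps power2_eq_square)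
    then have "exp (w * x - T * x\<^sup>2 / 2) = exp (w\<^sup>2 / (2 * T)) * exp (- (x - w / T)\<^sup>2 / (2 * (1 / T)))"
      by (simp only: exp_add)
    moreover have "normal_density (w / T) (sqrt (1 / T)) x
        = exp (- (x - w / T)\<^sup>2 / (2 * (1 / T))) / sqrt (2 * pi / T)"
      using assms by (simp add: normal_density_def)
    ultimately show ?thesis using assms by simp
  qed
  then have "(\<integral>\<^sup>+ x. ennreal (exp (w * x - T * x\<^sup>2 / 2)) \<partial>lborel)
      = (\<integral>\<^sup>+ x. ennreal (sqrt (2 * pi / T) * exp (w\<^sup>2 / (2 * T))) * ennreal (normal_density (w / T) (sqrt (1 / T)) x) \<partial>lborel)"
    using assms by (simp add: ennreal_mult)
  also have "\<dots> = ennreal (sqrt (2 * pi / T) * exp (w\<^sup>2 / (2 * T))) * (\<integral>\<^sup>+ x. ennreal (normal_density (w / T) (sqrt (1 / T)) x) \<partial>lborel)"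
    by (rule nn_integral_cmult) auto
  also have "(\<integral>\<^sup>+ x. ennreal (normal_density (w / T) (sqrt (1 / T)) x) \<partial>lborel) = 1"
    using assms by (subst nn_integral_eq_integral) auto
  finally show ?thesis by simp
qed

text \<open>A substitute for Stirling's formula with the right exponential rate. In the integrand
  t^s exp (-t) the factor exp (-\<eta> t) is set aside, which integrates to 1 / \<eta>; the
  remaining factor t^s exp (-(1 - \<eta>) t) is largest at t = s / (1 - \<eta>). The maximum is
  obtained from ln x \<le> x - 1.\<close>

lemma Gamma_le_real:
  fixes s \<eta> :: real
  assumes s: "0 < s" and \<eta>: "0 < \<eta>" "\<eta> < 1"
  shows "Gamma (s + 1) \<le> exp (s * (ln s - ln (1 - \<eta>) - 1)) / \<eta>"
proof -
  define C where "C = exp (s * (ln s - ln (1 - \<eta>) - 1)) / \<eta>"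
  have C: "0 < C" using \<eta> by (simp add: C_def)
  have pw: "indicator {0..} t * t powr (s + 1 - 1) / exp t \<le> C * exponential_density \<eta> t" for t :: real
  proof (cases "0 < t")
    case True
    have "ln ((1 - \<eta>) * t / s) \<le> (1 - \<eta>) * t / s - 1"
      using True s \<eta> by (intro ln_le_minus_one) auto
    then have "s * (ln (1 - \<eta>) + ln t - ln s) \<le> s * ((1 - \<eta>) * t / s - 1)"
      using True s \<eta> by (intro mult_left_mono) (auto simp: ln_mult ln_div)
    also have "\<dots> = (1 - \<eta>) * t - s"
      using s by (simp add: field_simps)
    finally have "s * ln t - t \<le> s * (ln s - ln (1 - \<eta>) - 1) - t * \<eta>"
      by (simp add: algebra_simps)
    then have "exp (s * ln t - t) \<le> exp (s * (ln s - ln (1 - \<eta>) - 1) - t * \<eta>)"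
      by simp
    also have "\<dots> = C * exponential_density \<eta> t"
      using True \<eta> by (simp add: C_def exponential_density_def exp_diff exp_minus divide_inverse)
    finally show ?thesis
      using True by (simp add: powr_def exp_diff)
  qed (use C \<eta> s in \<open>auto simp: exponential_density_def indicator_def\<close>)
  interpret E: prob_space "density lborel (exponential_density \<eta>)"
    using \<eta> by (intro prob_space_exponential_density)
  have E: "(\<integral>\<^sup>+ t. ennreal (exponential_density \<eta> t) \<partial>lborel) = 1"
    using E.emeasure_space_1 by (subst (asm) emeasure_density) auto
  have "ennreal (Gamma (s + 1)) = (\<integral>\<^sup>+ t. ennreal (indicator {0..} t * t powr (s + 1 - 1) / exp t) \<partial>lborel)"
    using s by (intro Gamma_conv_nn_integral_real) auto
  also have "\<dots> \<le> (\<integral>\<^sup>+ t. ennreal C * ennreal (exponential_density \<eta> t) \<partial>lborel)"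
    using pw C \<eta> by (intro nn_integral_mono) (auto simp: ennreal_mult[symmetric] exponential_density_nonneg intro!: ennreal_leI)
  also have "\<dots> = ennreal C"
    by (subst nn_integral_cmult) (auto simp: E)
  finally show ?thesis
    using C by (simp add: C_def)
qed

interpretation lborel_prod: product_sigma_finite "\<lambda>_. lborel :: real measure"
  by unfold_locales

abbreviation lborel_PiM :: "'i set \<Rightarrow> ('i \<Rightarrow> real) measure" where
  "lborel_PiM I \<equiv> \<Pi>\<^sub>M i\<in>I. lborel"

lemma nn_integral_exp_quadratic_lborel_PiM:
  assumes "finite I" "0 < T"
  shows "(\<integral>\<^sup>+ x. ennreal (exp ((\<Sum>i\<in>I. w i * x i) - T / 2 * (\<Sum>i\<in>I. (x i)\<^sup>2))) \<partial>lborel_PiM I)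
    = ennreal (sqrt (2 * pi / T) ^ card I * exp ((\<Sum>i\<in>I. (w i)\<^sup>2) / (2 * T)))"
proof -
  have "(\<integral>\<^sup>+ x. ennreal (exp ((\<Sum>i\<in>I. w i * x i) - T / 2 * (\<Sum>i\<in>I. (x i)\<^sup>2))) \<partial>lborel_PiM I)
      = (\<integral>\<^sup>+ x. (\<Prod>i\<in>I. ennreal (exp (w i * x i - T * (x i)\<^sup>2 / 2))) \<partial>lborel_PiM I)"
    using assms(1) by (simp add: exp_sum prod_ennreal sum_distrib_left flip: sum_subtractf)
  also have "\<dots> = (\<Prod>i\<in>I. ennreal (sqrt (2 * pi / T) * exp ((w i)\<^sup>2 / (2 * T))))"
    using assms by (subst lborel_prod.product_nn_integral_prod) (auto simp: nn_integral_exp_quadratic_lborel)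
  also have "\<dots> = ennreal (\<Prod>i\<in>I. sqrt (2 * pi / T) * exp ((w i)\<^sup>2 / (2 * T)))"
    using assms by (intro prod_ennreal) auto
  also have "(\<Prod>i\<in>I. sqrt (2 * pi / T) * exp ((w i)\<^sup>2 / (2 * T)))
      = sqrt (2 * pi / T) ^ card I * exp ((\<Sum>i\<in>I. (w i)\<^sup>2) / (2 * T))"
    using assms by (simp add: prod.distrib exp_sum sum_divide_distrib)
  finally show ?thesis .
qed

lemma nn_integral_lborel_PiM_scale:
  fixes f :: "('i \<Rightarrow> real) \<Rightarrow> ennreal"
  assumes I: "finite I" and c: "0 < c" and [measurable]: "f \<in> borel_measurable (\<Pi>\<^sub>M i\<in>I. borel)"
  shows "(\<integral>\<^sup>+ x. f x \<partial>lborel_PiM I) = ennreal (c ^ card I) * (\<integral>\<^sup>+ x. f (\<lambda>i\<in>I. c * x i) \<partial>lborel_PiM I)"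
proof -
  define P where "P = scale_measure (ennreal (c ^ card I))
    (distr (lborel_PiM I) (\<Pi>\<^sub>M i\<in>I. borel) (\<lambda>x. \<lambda>i\<in>I. c * x i))"
  have "P = lborel_PiM I"
  proof (rule lborel_prod.PiM_eqI[OF I])
    show "sets P = sets (lborel_PiM I)"
      unfolding P_def by (auto intro!: sets_PiM_cong)
    fix A assume "\<And>i. i \<in> I \<Longrightarrow> A i \<in> sets (lborel :: real measure)"
    then have A[measurable]: "\<And>i. i \<in> I \<Longrightarrow> A i \<in> sets borel" by simp
    have PA[measurable]: "Pi\<^sub>E I A \<in> sets (\<Pi>\<^sub>M i\<in>I. borel)"
      using I A by (intro sets_PiM_I_finite) auto
    have ind: "(indicator (Pi\<^sub>E I A) (restrict x I) :: ennreal) = (\<Prod>i\<in>I. indicator (A i) (x i))"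
      for x :: "'i \<Rightarrow> real"
      using I by (auto simp: indicator_def prod_zero_iff Pi_iff intro!: prod.neutral)
    have "emeasure P (Pi\<^sub>E I A) = ennreal (c ^ card I) *
        (\<integral>\<^sup>+ x. indicator (Pi\<^sub>E I A) x \<partial>distr (lborel_PiM I) (\<Pi>\<^sub>M i\<in>I. borel) (\<lambda>x. \<lambda>i\<in>I. c * x i))"
      by (simp add: P_def)
    also have "\<dots> = ennreal (c ^ card I) * (\<integral>\<^sup>+ x. (\<Prod>i\<in>I. indicator (A i) (c * x i)) \<partial>lborel_PiM I)"
      by (subst nn_integral_distr) (auto simp: ind)
    also have "\<dots> = (\<Prod>i\<in>I. ennreal c) * (\<Prod>i\<in>I. \<integral>\<^sup>+ x. indicator (A i) (c * x) \<partial>lborel)"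
      using I c by (subst lborel_prod.product_nn_integral_prod[of I "\<lambda>i x. indicator (A i) (c * x)"])
        (auto simp: ennreal_power)
    also have "\<dots> = (\<Prod>i\<in>I. emeasure lborel (A i))"
      unfolding prod.distrib[symmetric]
    proof (rule prod.cong[OF refl])
      fix i assume "i \<in> I"
      then show "ennreal c * (\<integral>\<^sup>+ x. indicator (A i) (c * x) \<partial>lborel) = emeasure lborel (A i)"
        using c nn_integral_real_affine[of "indicator (A i)" c 0] A[of i] by simp
    qed
    finally show "emeasure P (Pi\<^sub>E I A) = (\<Prod>i\<in>I. emeasure lborel (A i))" .
  qed
  then have "(\<integral>\<^sup>+ x. f x \<partial>lborel_PiM I) = (\<integral>\<^sup>+ x. f x \<partial>P)" by simp
  also have "\<dots> = ennreal (c ^ card I) * (\<integral>\<^sup>+ x. f (\<lambda>i\<in>I. c * x i) \<partial>lborel_PiM I)"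
    unfolding P_def by (subst nn_integral_scale_measure) (auto simp: nn_integral_distr)
  finally show ?thesis .
qed

section \<open>The uniform measure on the sphere by radial integration\<close>

lemma L2_set_measurable [measurable]:
  "(\<lambda>x. L2_set x I) \<in> borel_measurable (\<Pi>\<^sub>M i\<in>I. (borel :: real measure))"
  unfolding L2_set_def by measurable

lemma emeasure_unit_ball_PiM:
  "emeasure (lborel_PiM {..<N}) {x \<in> {..<N} \<rightarrow>\<^sub>E UNIV. L2_set x {..<N} \<le> 1} = ennreal (unit_ball_vol (real N))"
proof -
  have "{x \<in> {..<N} \<rightarrow>\<^sub>E UNIV. L2_set x {..<N} \<le> 1}
      = {f. sqrt (\<Sum>i\<in>{..<N}. (f i)\<^sup>2) \<le> 1} \<inter> space (lborel_PiM {..<N})"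
    by (auto simp: L2_set_def space_PiM)
  then show ?thesis using emeasure_cball_aux[of "{..<N}" 1] by simp
qed

lemma ennreal_unit_ball_vol_neq_0: "ennreal (unit_ball_vol (real N)) \<noteq> 0"
  by (simp add: ennreal_eq_0_iff not_le)

definition sphere_proj :: "nat \<Rightarrow> (nat \<Rightarrow> real) \<Rightarrow> nat \<Rightarrow> real" where
  "sphere_proj N x = (\<lambda>i\<in>{..<N}. sqrt (real N) * x i / L2_set x {..<N})"

lemma sphere_proj_measurable [measurable]:
  "sphere_proj N \<in> (\<Pi>\<^sub>M i\<in>{..<N}. borel) \<rightarrow>\<^sub>M (\<Pi>\<^sub>M i\<in>{..<N}. borel)"
  unfolding sphere_proj_def[abs_def] by measurable

lemma sets_sphere_measure [simp, measurable_cong]: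
  "sets (sphere_measure N) = sets (\<Pi>\<^sub>M i\<in>{..<N}. borel)"
  by (simp add: sphere_measure_def)

lemma space_sphere_measure [simp]: "space (sphere_measure N) = {..<N} \<rightarrow>\<^sub>E UNIV"
  by (simp add: sphere_measure_def space_PiM)

lemma prob_space_sphere_measure: "prob_space (sphere_measure N)"
  unfolding sphere_measure_def
proof (intro prob_space.prob_space_distr prob_space_uniform_measure)
  show "emeasure (lborel_PiM {..<N}) {x \<in> {..<N} \<rightarrow>\<^sub>E UNIV. L2_set x {..<N} \<le> 1} \<noteq> 0"
    "emeasure (lborel_PiM {..<N}) {x \<in> {..<N} \<rightarrow>\<^sub>E UNIV. L2_set x {..<N} \<le> 1} \<noteq> \<infinity>"
    unfolding emeasure_unit_ball_PiM by (rule ennreal_unit_ball_vol_neq_0) simp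
  show "(\<lambda>x. \<lambda>i\<in>{..<N}. sqrt (real N) * x i / L2_set x {..<N})
    \<in> uniform_measure (lborel_PiM {..<N}) {x \<in> {..<N} \<rightarrow>\<^sub>E UNIV. L2_set x {..<N} \<le> 1} \<rightarrow>\<^sub>M (\<Pi>\<^sub>M i\<in>{..<N}. borel)"
    by measurable
qed

text \<open>A substitute for polar coordinates: \<open>\<phi>\<close> is extended to be constant
  along rays, so the integral scales with the volume of the ball, and radius 1 recovers the sphere
  average. Differences of two radii give integrals over shells.\<close>

definition ball_integral :: "nat \<Rightarrow> ((nat \<Rightarrow> real) \<Rightarrow> ennreal) \<Rightarrow> real \<Rightarrow> ennreal" where
  "ball_integral N \<phi> \<rho> =
    (\<integral>\<^sup>+ x. indicator {x. L2_set x {..<N} \<le> \<rho>} x * \<phi> (sphere_proj N x) \<partial>lborel_PiM {..<N})"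

lemma ball_integral_1:
  assumes [measurable]: "\<phi> \<in> borel_measurable (\<Pi>\<^sub>M i\<in>{..<N}. borel)"
  shows "ball_integral N \<phi> 1 = ennreal (unit_ball_vol (real N)) * (\<integral>\<^sup>+ \<sigma>. \<phi> \<sigma> \<partial>sphere_measure N)"
proof -
  let ?B = "{x \<in> {..<N} \<rightarrow>\<^sub>E UNIV. L2_set x {..<N} \<le> 1}"
  have B: "?B \<in> sets (lborel_PiM {..<N})"
  proof -
    have "{x \<in> space (lborel_PiM {..<N}). L2_set x {..<N} \<le> 1} \<in> sets (lborel_PiM {..<N})" by measurable
    then show ?thesis by (simp add: space_PiM)
  qed
  have "(\<integral>\<^sup>+ \<sigma>. \<phi> \<sigma> \<partial>sphere_measure N)
      = (\<integral>\<^sup>+ x. \<phi> (sphere_proj N x) \<partial>uniform_measure (lborel_PiM {..<N}) ?B)"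
    unfolding sphere_measure_def by (subst nn_integral_distr) (auto simp: sphere_proj_def[abs_def])
  also have "\<dots> = (\<integral>\<^sup>+ x. \<phi> (sphere_proj N x) * indicator ?B x \<partial>lborel_PiM {..<N}) / emeasure (lborel_PiM {..<N}) ?B"
    using B by (intro nn_integral_uniform_measure) auto
  also have "(\<integral>\<^sup>+ x. \<phi> (sphere_proj N x) * indicator ?B x \<partial>lborel_PiM {..<N}) = ball_integral N \<phi> 1"
    unfolding ball_integral_def by (intro nn_integral_cong) (auto simp: indicator_def space_PiM)
  finally show ?thesis
    unfolding emeasure_unit_ball_PiM
    using ennreal_unit_ball_vol_neq_0[of N]
    by (simp add: ennreal_times_divide mult.commute[of "ennreal _"] ennreal_mult_divide_eq)
qed

lemma ball_integral_scale:
  assumes [measurable]: "\<phi> \<in> borel_measurable (\<Pi>\<^sub>M i\<in>{..<N}. borel)" and \<rho>: "0 < \<rho>"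
  shows "ball_integral N \<phi> \<rho> = ennreal (\<rho> ^ N) * ball_integral N \<phi> 1"
proof -
  have L: "L2_set (\<lambda>i\<in>{..<N}. \<rho> * x i) {..<N} = \<rho> * L2_set x {..<N}" for x
    using L2_set_right_distrib[of \<rho> x "{..<N}"] \<rho> by (simp add: L2_set_def)
  have P: "sphere_proj N (\<lambda>i\<in>{..<N}. \<rho> * x i) = sphere_proj N x" for x
    unfolding sphere_proj_def L using \<rho> by (auto simp: fun_eq_iff)
  show ?thesis
    unfolding ball_integral_def
    by (subst nn_integral_lborel_PiM_scale[OF _ \<rho>]) (use \<rho> in \<open>auto simp: L P indicator_def\<close>)
qed

lemma cosh_mono_abs:
  fixes x y :: real
  shows "\<bar>x\<bar> \<le> \<bar>y\<bar> \<Longrightarrow> cosh x \<le> cosh y"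
  using cosh_real_nonneg_le_iff[of "\<bar>x\<bar>" "\<bar>y\<bar>"] by (simp add: cosh_real_abs)

lemma exp_le_2_cosh: "exp x \<le> 2 * cosh (x :: real)"
  by (simp add: cosh_def)

lemma exp_minus_mult_cosh:
  "exp (- c) * cosh (x :: real) = exp (x - c) / 2 + exp (- x - c) / 2"
  by (simp add: cosh_def exp_diff exp_minus field_simps)

text \<open>This is the normalising constant of the sphere measure: the volume of the ball of radius
  sqrt N grows like (2 pi e)^(N/2). The upper bound on the Gamma function yields this rate from
  below, with a loss (1 - \<eta>)^(N/2) \<eta> whose rate vanishes as \<eta> tends to 0.\<close>

lemma unit_ball_vol_ge:
  assumes N: "0 < N" and \<eta>: "0 < \<eta>" "\<eta> < 1"
  shows "exp (N / 2 * (ln (2 * pi) + 1 + ln (1 - \<eta>))) * \<eta> \<le> unit_ball_vol (real N) * sqrt N ^ N"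
proof -
  define s where "s = real N / 2"
  have s: "0 < s" using N by (simp add: s_def)
  have G: "Gamma (s + 1) \<le> exp (s * (ln s - ln (1 - \<eta>) - 1)) / \<eta>"
    by (rule Gamma_le_real) (use s \<eta> in auto)
  have G0: "0 < Gamma (s + 1)" using s by (intro Gamma_real_pos) auto
  have sq: "sqrt N ^ N = exp (s * ln N)"
  proof -
    have "sqrt N ^ N = exp (ln (sqrt N)) ^ N" using N by simp
    also have "\<dots> = exp (real N * ln (sqrt N))" by (simp add: exp_of_nat_mult)
    finally show ?thesis using N by (simp add: ln_sqrt s_def)
  qed
  have "exp (N / 2 * (ln (2 * pi) + 1 + ln (1 - \<eta>))) * \<eta>
      = exp (s * ln pi) * exp (s * ln N) / (exp (s * (ln s - ln (1 - \<eta>) - 1)) / \<eta>)"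
  proof -
    have "N / 2 * (ln (2 * pi) + 1 + ln (1 - \<eta>)) = s * ln pi + s * ln N - s * (ln s - ln (1 - \<eta>) - 1)"
      using N by (simp add: s_def ln_mult ln_div algebra_simps)
    then show ?thesis by (simp only: exp_add exp_diff) simp
  qed
  also have "\<dots> \<le> exp (s * ln pi) * exp (s * ln N) / Gamma (s + 1)"
    using G G0 \<eta> by (intro divide_left_mono mult_pos_pos divide_pos_pos) auto
  also have "\<dots> = unit_ball_vol (real N) * sqrt N ^ N"
    unfolding sq by (simp add: unit_ball_vol_def s_def powr_def)
  finally show ?thesis .
qed

text \<open>The exponential moment of a linear functional on the sphere is at most its Gaussian
  counterpart: \<open>cosh (w \<bullet> x)\<close> increases along rays, so the integral over the sphere is bounded by the
  integral over a thin shell just outside of it.\<close>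

lemma sphere_exp_moment_le:
  assumes N: "0 < N" and T: "0 < T" and \<delta>: "0 < \<delta>" "\<delta> < 1"
  shows "(\<integral>\<^sup>+ \<sigma>. ennreal (exp (\<Sum>i<N. w i * \<sigma> i)) \<partial>sphere_measure N)
    \<le> ennreal (exp (N / 2 * (T * (1 + \<delta>)\<^sup>2 - 1 - ln T - ln (1 - \<delta>)) + (\<Sum>i<N. (w i)\<^sup>2) / (2 * T) + ln (2 / \<delta>\<^sup>2)))"
proof -
  define n where "n x = L2_set x {..<N}" for x
  define \<phi> where "\<phi> \<sigma> = cosh (\<Sum>i<N. w i * \<sigma> i)" for \<sigma>
  define \<rho> where "\<rho> = sqrt N * (1 + \<delta>)"
  define V where "V = unit_ball_vol (real N)"
  have V: "0 < V" by (simp add: V_def)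
  have \<rho>: "sqrt N < \<rho>" "0 < \<rho>" using N \<delta> by (auto simp: \<rho>_def)
  have \<phi>m[measurable]: "\<phi> \<in> borel_measurable (\<Pi>\<^sub>M i\<in>{..<N}. borel)"
    unfolding \<phi>_def[abs_def] cosh_def by measurable
  have nm[measurable]: "n \<in> borel_measurable (\<Pi>\<^sub>M i\<in>{..<N}. borel)"
    unfolding n_def[abs_def] by measurable
  have \<phi>0: "0 < \<phi> \<sigma>" for \<sigma> by (simp add: \<phi>_def)
  have n0: "0 \<le> n x" for x by (simp add: n_def)
  have wp: "(\<Sum>i<N. w i * sphere_proj N x i) = sqrt N / n x * (\<Sum>i<N. w i * x i)" for x
    by (simp add: sphere_proj_def n_def sum_distrib_left mult_ac)
  define X where "X = (\<integral>\<^sup>+ \<sigma>. ennreal (\<phi> \<sigma>) \<partial>sphere_measure N)"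
  define B where "B = ball_integral N (\<lambda>\<sigma>. ennreal (\<phi> \<sigma>))"
  define S where "S = (\<integral>\<^sup>+ x. indicator {x. sqrt N < n x \<and> n x \<le> \<rho>} x * ennreal (\<phi> (sphere_proj N x)) \<partial>lborel_PiM {..<N})"
  interpret sph: prob_space "sphere_measure N" by (rule prob_space_sphere_measure)
  have B1: "B 1 = ennreal V * X"
    unfolding B_def X_def V_def by (rule ball_integral_1) measurable
  have Bs: "B r = ennreal (r ^ N) * B 1" if "0 < r" for r
    unfolding B_def by (rule ball_integral_scale[OF _ that]) measurable
  \<comment> \<open>Finiteness is needed so that the integral over the inner ball can be subtracted
    from the one over the outer ball. The integrand is bounded because the projected points have
    norm at most sqrt N.\<close>
  have "B 1 < \<infinity>"
  proof -
    define b where "b = sqrt N * (\<Sum>i<N. \<bar>w i\<bar>)"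
    have "\<phi> (sphere_proj N x) \<le> cosh b" for x
      unfolding \<phi>_def
    proof (rule cosh_mono_abs)
      have "\<bar>x i\<bar> \<le> n x" if "i < N" for i
      proof -
        have "sqrt ((x i)\<^sup>2) \<le> sqrt (\<Sum>i<N. (x i)\<^sup>2)"
          using that by (intro real_sqrt_le_mono member_le_sum[of i "{..<N}" "\<lambda>i. (x i)\<^sup>2"]) auto
        then show ?thesis by (simp add: n_def L2_set_def)
      qed
      then have "\<bar>\<Sum>i<N. w i * x i\<bar> \<le> (\<Sum>i<N. \<bar>w i\<bar> * n x)"
        by (intro order_trans[OF sum_abs] sum_mono) (auto simp: abs_mult intro!: mult_left_mono)
      then have "\<bar>\<Sum>i<N. w i * x i\<bar> \<le> (\<Sum>i<N. \<bar>w i\<bar>) * n x" by (simp add: sum_distrib_right)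
      \<comment> \<open>At the origin the left-hand side is 0, since division by 0 gives 0.\<close>
      then have "\<bar>\<Sum>i<N. w i * x i\<bar> / n x \<le> (\<Sum>i<N. \<bar>w i\<bar>)"
        using n0[of x] by (cases "n x = 0") (auto simp: pos_divide_le_eq sum_nonneg)
      then have "sqrt N * (\<bar>\<Sum>i<N. w i * x i\<bar> / n x) \<le> b"
        unfolding b_def by (intro mult_left_mono) auto
      then show "\<bar>\<Sum>i<N. w i * sphere_proj N x i\<bar> \<le> \<bar>b\<bar>"
        unfolding wp using n0[of x] by (simp add: abs_mult)
    qed
    then have "B 1 \<le> (\<integral>\<^sup>+ x. ennreal (cosh b) * indicator {x \<in> {..<N} \<rightarrow>\<^sub>E UNIV. n x \<le> 1} x \<partial>lborel_PiM {..<N})"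
      unfolding B_def ball_integral_def n_def
      by (intro nn_integral_mono) (auto simp: indicator_def space_PiM intro!: ennreal_leI)
    also have "\<dots> = ennreal (cosh b) * emeasure (lborel_PiM {..<N}) {x \<in> {..<N} \<rightarrow>\<^sub>E UNIV. n x \<le> 1}"
    proof (rule nn_integral_cmult_indicator)
      have "{x \<in> space (lborel_PiM {..<N}). n x \<le> 1} \<in> sets (lborel_PiM {..<N})" by measurable
      then show "{x \<in> {..<N} \<rightarrow>\<^sub>E UNIV. n x \<le> 1} \<in> sets (lborel_PiM {..<N})" by (simp add: space_PiM)
    qed
    also have "\<dots> < \<infinity>"
      unfolding n_def emeasure_unit_ball_PiM by (simp add: ennreal_mult_less_top)
    finally show ?thesis .
  qed
  then have Xfin: "X < \<infinity>" unfolding B1 using V by (auto simp: ennreal_mult_less_top less_top)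
  then obtain x where x: "X = ennreal x" "0 \<le> x" by (cases X) auto
  have "B \<rho> = B (sqrt N) + S"
    unfolding B_def S_def ball_integral_def n_def[symmetric]
    by (subst nn_integral_add[symmetric]) (use \<rho> in \<open>auto intro!: nn_integral_cong simp: indicator_def\<close>)
  then have "ennreal (\<rho> ^ N * (V * x)) = ennreal (sqrt N ^ N * (V * x)) + S"
    using Bs[of \<rho>] Bs[of "sqrt N"] \<rho> N V x by (simp add: B1 ennreal_mult)
  then have "S = ennreal (\<rho> ^ N * (V * x)) - ennreal (sqrt N ^ N * (V * x))"
    by simp
  then have S: "S = ennreal ((\<rho> ^ N - sqrt N ^ N) * (V * x))"
    using V x \<rho> by (simp add: ennreal_minus algebra_simps)
  \<comment> \<open>On the shell, passing from the projected point outwards to \<open>x\<close>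
    increases the even function cosh, and replacing \<open>\<rho>\<close> by the smaller
    \<open>n x\<close> increases the Gaussian weight. Off the shell the left-hand side is 0. The
    right-hand side is the Gaussian-weighted cosh, written as two exponentials that can be
    integrated over the whole space.\<close>
  have pw: "ennreal (exp (- (T / 2 * \<rho>\<^sup>2))) * (indicator {x. sqrt N < n x \<and> n x \<le> \<rho>} x * ennreal (\<phi> (sphere_proj N x)))
      \<le> ennreal (exp ((\<Sum>i<N. w i * x i) - T / 2 * (\<Sum>i<N. (x i)\<^sup>2)) / 2)
        + ennreal (exp ((\<Sum>i<N. - w i * x i) - T / 2 * (\<Sum>i<N. (x i)\<^sup>2)) / 2)" for x
  proof (cases "sqrt N < n x \<and> n x \<le> \<rho>")
    case True
    have nx2: "(\<Sum>i<N. (x i)\<^sup>2) = (n x)\<^sup>2"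
      by (simp add: n_def L2_set_def sum_nonneg)
    have "0 < n x" using True N by (auto intro: less_trans[rotated])
    have "\<phi> (sphere_proj N x) \<le> \<phi> x"
      unfolding \<phi>_def
    proof (rule cosh_mono_abs)
      have "sqrt N / n x * \<bar>\<Sum>i<N. w i * x i\<bar> \<le> 1 * \<bar>\<Sum>i<N. w i * x i\<bar>"
        using True \<open>0 < n x\<close> by (intro mult_right_mono) auto
      then show "\<bar>\<Sum>i<N. w i * sphere_proj N x i\<bar> \<le> \<bar>\<Sum>i<N. w i * x i\<bar>"
        unfolding wp using \<open>0 < n x\<close> by (simp add: abs_mult)
    qed
    moreover have "exp (- (T / 2 * \<rho>\<^sup>2)) \<le> exp (- (T / 2 * (n x)\<^sup>2))"
      using True n0[of x] T by (auto intro!: power_mono)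
    ultimately have "exp (- (T / 2 * \<rho>\<^sup>2)) * \<phi> (sphere_proj N x) \<le> exp (- (T / 2 * (n x)\<^sup>2)) * \<phi> x"
      using \<phi>0[of "sphere_proj N x"] by (intro mult_mono) auto
    also have "\<dots> = exp ((\<Sum>i<N. w i * x i) - T / 2 * (n x)\<^sup>2) / 2 + exp ((\<Sum>i<N. - w i * x i) - T / 2 * (n x)\<^sup>2) / 2"
      by (simp only: \<phi>_def exp_minus_mult_cosh minus_mult_left[symmetric] sum_negf)
    finally show ?thesis
      using True \<phi>0[of "sphere_proj N x"] by (simp add: nx2 ennreal_mult[symmetric] flip: ennreal_plus)
  qed auto
  define G where "G = sqrt (2 * pi / T) ^ N * exp ((\<Sum>i<N. (w i)\<^sup>2) / (2 * T))"
  have G: "0 < G" using T by (simp add: G_def)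
  have G1: "(\<integral>\<^sup>+ x. ennreal (exp ((\<Sum>i<N. v i * x i) - T / 2 * (\<Sum>i<N. (x i)\<^sup>2)) / 2) \<partial>lborel_PiM {..<N}) = ennreal (G / 2)"
    if "\<And>i. (v i)\<^sup>2 = (w i)\<^sup>2" for v
  proof -
    have "(\<integral>\<^sup>+ x. ennreal (exp ((\<Sum>i<N. v i * x i) - T / 2 * (\<Sum>i<N. (x i)\<^sup>2)) / 2) \<partial>lborel_PiM {..<N})
      = (\<integral>\<^sup>+ x. ennreal (1 / 2) * ennreal (exp ((\<Sum>i<N. v i * x i) - T / 2 * (\<Sum>i<N. (x i)\<^sup>2))) \<partial>lborel_PiM {..<N})"
      by (intro nn_integral_cong, subst ennreal_mult[symmetric]) auto
    also have "\<dots> = ennreal (1 / 2) * ennreal G"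
      using nn_integral_exp_quadratic_lborel_PiM[of "{..<N}" T v] T that
      by (subst nn_integral_cmult) (auto simp: G_def)
    finally show ?thesis using G by (subst (asm) ennreal_mult[symmetric]) auto
  qed
  have "ennreal (exp (- (T / 2 * \<rho>\<^sup>2))) * S \<le> ennreal (G / 2) + ennreal (G / 2)"
  proof -
    have "ennreal (exp (- (T / 2 * \<rho>\<^sup>2))) * S = (\<integral>\<^sup>+ x. ennreal (exp (- (T / 2 * \<rho>\<^sup>2))) *
        (indicator {x. sqrt N < n x \<and> n x \<le> \<rho>} x * ennreal (\<phi> (sphere_proj N x))) \<partial>lborel_PiM {..<N})"
      unfolding S_def by (rule nn_integral_cmult[symmetric]) measurable
    also have "\<dots> \<le> (\<integral>\<^sup>+ x. ennreal (exp ((\<Sum>i<N. w i * x i) - T / 2 * (\<Sum>i<N. (x i)\<^sup>2)) / 2)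
        + ennreal (exp ((\<Sum>i<N. - w i * x i) - T / 2 * (\<Sum>i<N. (x i)\<^sup>2)) / 2) \<partial>lborel_PiM {..<N})"
      by (rule nn_integral_mono) (rule pw)
    also have "\<dots> = ennreal (G / 2) + ennreal (G / 2)"
      using G1[of w] G1[of "\<lambda>i. - w i"] by (subst nn_integral_add) auto
    finally show ?thesis .
  qed
  also have "\<dots> = ennreal G" using G by (simp flip: ennreal_plus)
  finally have main: "exp (- (T / 2 * \<rho>\<^sup>2)) * ((\<rho> ^ N - sqrt N ^ N) * (V * x)) \<le> G"
    unfolding S using G V x \<rho> by (simp add: ennreal_mult[symmetric] power_mono)
  define v where "v = exp (N / 2 * (ln (2 * pi) + 1 + ln (1 - \<delta>)))"
  \<comment> \<open>One factor \<open>\<delta>\<close> is the relative volume of the shell, from 1 +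
    \<delta> \<le> (1 + \<delta>)^N with N \<ge> 1; the other is the loss in
    \<open>unit_ball_vol_ge\<close> with \<eta> = \<delta>. Together with the 2 from exp \<le> 2
    cosh they make up the summand ln (2 / \<delta>^2).\<close>
  have "v * \<delta>\<^sup>2 * x \<le> (\<rho> ^ N - sqrt N ^ N) * (V * x)"
  proof -
    have "1 + \<delta> \<le> (1 + \<delta>) ^ N"
      using N \<delta> by (simp add: self_le_power)
    then have "sqrt N ^ N * \<delta> \<le> sqrt N ^ N * ((1 + \<delta>) ^ N - 1)"
      by (intro mult_left_mono) auto
    also have "\<dots> = \<rho> ^ N - sqrt N ^ N"
      by (simp add: \<rho>_def power_mult_distrib right_diff_distrib)
    finally have "sqrt N ^ N * \<delta> * (V * x) \<le> (\<rho> ^ N - sqrt N ^ N) * (V * x)"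
      using V x by (intro mult_right_mono) auto
    moreover have "v * \<delta> * (\<delta> * x) \<le> V * sqrt N ^ N * (\<delta> * x)"
      using unit_ball_vol_ge[OF N \<delta>] x \<delta> unfolding v_def V_def by (intro mult_right_mono) auto
    ultimately show ?thesis by (simp add: power2_eq_square mult_ac)
  qed
  then have "exp (- (T / 2 * \<rho>\<^sup>2)) * (v * \<delta>\<^sup>2 * x) \<le> G"
    by (intro order_trans[OF mult_left_mono main]) auto
  then have "2 * x \<le> 2 * (G * exp (T / 2 * \<rho>\<^sup>2) / v / \<delta>\<^sup>2)"
    using \<delta> by (simp add: v_def exp_minus field_simps)
  also have "\<dots> = exp (N / 2 * (T * (1 + \<delta>)\<^sup>2 - 1 - ln T - ln (1 - \<delta>)) + (\<Sum>i<N. (w i)\<^sup>2) / (2 * T) + ln (2 / \<delta>\<^sup>2))"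
  proof -
    have sq: "sqrt (2 * pi / T) ^ N = exp (N / 2 * (ln (2 * pi) - ln T))"
    proof -
      have "sqrt (2 * pi / T) ^ N = exp (ln (sqrt (2 * pi / T))) ^ N" using T by simp
      also have "\<dots> = exp (real N * ln (sqrt (2 * pi / T)))" by (simp add: exp_of_nat_mult)
      finally show ?thesis using T by (simp add: ln_sqrt ln_div)
    qed
    have \<rho>2: "\<rho>\<^sup>2 = N * (1 + \<delta>)\<^sup>2" by (simp add: \<rho>_def power_mult_distrib)
    have E: "G * exp (T / 2 * \<rho>\<^sup>2) / v
        = exp (N / 2 * (T * (1 + \<delta>)\<^sup>2 - 1 - ln T - ln (1 - \<delta>)) + (\<Sum>i<N. (w i)\<^sup>2) / (2 * T))"
    proof -
      have "N / 2 * (T * (1 + \<delta>)\<^sup>2 - 1 - ln T - ln (1 - \<delta>)) + (\<Sum>i<N. (w i)\<^sup>2) / (2 * T)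
          = N / 2 * (ln (2 * pi) - ln T) + (\<Sum>i<N. (w i)\<^sup>2) / (2 * T) + T / 2 * (N * (1 + \<delta>)\<^sup>2)
            - N / 2 * (ln (2 * pi) + 1 + ln (1 - \<delta>))"
        by (simp add: field_simps)
      then show ?thesis
        unfolding G_def v_def sq \<rho>2 by (simp only: exp_add exp_diff)
    qed
    have "2 * (G * exp (T / 2 * \<rho>\<^sup>2) / v / \<delta>\<^sup>2) = (G * exp (T / 2 * \<rho>\<^sup>2) / v) * exp (ln (2 / \<delta>\<^sup>2))"
      using \<delta> by simp
    then show ?thesis unfolding E by (simp only: exp_add)
  qed
  finally have x_le: "2 * x \<le> \<dots>" .
  have "(\<integral>\<^sup>+ \<sigma>. ennreal (exp (\<Sum>i<N. w i * \<sigma> i)) \<partial>sphere_measure N) \<le> (\<integral>\<^sup>+ \<sigma>. ennreal 2 * ennreal (\<phi> \<sigma>) \<partial>sphere_measure N)"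
  proof (rule nn_integral_mono)
    fix \<sigma>
    have "ennreal (exp (\<Sum>i<N. w i * \<sigma> i)) \<le> ennreal (2 * \<phi> \<sigma>)"
      unfolding \<phi>_def by (rule ennreal_leI) (rule exp_le_2_cosh)
    also have "\<dots> = ennreal 2 * ennreal (\<phi> \<sigma>)"
      using \<phi>0[of \<sigma>] by (intro ennreal_mult) auto
    finally show "ennreal (exp (\<Sum>i<N. w i * \<sigma> i)) \<le> ennreal 2 * ennreal (\<phi> \<sigma>)" .
  qed
  also have "\<dots> = ennreal (2 * x)"
    using x by (subst nn_integral_cmult) (auto simp: X_def[symmetric] ennreal_mult)
  also have "\<dots> \<le> ennreal (exp (N / 2 * (T * (1 + \<delta>)\<^sup>2 - 1 - ln T - ln (1 - \<delta>)) + (\<Sum>i<N. (w i)\<^sup>2) / (2 * T) + ln (2 / \<delta>\<^sup>2)))"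
    using x_le by (rule ennreal_leI)
  finally show ?thesis .
qed

section \<open>Diagonalisation of symmetric matrices\<close>

text \<open>The reflection along w = e - v, with e the first unit vector, exchanges e and v. Since v
  is a unit vector, \<parallel>w\<parallel>^2 = 2 \<open>w 0\<close>. If v = e, then s = 0 and
  division by 0 makes \<open>H\<close> the identity, so the formula covers this case too.\<close>

lemma householder:
  fixes v :: "real vec"
  assumes v: "v \<in> carrier_vec (Suc m)" and vv: "v \<bullet> v = 1"
  shows "\<exists>H \<in> carrier_mat (Suc m) (Suc m). H\<^sup>T = H \<and> H * H = 1\<^sub>m (Suc m) \<and> H *\<^sub>v unit_vec (Suc m) 0 = v"
proof -
  define n where "n = Suc m"
  define w where "w i = (if i = 0 then 1 else 0) - v $ i" for i
  define s where "s = (\<Sum>i<n. w i * w i)"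
  define H where "H = Matrix.mat n n (\<lambda>(i, j). (if i = j then 1 else 0) - 2 * w i * w j / s)"
  have dim: "dim_vec v = n" using v by (simp add: n_def)
  have vs: "(\<Sum>i<n. v $ i * v $ i) = 1"
    using vv by (simp add: scalar_prod_def dim atLeast0LessThan)
  have n0: "0 < n" by (simp add: n_def)
  have "s = (\<Sum>i<n. (if i = 0 then 1 else 0) - 2 * (if i = 0 then v $ i else 0) + v $ i * v $ i)"
    unfolding s_def w_def by (intro sum.cong) (auto simp: algebra_simps)
  also have "\<dots> = 2 * w 0"
    using n0 vs by (simp add: sum.distrib sum_subtractf sum_distrib_left[symmetric] w_def)
  finally have sw: "s = 2 * w 0" .
  have w0: "w i = 0" if "s = 0" "i < n" for i
  proof -
    have "\<forall>i\<in>{..<n}. w i * w i = 0"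
      using that(1) unfolding s_def by (subst (asm) sum_nonneg_eq_0_iff) auto
    then show ?thesis using that by auto
  qed
  have H: "H \<in> carrier_mat n n" by (simp add: H_def)
  moreover have "H\<^sup>T = H"
    by (rule eq_matI) (auto simp: H_def)
  moreover have "H * H = 1\<^sub>m n"
  proof (rule eq_matI)
    fix i j assume "i < dim_row (1\<^sub>m n :: real mat)" "j < dim_col (1\<^sub>m n :: real mat)"
    then have ij: "i < n" "j < n" by auto
    have "(H * H) $$ (i, j) = (\<Sum>k<n. ((if i = k then 1 else 0) - 2 * w i * w k / s) * ((if k = j then 1 else 0) - 2 * w k * w j / s))"
      using ij by (simp add: H_def scalar_prod_def atLeast0LessThan)
    also have "\<dots> = (\<Sum>k<n. (if k = i then (if k = j then 1 else 0) else 0) - (if k = i then 2 * w k * w j / s else 0)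
        - (if k = j then 2 * w i * w k / s else 0) + 4 * w i * w j / s / s * (w k * w k))"
      by (intro sum.cong) (auto simp: algebra_simps)
    also have "\<dots> = (if i = j then 1 else 0) - 4 * w i * w j / s + 4 * w i * w j / s / s * s"
    proof -
      have "(\<Sum>k<n. 4 * w i * w j / s / s * (w k * w k)) = 4 * w i * w j / s / s * s"
        by (simp only: sum_distrib_left[symmetric] s_def[symmetric])
      then show ?thesis using ij by (simp add: sum.distrib sum_subtractf)
    qed
    also have "\<dots> = (if i = j then 1 else 0)"
      using w0 ij by (cases "s = 0") auto
    finally show "(H * H) $$ (i, j) = 1\<^sub>m n $$ (i, j)" using ij by simp
  qed (auto simp: H_def)
  moreover have "H *\<^sub>v unit_vec n 0 = v"
  proof (rule eq_vecI)
    fix i assume "i < dim_vec v"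
    then have i: "i < n" by (simp add: dim)
    have "(H *\<^sub>v unit_vec n 0) $ i = (\<Sum>k<n. ((if i = k then 1 else 0) - 2 * w i * w k / s) * (if k = 0 then 1 else 0))"
      using i by (simp add: H_def scalar_prod_def atLeast0LessThan unit_vec_def)
    also have "\<dots> = (if i = 0 then 1 else 0) - 2 * w i * w 0 / s"
      using n0 by (simp add: if_distrib[of "(*) _"] cong: if_cong)
    also have "\<dots> = v $ i"
    proof -
      have "2 * w i * w 0 / s = w i"
        using w0[of i] i sw by (cases "s = 0") auto
      then show ?thesis by (simp add: w_def)
    qed
    finally show "(H *\<^sub>v unit_vec n 0) $ i = v $ i" .
  qed (simp add: H_def dim)
  ultimately show ?thesis unfolding n_def by blast
qed

text \<open>A unit eigenvector for \<open>r 0\<close> is reflected onto the first unit vector; by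
  symmetry the first row vanishes together with the first column, and a smaller symmetric block is
  left. Cancelling one linear factor of the characteristic polynomial leaves the shifted sequence
  \<open>r (Suc j)\<close>, so the induction returns the diagonal in the prescribed order and with
  the prescribed multiplicities.\<close>

lemma symmetric_mat_diagonalization:
  fixes A :: "real mat" and r :: "nat \<Rightarrow> real"
  assumes "A \<in> carrier_mat n n" "A\<^sup>T = A" "char_poly A = (\<Prod>j<n. [:- r j, 1:])"
  shows "\<exists>U \<in> carrier_mat n n. U\<^sup>T * U = 1\<^sub>m n \<and>
    U\<^sup>T * A * U = Matrix.mat n n (\<lambda>(i, j). if i = j then r i else 0)"
  using assms
proof (induction n arbitrary: A r)
  case 0
  then show ?case by (intro bexI[of _ "1\<^sub>m 0"]) (auto intro!: eq_matI)
next
  case (Suc m)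
  define n where "n = Suc m"
  have A: "A \<in> carrier_mat n n" using Suc.prems by (simp add: n_def)
  have cp: "char_poly A = [:- r 0, 1:] * (\<Prod>j<m. [:- r (Suc j), 1:])"
    unfolding Suc.prems(3) by (simp only: prod.lessThan_Suc_shift)
  then have "poly (char_poly A) (r 0) = 0" by simp
  then have "eigenvalue A (r 0)" using eigenvalue_root_char_poly[OF A] by simp
  then obtain v0 where v0: "v0 \<in> carrier_vec n" "v0 \<noteq> 0\<^sub>v n" "A *\<^sub>v v0 = r 0 \<cdot>\<^sub>v v0"
    using A unfolding eigenvalue_def eigenvector_def by auto
  define v where "v = (1 / sqrt (v0 \<bullet> v0)) \<cdot>\<^sub>v v0"
  have v0v0: "0 < v0 \<bullet> v0"
    using conjugate_square_greater_0_vec[OF v0(1)] v0(2) by simp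
  have v: "v \<in> carrier_vec n" using v0 by (simp add: v_def)
  have vv: "v \<bullet> v = 1"
    using v0 v0v0 by (simp add: v_def)
  have Av: "A *\<^sub>v v = r 0 \<cdot>\<^sub>v v"
    unfolding v_def using v0 A by (simp add: mult_mat_vec smult_smult_assoc mult.commute)
  obtain H where H: "H \<in> carrier_mat n n" "H\<^sup>T = H" "H * H = 1\<^sub>m n" "H *\<^sub>v unit_vec n 0 = v"
    using householder[of v m] v vv by (auto simp: n_def)
  define B where "B = H * A * H"
  have B: "B \<in> carrier_mat n n" using H A by (simp add: B_def)
  have BT: "B\<^sup>T = B"
    unfolding B_def using H A Suc.prems(2)
    by (simp add: transpose_mult[of _ n n _ n] assoc_mult_mat[of _ n n _ n _ n])
  have Hv: "H *\<^sub>v v = unit_vec n 0"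
    using H(4)[symmetric] H(1,3) by (simp flip: assoc_mult_mat_vec)
  have "B *\<^sub>v unit_vec n 0 = H *\<^sub>v (A *\<^sub>v (H *\<^sub>v unit_vec n 0))"
    unfolding B_def using H A by (simp add: assoc_mult_mat_vec[of _ n n _ n])
  also have "\<dots> = r 0 \<cdot>\<^sub>v unit_vec n 0"
    unfolding H(4) Av using H v Hv by (simp add: mult_mat_vec)
  finally have Be: "B *\<^sub>v unit_vec n 0 = r 0 \<cdot>\<^sub>v unit_vec n 0" .
  have col0: "B $$ (i, 0) = (if i = 0 then r 0 else 0)" if "i < n" for i
  proof -
    have "(B *\<^sub>v unit_vec n 0) $ i = B $$ (i, 0)"
      using B that by (simp add: n_def)
    then show ?thesis unfolding Be using that by (auto simp: unit_vec_def n_def)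
  qed
  have row0: "B $$ (0, i) = (if i = 0 then r 0 else 0)" if "i < n" for i
    using col0[OF that] arg_cong[OF BT, of "\<lambda>M. M $$ (i, 0)"] B that by (simp add: n_def)
  define B1 where "B1 = Matrix.mat 1 1 (\<lambda>_. r 0)"
  define B4 where "B4 = Matrix.mat m m (\<lambda>(i, j). B $$ (Suc i, Suc j))"
  have B1: "B1 \<in> carrier_mat 1 1" and B4: "B4 \<in> carrier_mat m m" by (simp_all add: B1_def B4_def)
  have Bblock: "B = four_block_mat B1 (0\<^sub>m 1 m) (0\<^sub>m m 1) B4"
    using B by (intro eq_matI) (auto simp: B1_def B4_def n_def row0 col0)
  have "similar_mat B A"
    unfolding similar_mat_def similar_mat_wit_def Let_def B_def
    using H A by (intro exI[of _ H]) auto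
  then have "char_poly B = char_poly A" by (rule char_poly_similar)
  moreover have "char_poly B = char_poly B1 * char_poly B4"
    unfolding Bblock by (rule char_poly_four_block_zeros_col) (use B1 B4 in auto)
  moreover have "char_poly B1 = [:- r 0, 1:]"
  proof -
    have "char_poly B1 = (\<Prod>a\<leftarrow>diag_mat B1. [:- a, 1:])"
      by (rule char_poly_upper_triangular[OF B1]) (auto simp: B1_def)
    then show ?thesis by (simp add: diag_mat_def B1_def)
  qed
  ultimately have "[:- r 0, 1:] * char_poly B4 = [:- r 0, 1:] * (\<Prod>j<m. [:- r (Suc j), 1:])"
    using cp by simp
  then have "char_poly B4 = (\<Prod>j<m. [:- r (Suc j), 1:])"
    by (subst (asm) mult_left_cancel) auto
  moreover have "B4\<^sup>T = B4"
  proof (rule eq_matI)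
    fix i j assume "i < dim_row B4" "j < dim_col B4"
    then have ij: "i < m" "j < m" using B4 by auto
    show "B4\<^sup>T $$ (i, j) = B4 $$ (i, j)"
      using arg_cong[OF BT, of "\<lambda>M. M $$ (Suc i, Suc j)"] ij B by (simp add: B4_def n_def)
  qed (use B4 in auto)
  ultimately obtain V where V: "V \<in> carrier_mat m m" "V\<^sup>T * V = 1\<^sub>m m"
    "V\<^sup>T * B4 * V = Matrix.mat m m (\<lambda>(i, j). if i = j then r (Suc i) else 0)"
    using Suc.IH[OF B4, of "\<lambda>j. r (Suc j)"] by auto
  define W where "W = four_block_mat (1\<^sub>m 1) (0\<^sub>m 1 m) (0\<^sub>m m 1) V"
  have W: "W \<in> carrier_mat n n"
    unfolding W_def n_def using four_block_carrier_mat[of "1\<^sub>m 1" 1 1 V m m] V by simp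
  have WT: "W\<^sup>T = four_block_mat (1\<^sub>m 1) (0\<^sub>m 1 m) (0\<^sub>m m 1) V\<^sup>T"
    unfolding W_def using V
    by (subst transpose_four_block_mat[of _ 1 1 _ m _ m]) auto
  have WTW: "W\<^sup>T * W = 1\<^sub>m n"
  proof -
    have "W\<^sup>T * W = four_block_mat (1\<^sub>m 1) (0\<^sub>m 1 m) (0\<^sub>m m 1) V\<^sup>T * four_block_mat (1\<^sub>m 1) (0\<^sub>m 1 m) (0\<^sub>m m 1) V"
      by (simp only: WT) (simp only: W_def)
    also have "\<dots> = four_block_mat (1\<^sub>m 1) (0\<^sub>m 1 m) (0\<^sub>m m 1) (V\<^sup>T * V)"
      using V(1) by (subst mult_four_block_mat[of _ 1 1 _ m _ m _ _ 1 _ m]) auto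
    finally show ?thesis unfolding V(2) n_def by (simp add: four_block_one_mat)
  qed
  have WTBW: "W\<^sup>T * B * W = Matrix.mat n n (\<lambda>(i, j). if i = j then r i else 0)"
  proof -
    have "W\<^sup>T * B * W = four_block_mat B1 (0\<^sub>m 1 m) (0\<^sub>m m 1) (V\<^sup>T * B4 * V)"
    proof -
      have "W\<^sup>T * B = four_block_mat B1 (0\<^sub>m 1 m) (0\<^sub>m m 1) (V\<^sup>T * B4)"
        unfolding WT Bblock using V(1) B1 B4
        by (subst mult_four_block_mat[of _ 1 1 _ m _ m _ _ 1 _ m]) auto
      then show ?thesis
        using V(1) B1 B4
        by (simp only: W_def) (subst mult_four_block_mat[of _ 1 1 _ m _ m _ _ 1 _ m]; auto)
    qed
    also have "\<dots> = Matrix.mat n n (\<lambda>(i, j). if i = j then r i else 0)"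
      unfolding V(3) B1_def by (intro eq_matI) (auto simp: n_def)
    finally show ?thesis .
  qed
  have "(H * W)\<^sup>T = W\<^sup>T * H"
    using H W by (simp add: transpose_mult[of _ n n _ n])
  moreover have "W\<^sup>T * H * (H * W) = W\<^sup>T * (H * H) * W"
    using H(1) W by (simp add: assoc_mult_mat[of _ n n _ n _ n])
  moreover have "W\<^sup>T * H * A * (H * W) = W\<^sup>T * B * W"
    using H(1) W A by (simp add: B_def assoc_mult_mat[of _ n n _ n _ n])
  ultimately show ?case
    using H W WTW WTBW by (intro bexI[of _ "H * W"]) (auto simp: n_def)
qed

text \<open>The coordinate form of the diagonalisation. Orthonormality of the rows follows from that
  of the columns because a left inverse of a square matrix is also a right inverse.\<close>

lemma symmetric_mat_eigenbasis:
  fixes A :: "real mat" and r :: "nat \<Rightarrow> real"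
  assumes A: "A \<in> carrier_mat n n" "A\<^sup>T = A" "char_poly A = (\<Prod>j<n. [:- r j, 1:])"
  obtains u :: "nat \<Rightarrow> nat \<Rightarrow> real" where
    "\<And>k l. k < n \<Longrightarrow> l < n \<Longrightarrow> (\<Sum>i<n. u i k * u i l) = (if k = l then 1 else 0)"
    "\<And>i j. i < n \<Longrightarrow> j < n \<Longrightarrow> (\<Sum>k<n. u i k * u j k) = (if i = j then 1 else 0)"
    "\<And>k l. k < n \<Longrightarrow> l < n \<Longrightarrow> (\<Sum>i<n. \<Sum>j<n. u i k * A $$ (i, j) * u j l) = (if k = l then r k else 0)"
proof -
  obtain U where U: "U \<in> carrier_mat n n" "U\<^sup>T * U = 1\<^sub>m n"
    "U\<^sup>T * A * U = Matrix.mat n n (\<lambda>(i, j). if i = j then r i else 0)"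
    using symmetric_mat_diagonalization[OF A] by blast
  have UUT: "U * U\<^sup>T = 1\<^sub>m n"
    using mat_mult_left_right_inverse[of "U\<^sup>T" n U] U by auto
  show ?thesis
  proof (rule that[of "\<lambda>i k. U $$ (i, k)"])
    fix k l assume kl: "k < n" "l < n"
    show "(\<Sum>i<n. U $$ (i, k) * U $$ (i, l)) = (if k = l then 1 else 0)"
      using arg_cong[OF U(2), of "\<lambda>M. M $$ (k, l)"] U(1) kl
      by (simp add: scalar_prod_def atLeast0LessThan)
    show "(\<Sum>i<n. U $$ (k, i) * U $$ (l, i)) = (if k = l then 1 else 0)"
      using arg_cong[OF UUT, of "\<lambda>M. M $$ (k, l)"] U(1) kl
      by (simp add: scalar_prod_def atLeast0LessThan)
    have "(U\<^sup>T * A * U) $$ (k, l) = (\<Sum>i<n. U $$ (i, k) * (\<Sum>j<n. A $$ (i, j) * U $$ (j, l)))"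
      using U(1) A(1) kl by (simp add: scalar_prod_def atLeast0LessThan)
    also have "\<dots> = (\<Sum>i<n. \<Sum>j<n. U $$ (i, k) * A $$ (i, j) * U $$ (j, l))"
      by (simp add: sum_distrib_left mult.assoc)
    finally show "(\<Sum>i<n. \<Sum>j<n. U $$ (i, k) * A $$ (i, j) * U $$ (j, l)) = (if k = l then r k else 0)"
      unfolding U(3) using kl by simp
  qed
qed

lemma spin_f_less:
  fixes r :: real
  shows "r < 1 \<Longrightarrow> spin_f r < ereal (2 * r - 3 / 2)"
    and "spin_f r \<le> ereal (2 * r - 3 / 2)"
proof -
  have *: "ln r + r\<^sup>2 / 2 < 2 * r - 3 / 2" if r: "0 < r" "r < 1" for r :: real
  proof -
    define h where "h t = ln t + t\<^sup>2 / 2 - 2 * t" for t :: real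
    have "h r < h 1"
    proof (rule DERIV_pos_imp_increasing_open[OF r(2)])
      fix x assume x: "r < x" "x < 1"
      have "(h has_real_derivative 1 / x + x - 2) (at x)"
        unfolding h_def[abs_def] using x r by (auto intro!: derivative_eq_intros)
      moreover have "1 / x + x - 2 = (x - 1)\<^sup>2 / x"
        using x r by (simp add: field_simps power2_eq_square)
      moreover have "(x - 1)\<^sup>2 / x > 0" using x r by (intro divide_pos_pos) auto
      ultimately show "\<exists>y. (h has_real_derivative y) (at x) \<and> 0 < y" by auto
    next
      show "continuous_on {r..1} h"
        unfolding h_def[abs_def] using r by (auto intro!: continuous_intros)
    qed
    then show ?thesis by (simp add: h_def)
  qed
  show "r < 1 \<Longrightarrow> spin_f r < ereal (2 * r - 3 / 2)"
    using *[of r] by (auto simp: spin_f_def)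
  then show "spin_f r \<le> ereal (2 * r - 3 / 2)"
    by (cases "r < 1"; cases "r = 1") (auto simp: spin_f_def)
qed

section \<open>Overlaps in the eigenbasis\<close>

text \<open>With vectors a_k and b_m this is the trace inner product of the matrices \<Sum>k a_k
  a_k^T and \<Sum>m b_m b_m^T. It turns covariances of the Hamiltonian into squared inner products
  of configurations.\<close>

lemma sum_square_bilinear:
  fixes a b :: "'k \<Rightarrow> 'i \<Rightarrow> real"
  shows "(\<Sum>i\<in>I. \<Sum>l\<in>I. (\<Sum>k\<in>A. a k i * a k l) * (\<Sum>k\<in>B. b k i * b k l))
    = (\<Sum>k\<in>A. \<Sum>m\<in>B. (\<Sum>i\<in>I. a k i * b m i)\<^sup>2)"
proof -
  have "(\<Sum>i\<in>I. \<Sum>l\<in>I. (\<Sum>k\<in>A. a k i * a k l) * (\<Sum>k\<in>B. b k i * b k l))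
      = (\<Sum>i\<in>I. \<Sum>l\<in>I. \<Sum>k\<in>A. \<Sum>m\<in>B. (a k i * b m i) * (a k l * b m l))"
    by (simp add: sum_product mult_ac)
  also have "\<dots> = (\<Sum>i\<in>I. \<Sum>k\<in>A. \<Sum>l\<in>I. \<Sum>m\<in>B. (a k i * b m i) * (a k l * b m l))"
    by (intro sum.cong refl sum.swap)
  also have "\<dots> = (\<Sum>k\<in>A. \<Sum>i\<in>I. \<Sum>l\<in>I. \<Sum>m\<in>B. (a k i * b m i) * (a k l * b m l))"
    by (rule sum.swap)
  also have "\<dots> = (\<Sum>k\<in>A. \<Sum>i\<in>I. \<Sum>m\<in>B. \<Sum>l\<in>I. (a k i * b m i) * (a k l * b m l))"
    by (intro sum.cong refl sum.swap)
  also have "\<dots> = (\<Sum>k\<in>A. \<Sum>m\<in>B. \<Sum>i\<in>I. \<Sum>l\<in>I. (a k i * b m i) * (a k l * b m l))"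
    by (intro sum.cong refl, rule sum.swap)
  also have "\<dots> = (\<Sum>k\<in>A. \<Sum>m\<in>B. (\<Sum>i\<in>I. a k i * b m i)\<^sup>2)"
    by (simp add: power2_eq_square sum_product)
  finally show ?thesis .
qed

locale eigen_overlap =
  fixes n :: nat and \<beta> r :: "nat \<Rightarrow> real" and Q :: "real mat" and u :: "nat \<Rightarrow> nat \<Rightarrow> real"
  assumes \<beta>_pos: "\<And>j. j < n \<Longrightarrow> 0 < \<beta> j"
    and u_cols: "\<And>k l. k < n \<Longrightarrow> l < n \<Longrightarrow> (\<Sum>i<n. u i k * u i l) = (if k = l then 1 else 0)"
    and u_rows: "\<And>i j. i < n \<Longrightarrow> j < n \<Longrightarrow> (\<Sum>k<n. u i k * u j k) = (if i = j then 1 else 0)"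
    and u_diag: "\<And>k l. k < n \<Longrightarrow> l < n \<Longrightarrow>
      (\<Sum>i<n. \<Sum>j<n. u i k * (sqrt (\<beta> i * \<beta> j) * Q $$ (i, j)) * u j l) = (if k = l then r k else 0)"
    and r_nonneg: "\<And>k. k < n \<Longrightarrow> 0 \<le> r k"
begin

lemma sum_rotate:
  fixes a b :: "nat \<Rightarrow> real"
  shows "(\<Sum>k<n. (\<Sum>j<n. u j k * a j) * (\<Sum>j<n. u j k * b j)) = (\<Sum>j<n. a j * b j)"
    and "(\<Sum>j<n. (\<Sum>k<n. u j k * a k) * (\<Sum>k<n. u j k * b k)) = (\<Sum>k<n. a k * b k)"
proof -
  have "(\<Sum>k<n. (\<Sum>j<n. u j k * a j) * (\<Sum>j<n. u j k * b j))
      = (\<Sum>k<n. \<Sum>i<n. \<Sum>j<n. (u i k * u j k) * (a i * b j))"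
    by (simp add: sum_product mult_ac)
  also have "\<dots> = (\<Sum>i<n. \<Sum>j<n. \<Sum>k<n. (u i k * u j k) * (a i * b j))"
    by (subst sum.swap, rule sum.cong[OF refl], rule sum.swap)
  also have "\<dots> = (\<Sum>i<n. \<Sum>j<n. (if i = j then 1 else 0) * (a i * b j))"
    by (intro sum.cong refl) (simp add: sum_distrib_right[symmetric] u_rows)
  also have "\<dots> = (\<Sum>j<n. a j * b j)"
    by (intro sum.cong refl) (simp add: if_distrib[of "\<lambda>x. x * _"] cong: if_cong)
  finally show "(\<Sum>k<n. (\<Sum>j<n. u j k * a j) * (\<Sum>j<n. u j k * b j)) = (\<Sum>j<n. a j * b j)" .
  have "(\<Sum>j<n. (\<Sum>k<n. u j k * a k) * (\<Sum>k<n. u j k * b k))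
      = (\<Sum>j<n. \<Sum>k<n. \<Sum>l<n. (u j k * u j l) * (a k * b l))"
    by (simp add: sum_product mult_ac)
  also have "\<dots> = (\<Sum>k<n. \<Sum>l<n. \<Sum>j<n. (u j k * u j l) * (a k * b l))"
    by (subst sum.swap, rule sum.cong[OF refl], rule sum.swap)
  also have "\<dots> = (\<Sum>k<n. \<Sum>l<n. (if k = l then 1 else 0) * (a k * b l))"
    by (intro sum.cong refl) (simp add: sum_distrib_right[symmetric] u_cols)
  also have "\<dots> = (\<Sum>k<n. a k * b k)"
    by (intro sum.cong refl) (simp add: if_distrib[of "\<lambda>x. x * _"] cong: if_cong)
  finally show "(\<Sum>j<n. (\<Sum>k<n. u j k * a k) * (\<Sum>k<n. u j k * b k)) = (\<Sum>k<n. a k * b k)" .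
qed

definition rot :: "(nat \<Rightarrow> nat \<Rightarrow> real) \<Rightarrow> nat \<Rightarrow> nat \<Rightarrow> real" where
  "rot \<sigma> k i = (\<Sum>j<n. u j k * (sqrt (\<beta> j) * \<sigma> j i))"

text \<open>The Hamiltonian sees the configurations only through the matrix of the weighted sums on
  the right, and rows of an orthogonal matrix drop out of it. This is why the rotation leaves the
  total energy a sum of the same form, with all weights equal to 1.\<close>

lemma sum_rot: "(\<Sum>k<n. rot \<sigma> k i * rot \<sigma> k l) = (\<Sum>j<n. \<beta> j * (\<sigma> j i * \<sigma> j l))"
  unfolding rot_def sum_rotate
proof (intro sum.cong refl)
  fix j assume "j \<in> {..<n}"
  then have "sqrt (\<beta> j) * sqrt (\<beta> j) = \<beta> j" using \<beta>_pos[of j] by simp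
  then show "sqrt (\<beta> j) * \<sigma> j i * (sqrt (\<beta> j) * \<sigma> j l) = \<beta> j * (\<sigma> j i * \<sigma> j l)"
    by (metis mult.assoc mult.left_commute)
qed

lemma hamiltonian_rot:
  "(\<Sum>j<n. \<beta> j * hamiltonian N G (\<sigma> j))
    = (\<Sum>i<N. \<Sum>l<N. G i l * ((\<Sum>k<n. rot \<sigma> k i * rot \<sigma> k l) / (sqrt 2 * sqrt (real N))))"
proof -
  have "(\<Sum>j<n. \<beta> j * hamiltonian N G (\<sigma> j))
      = (\<Sum>j<n. \<Sum>i<N. \<Sum>l<N. G i l * (\<beta> j * (\<sigma> j i * \<sigma> j l)) / (sqrt 2 * sqrt (real N)))"
    unfolding hamiltonian_def by (simp add: sum_distrib_left sum_divide_distrib mult_ac)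
  also have "\<dots> = (\<Sum>i<N. \<Sum>l<N. \<Sum>j<n. G i l * (\<beta> j * (\<sigma> j i * \<sigma> j l)) / (sqrt 2 * sqrt (real N)))"
    by (subst sum.swap, rule sum.cong[OF refl], rule sum.swap)
  finally show ?thesis
    by (simp add: sum_rot sum_distrib_left sum_divide_distrib)
qed

definition overlap_const :: real where
  "overlap_const = (\<Sum>k<n. \<Sum>l<n. \<Sum>i<n. \<Sum>j<n. \<bar>u i k * sqrt (\<beta> i * \<beta> j) * u j l\<bar>)"

lemma overlap_const_nonneg: "0 \<le> overlap_const"
  unfolding overlap_const_def by (intro sum_nonneg) auto

text \<open>The Gram matrix of the rotated vectors is N times the rotation of the matrix with
  entries sqrt (\<beta> i \<beta> j) R i j. The rotation makes its limit diagonal with entries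
  \<open>r k\<close>, and an overlap tolerance \<epsilon> is amplified at most by the sum of the
  absolute coefficients; \<open>overlap_const\<close> sums over all k and l as well in order to
  serve every pair at once.\<close>

lemma rot_inner:
  assumes \<sigma>: "\<sigma> \<in> overlap_set n Q \<epsilon> N" and N: "0 < N" and kl: "k < n" "l < n"
  shows "\<bar>(\<Sum>i<N. rot \<sigma> k i * rot \<sigma> l i) - N * (if k = l then r k else 0)\<bar> \<le> N * (\<epsilon> * overlap_const)"
proof -
  define R where "R i j = overlap N (\<sigma> i) (\<sigma> j)" for i j
  have R: "\<bar>R i j - Q $$ (i, j)\<bar> \<le> \<epsilon>" if "i < n" "j < n" for i j
    using \<sigma> that unfolding overlap_set_def R_def by (auto simp: abs_le_iff) (smt (verit))+
  have \<epsilon>: "0 \<le> \<epsilon>" using R[OF kl] by linarith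
  have NR: "(\<Sum>p<N. \<sigma> i p * \<sigma> j p) = N * R i j" for i j
    using N by (simp add: R_def overlap_def)
  have "(\<Sum>p<N. rot \<sigma> k p * rot \<sigma> l p)
      = (\<Sum>p<N. \<Sum>i<n. \<Sum>j<n. u i k * sqrt (\<beta> i * \<beta> j) * u j l * (\<sigma> i p * \<sigma> j p))"
    unfolding rot_def sum_product real_sqrt_mult by (simp add: mult_ac)
  also have "\<dots> = (\<Sum>i<n. \<Sum>j<n. \<Sum>p<N. u i k * sqrt (\<beta> i * \<beta> j) * u j l * (\<sigma> i p * \<sigma> j p))"
    by (subst sum.swap, rule sum.cong[OF refl], rule sum.swap)
  also have "\<dots> = (\<Sum>i<n. \<Sum>j<n. u i k * sqrt (\<beta> i * \<beta> j) * u j l * (N * R i j))"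
    by (simp add: sum_distrib_left[symmetric] NR)
  finally have 1: "(\<Sum>p<N. rot \<sigma> k p * rot \<sigma> l p) = (\<Sum>i<n. \<Sum>j<n. u i k * sqrt (\<beta> i * \<beta> j) * u j l * (N * R i j))" .
  have 2: "N * (if k = l then r k else 0) = (\<Sum>i<n. \<Sum>j<n. u i k * sqrt (\<beta> i * \<beta> j) * u j l * (N * Q $$ (i, j)))"
    unfolding u_diag[OF kl, symmetric] by (simp add: sum_distrib_left mult_ac)
  have "\<bar>(\<Sum>i<N. rot \<sigma> k i * rot \<sigma> l i) - N * (if k = l then r k else 0)\<bar>
      = \<bar>\<Sum>i<n. \<Sum>j<n. (u i k * sqrt (\<beta> i * \<beta> j) * u j l) * (N * (R i j - Q $$ (i, j)))\<bar>"
    unfolding 1 2 by (simp add: sum_subtractf[symmetric] algebra_simps)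
  also have "\<dots> \<le> (\<Sum>i<n. \<bar>\<Sum>j<n. (u i k * sqrt (\<beta> i * \<beta> j) * u j l) * (N * (R i j - Q $$ (i, j)))\<bar>)"
    by (rule sum_abs)
  also have "\<dots> \<le> (\<Sum>i<n. \<Sum>j<n. \<bar>(u i k * sqrt (\<beta> i * \<beta> j) * u j l) * (N * (R i j - Q $$ (i, j)))\<bar>)"
    by (intro sum_mono sum_abs)
  also have "\<dots> \<le> (\<Sum>i<n. \<Sum>j<n. \<bar>u i k * sqrt (\<beta> i * \<beta> j) * u j l\<bar> * (N * \<epsilon>))"
  proof (intro sum_mono)
    fix i j assume "i \<in> {..<n}" "j \<in> {..<n}"
    then have "\<bar>N * (R i j - Q $$ (i, j))\<bar> \<le> N * \<epsilon>"
      using R[of i j] N by (simp add: abs_mult)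
    then show "\<bar>(u i k * sqrt (\<beta> i * \<beta> j) * u j l) * (N * (R i j - Q $$ (i, j)))\<bar>
        \<le> \<bar>u i k * sqrt (\<beta> i * \<beta> j) * u j l\<bar> * (N * \<epsilon>)"
      by (subst abs_mult) (intro mult_left_mono, auto)
  qed
  also have "\<dots> = (\<Sum>i<n. \<Sum>j<n. \<bar>u i k * sqrt (\<beta> i * \<beta> j) * u j l\<bar>) * (N * \<epsilon>)"
    by (simp add: sum_distrib_right)
  also have "\<dots> \<le> overlap_const * (N * \<epsilon>)"
  proof (intro mult_right_mono)
    have "(\<Sum>i<n. \<Sum>j<n. \<bar>u i k * sqrt (\<beta> i * \<beta> j) * u j l\<bar>)
        \<le> (\<Sum>l<n. \<Sum>i<n. \<Sum>j<n. \<bar>u i k * sqrt (\<beta> i * \<beta> j) * u j l\<bar>)"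
      using kl by (intro member_le_sum[where f = "\<lambda>l. \<Sum>i<n. \<Sum>j<n. \<bar>u i k * sqrt (\<beta> i * \<beta> j) * u j l\<bar>"])
        (auto intro!: sum_nonneg)
    also have "\<dots> \<le> overlap_const"
      unfolding overlap_const_def using kl
      by (intro member_le_sum[where f = "\<lambda>k. \<Sum>l<n. \<Sum>i<n. \<Sum>j<n. \<bar>u i k * sqrt (\<beta> i * \<beta> j) * u j l\<bar>"])
        (auto intro!: sum_nonneg)
    finally show "(\<Sum>i<n. \<Sum>j<n. \<bar>u i k * sqrt (\<beta> i * \<beta> j) * u j l\<bar>) \<le> overlap_const" .
  qed (use \<epsilon> in auto)
  finally show ?thesis by (simp add: mult_ac)
qed

definition q :: "nat \<Rightarrow> real" where "q k = max (r k - 1) 0"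

lemma q_nonneg: "0 \<le> q k" by (simp add: q_def)

lemma r_minus_q: "r k - q k = min (r k) 1" by (simp add: q_def)

text \<open>The coefficients with \<open>p < N\<close> represent the Hamiltonian, those with \<open>N \<le> p < N + n\<close> the linear
  field \<open>\<Sum>k. sqrt (q k) * (g k \<bullet> rot \<sigma> k)\<close> with which it is compared.\<close>

definition coef :: "nat \<Rightarrow> nat \<times> nat \<Rightarrow> (nat \<Rightarrow> nat \<Rightarrow> real) \<Rightarrow> real" where
  "coef N = (\<lambda>(p, i) \<sigma>. if p < N then (\<Sum>k<n. rot \<sigma> k p * rot \<sigma> k i) / (sqrt 2 * sqrt (real N))
    else sqrt (q (p - N)) * rot \<sigma> (p - N) i)"

lemma sum_upper:
  "(\<Sum>j\<in>{N..<N + n} \<times> {..<N}. f j) = (\<Sum>k<n. \<Sum>i<N. f (N + k, i))"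
  using sum.shift_bounds_nat_ivl[of "\<lambda>p. \<Sum>i<N. f (p, i)" 0 N n]
  by (simp add: sum.cartesian_product' add.commute atLeast0LessThan)

text \<open>The first two summands are the \<epsilon>-errors of the squared Gram entries: (r k +
  \<epsilon> c)^2 on the diagonal and at most \<epsilon> c^2 for each of the n^2 pairs, with c =
  \<open>overlap_const\<close>. The last one comes from replacing the two squared norms by N
  \<open>r k\<close> in the increments of the linear field.\<close>

definition incr_const :: real where
  "incr_const = 2 * overlap_const * (\<Sum>k<n. r k) + n\<^sup>2 * overlap_const\<^sup>2 + 2 * overlap_const * (\<Sum>k<n. q k)"

lemma sum_rot_square_le:
  assumes \<sigma>: "\<sigma> \<in> overlap_set n Q \<epsilon> N" and N: "0 < N" and \<epsilon>: "0 \<le> \<epsilon>" "\<epsilon> \<le> 1"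
  shows "(\<Sum>k<n. \<Sum>l<n. (\<Sum>i<N. rot \<sigma> k i * rot \<sigma> l i)\<^sup>2)
    \<le> (real N)\<^sup>2 * ((\<Sum>k<n. (r k)\<^sup>2) + \<epsilon> * (2 * overlap_const * (\<Sum>k<n. r k) + n\<^sup>2 * overlap_const\<^sup>2))"
proof -
  define c where "c = overlap_const"
  have c: "0 \<le> c" by (simp add: c_def overlap_const_nonneg)
  have "(\<Sum>k<n. \<Sum>l<n. (\<Sum>i<N. rot \<sigma> k i * rot \<sigma> l i)\<^sup>2)
      \<le> (\<Sum>k<n. \<Sum>l<n. (real N)\<^sup>2 * ((if k = l then (r k)\<^sup>2 + \<epsilon> * (2 * c * r k) else 0) + \<epsilon> * c\<^sup>2))"
  proof (intro sum_mono)
    fix k l assume "k \<in> {..<n}" "l \<in> {..<n}"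
    then have kl: "k < n" "l < n" by auto
    have "\<bar>\<Sum>i<N. rot \<sigma> k i * rot \<sigma> l i\<bar> \<le> N * ((if k = l then r k else 0) + \<epsilon> * c)"
    proof -
      have "0 \<le> N * (if k = l then r k else 0)"
        using r_nonneg[OF kl(1)] by (auto intro!: mult_nonneg_nonneg)
      then show ?thesis
        using rot_inner[OF \<sigma> N kl] unfolding c_def[symmetric] distrib_left by linarith
    qed
    then have "(\<Sum>i<N. rot \<sigma> k i * rot \<sigma> l i)\<^sup>2 \<le> (N * ((if k = l then r k else 0) + \<epsilon> * c))\<^sup>2"
      by (rule abs_le_square_iff[THEN iffD1, OF order_trans[OF _ abs_ge_self]])
    also have "\<dots> = (real N)\<^sup>2 * ((if k = l then (r k)\<^sup>2 + \<epsilon> * (2 * c * r k) else 0) + \<epsilon>\<^sup>2 * c\<^sup>2)"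
      by (cases "k = l") (simp_all add: power2_eq_square algebra_simps)
    also have "\<dots> \<le> (real N)\<^sup>2 * ((if k = l then (r k)\<^sup>2 + \<epsilon> * (2 * c * r k) else 0) + \<epsilon> * c\<^sup>2)"
      using \<epsilon> by (intro mult_left_mono add_mono mult_right_mono order_refl)
        (auto simp: power2_eq_square mult_left_le)
    finally show "(\<Sum>i<N. rot \<sigma> k i * rot \<sigma> l i)\<^sup>2
      \<le> (real N)\<^sup>2 * ((if k = l then (r k)\<^sup>2 + \<epsilon> * (2 * c * r k) else 0) + \<epsilon> * c\<^sup>2)" .
  qed
  also have "\<dots> = (real N)\<^sup>2 * (\<Sum>k<n. \<Sum>l<n. (if k = l then (r k)\<^sup>2 + \<epsilon> * (2 * c * r k) else 0) + \<epsilon> * c\<^sup>2)"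
    by (simp only: sum_distrib_left)
  also have "(\<Sum>k<n. \<Sum>l<n. (if k = l then (r k)\<^sup>2 + \<epsilon> * (2 * c * r k) else 0) + \<epsilon> * c\<^sup>2)
      = (\<Sum>k<n. (r k)\<^sup>2) + \<epsilon> * (2 * c * (\<Sum>k<n. r k) + n\<^sup>2 * c\<^sup>2)"
    by (simp add: sum.distrib sum_distrib_left power2_eq_square algebra_simps)
  finally show ?thesis unfolding c_def .
qed

text \<open>The overlap constraint fixes the Gram entries within \<sigma> and within \<tau>, but
  says nothing about the products m k between them, so the bound has to hold for all values of m k.
  The cross terms with k \<noteq> l enter the Hamiltonian increments with a negative sign and are
  dropped. What is left for each k is a concave quadratic in m k, maximal at N
  \<open>q k\<close>.\<close>

lemma coef_increments:
  assumes \<sigma>: "\<sigma> \<in> overlap_set n Q \<epsilon> N" and \<tau>: "\<tau> \<in> overlap_set n Q \<epsilon> N"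
    and N: "0 < N" and \<epsilon>: "0 \<le> \<epsilon>" "\<epsilon> \<le> 1"
  shows "(\<Sum>j\<in>{..<N} \<times> {..<N}. (coef N j \<sigma> - coef N j \<tau>)\<^sup>2)
    \<le> (\<Sum>j\<in>{N..<N + n} \<times> {..<N}. (coef N j \<sigma> - coef N j \<tau>)\<^sup>2)
      + N * ((\<Sum>k<n. (min (r k) 1)\<^sup>2) + \<epsilon> * incr_const)"
proof -
  define c where "c = overlap_const"
  define g where "g \<sigma> \<tau> k l = (\<Sum>i<N. rot \<sigma> k i * rot \<tau> l i)" for \<sigma> \<tau> k l
  define m where "m k = g \<sigma> \<tau> k k" for k
  define Y where "Y = (\<Sum>k<n. (r k)\<^sup>2) + \<epsilon> * (2 * c * (\<Sum>k<n. r k) + n\<^sup>2 * c\<^sup>2)"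
  have D0: "(\<Sum>i<N. \<Sum>l<N. (\<Sum>k<n. rot \<sigma> k i * rot \<sigma> k l) * (\<Sum>k<n. rot \<tau> k i * rot \<tau> k l))
      = (\<Sum>k<n. \<Sum>l<n. (g \<sigma> \<tau> k l)\<^sup>2)" for \<sigma> \<tau>
    unfolding g_def by (rule sum_square_bilinear)
  have "(\<Sum>j\<in>{..<N} \<times> {..<N}. (coef N j \<sigma> - coef N j \<tau>)\<^sup>2)
      = (\<Sum>i<N. \<Sum>l<N. ((\<Sum>k<n. rot \<sigma> k i * rot \<sigma> k l) - (\<Sum>k<n. rot \<tau> k i * rot \<tau> k l))\<^sup>2 / (2 * N))"
    by (simp add: sum.cartesian_product' coef_def diff_divide_distrib[symmetric] power_divide power_mult_distrib)
  also have "\<dots> = (\<Sum>i<N. \<Sum>l<N. ((\<Sum>k<n. rot \<sigma> k i * rot \<sigma> k l) * (\<Sum>k<n. rot \<sigma> k i * rot \<sigma> k l)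
      + (\<Sum>k<n. rot \<tau> k i * rot \<tau> k l) * (\<Sum>k<n. rot \<tau> k i * rot \<tau> k l)
      - 2 * ((\<Sum>k<n. rot \<sigma> k i * rot \<sigma> k l) * (\<Sum>k<n. rot \<tau> k i * rot \<tau> k l)))) / (2 * N)"
    by (simp add: sum_divide_distrib power2_eq_square algebra_simps)
  also have "\<dots> = ((\<Sum>k<n. \<Sum>l<n. (g \<sigma> \<sigma> k l)\<^sup>2) + (\<Sum>k<n. \<Sum>l<n. (g \<tau> \<tau> k l)\<^sup>2)
      - 2 * (\<Sum>k<n. \<Sum>l<n. (g \<sigma> \<tau> k l)\<^sup>2)) / (2 * N)"
    by (simp only: sum.distrib sum_subtractf sum_distrib_left[symmetric] D0)
  also have "\<dots> \<le> ((real N)\<^sup>2 * Y + (real N)\<^sup>2 * Y - 2 * (\<Sum>k<n. (m k)\<^sup>2)) / (2 * N)"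
  proof (intro divide_right_mono diff_mono add_mono mult_left_mono)
    show "(\<Sum>k<n. \<Sum>l<n. (g \<sigma> \<sigma> k l)\<^sup>2) \<le> (real N)\<^sup>2 * Y"
      unfolding g_def Y_def c_def by (rule sum_rot_square_le[OF \<sigma> N \<epsilon>])
    show "(\<Sum>k<n. \<Sum>l<n. (g \<tau> \<tau> k l)\<^sup>2) \<le> (real N)\<^sup>2 * Y"
      unfolding g_def Y_def c_def by (rule sum_rot_square_le[OF \<tau> N \<epsilon>])
    show "(\<Sum>k<n. (m k)\<^sup>2) \<le> (\<Sum>k<n. \<Sum>l<n. (g \<sigma> \<tau> k l)\<^sup>2)"
      unfolding m_def by (intro sum_mono member_le_sum[where f = "\<lambda>l. (g \<sigma> \<tau> _ l)\<^sup>2"]) auto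
  qed auto
  also have "\<dots> = N * Y - (\<Sum>k<n. (m k)\<^sup>2 / N)"
    using N by (simp add: field_simps power2_eq_square sum_divide_distrib[symmetric])
  finally have A: "(\<Sum>j\<in>{..<N} \<times> {..<N}. (coef N j \<sigma> - coef N j \<tau>)\<^sup>2) \<le> N * Y - (\<Sum>k<n. (m k)\<^sup>2 / N)" .
  have "(\<Sum>j\<in>{N..<N + n} \<times> {..<N}. (coef N j \<sigma> - coef N j \<tau>)\<^sup>2)
      = (\<Sum>k<n. \<Sum>i<N. q k * (rot \<sigma> k i - rot \<tau> k i)\<^sup>2)"
    unfolding sum_upper using q_nonneg
    by (simp add: coef_def right_diff_distrib[symmetric] power_mult_distrib)
  also have "\<dots> = (\<Sum>k<n. q k * (g \<sigma> \<sigma> k k + g \<tau> \<tau> k k - 2 * m k))"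
    unfolding g_def m_def
    by (simp add: sum_distrib_left[symmetric] power2_eq_square algebra_simps sum.distrib sum_subtractf)
  also have "\<dots> \<ge> (\<Sum>k<n. q k * ((N * r k - N * (\<epsilon> * c)) + (N * r k - N * (\<epsilon> * c)) - 2 * m k))"
  proof (intro sum_mono mult_left_mono diff_mono add_mono)
    fix k assume "k \<in> {..<n}"
    then have k: "k < n" by simp
    show "N * r k - N * (\<epsilon> * c) \<le> g \<sigma> \<sigma> k k" "N * r k - N * (\<epsilon> * c) \<le> g \<tau> \<tau> k k"
      using rot_inner[OF \<sigma> N k k] rot_inner[OF \<tau> N k k] unfolding g_def c_def by (simp_all add: abs_le_iff)
  qed (auto simp: q_nonneg)
  finally have B: "(\<Sum>k<n. q k * ((N * r k - N * (\<epsilon> * c)) + (N * r k - N * (\<epsilon> * c)) - 2 * m k))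
      \<le> (\<Sum>j\<in>{N..<N + n} \<times> {..<N}. (coef N j \<sigma> - coef N j \<tau>)\<^sup>2)" .
  have "N * Y - (\<Sum>k<n. (m k)\<^sup>2 / N) - (\<Sum>k<n. q k * ((N * r k - N * (\<epsilon> * c)) + (N * r k - N * (\<epsilon> * c)) - 2 * m k))
      = (\<Sum>k<n. N * (r k)\<^sup>2 - (m k)\<^sup>2 / N - q k * (2 * N * r k - 2 * m k)) + N * (\<epsilon> * incr_const)"
    unfolding Y_def incr_const_def c_def
    by (simp add: sum.distrib sum_subtractf sum_distrib_left algebra_simps)
  also have "(\<Sum>k<n. N * (r k)\<^sup>2 - (m k)\<^sup>2 / N - q k * (2 * N * r k - 2 * m k)) \<le> (\<Sum>k<n. N * (r k - q k)\<^sup>2)"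
  proof (intro sum_mono)
    fix k
    \<comment> \<open>Completing the square in \<open>m k\<close>; the defect is exactly the square
      that vanishes at m k = N q k.\<close>
    have "N * (r k - q k)\<^sup>2 - (N * (r k)\<^sup>2 - (m k)\<^sup>2 / N - q k * (2 * N * r k - 2 * m k)) = (N * q k - m k)\<^sup>2 / N"
      using N by (simp add: field_simps power2_eq_square)
    moreover have "(N * q k - m k)\<^sup>2 / N \<ge> 0" by simp
    ultimately show "N * (r k)\<^sup>2 - (m k)\<^sup>2 / N - q k * (2 * N * r k - 2 * m k) \<le> N * (r k - q k)\<^sup>2" by linarith
  qed
  finally have "N * Y - (\<Sum>k<n. (m k)\<^sup>2 / N) - (\<Sum>k<n. q k * ((N * r k - N * (\<epsilon> * c)) + (N * r k - N * (\<epsilon> * c)) - 2 * m k))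
      \<le> N * ((\<Sum>k<n. (min (r k) 1)\<^sup>2) + \<epsilon> * incr_const)"
    by (simp add: r_minus_q sum_distrib_left distrib_left)
  then show ?thesis using A B by linarith
qed

end

section \<open>The linear field on the overlap set\<close>

lemma prod_mono_ennreal:
  fixes f g :: "'i \<Rightarrow> ennreal"
  shows "(\<And>i. i \<in> A \<Longrightarrow> f i \<le> g i) \<Longrightarrow> prod f A \<le> prod g A"
  by (induction A rule: infinite_finite_induct) (auto intro: mult_mono)

abbreviation spheres :: "nat \<Rightarrow> nat \<Rightarrow> (nat \<Rightarrow> nat \<Rightarrow> real) measure" where
  "spheres n N \<equiv> \<Pi>\<^sub>M j\<in>{..<n}. sphere_measure N"

lemma prob_space_spheres: "prob_space (spheres n N)"
  by (intro prob_space_PiM prob_space_sphere_measure)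

lemma spheres_component_measurable:
  assumes "j < n" "i < N"
  shows "(\<lambda>\<sigma>. \<sigma> j i) \<in> borel_measurable (spheres n N)"
proof -
  have 1: "(\<lambda>\<sigma>. \<sigma> j) \<in> spheres n N \<rightarrow>\<^sub>M sphere_measure N"
    using assms by (intro measurable_component_singleton) auto
  have 2: "(\<lambda>\<sigma>. \<sigma> i) \<in> borel_measurable (sphere_measure N)"
    using assms by (simp cong: measurable_cong_sets)
  show ?thesis using measurable_compose[OF 1 2] .
qed

lemma overlap_set_measurable: "overlap_set n Q \<epsilon> N \<in> sets (spheres n N)"
proof -
  note c[measurable] = spheres_component_measurable
  have L: "(\<lambda>\<sigma>. L2_set (\<sigma> j) {..<N}) \<in> borel_measurable (spheres n N)" if "j < n" for j
    unfolding L2_set_def using that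
    by (intro measurable_compose[OF _ borel_measurable_sqrt] borel_measurable_sum borel_measurable_power c) auto
  have O: "(\<lambda>\<sigma>. overlap N (\<sigma> j) (\<sigma> k)) \<in> borel_measurable (spheres n N)" if "j < n" "k < n" for j k
    unfolding overlap_def using that
    by (intro borel_measurable_divide borel_measurable_sum borel_measurable_times c) auto
  have "overlap_set n Q \<epsilon> N = {\<sigma> \<in> space (spheres n N). (\<forall>j\<in>{..<n}. L2_set (\<sigma> j) {..<N} = sqrt N) \<and>
      (\<forall>j\<in>{..<n}. \<forall>k\<in>{..<n}. overlap N (\<sigma> j) (\<sigma> k) \<in> {Q $$ (j, k) - \<epsilon> .. Q $$ (j, k) + \<epsilon>})}"
    unfolding overlap_set_def sphere_set_def space_PiM by (auto simp: PiE_iff)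
  also have "\<dots> \<in> sets (spheres n N)"
  proof (intro predE pred_intros_logic pred_intros_finite finite_lessThan)
    fix j k assume "j \<in> {..<n}" "k \<in> {..<n}"
    then have [measurable]: "(\<lambda>\<sigma>. overlap N (\<sigma> j) (\<sigma> k)) \<in> borel_measurable (spheres n N)"
      by (intro O) auto
    show "Measurable.pred (spheres n N) (\<lambda>\<sigma>. overlap N (\<sigma> j) (\<sigma> k) \<in> {Q $$ (j, k) - \<epsilon> .. Q $$ (j, k) + \<epsilon>})"
      by measurable
  next
    fix j assume "j \<in> {..<n}"
    then have [measurable]: "(\<lambda>\<sigma>. L2_set (\<sigma> j) {..<N}) \<in> borel_measurable (spheres n N)"
      by (intro L) auto
    show "Measurable.pred (spheres n N) (\<lambda>\<sigma>. L2_set (\<sigma> j) {..<N} = sqrt N)"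
      by measurable
  qed
  finally show ?thesis .
qed

context eigen_overlap
begin

lemma rot_measurable:
  assumes "i < N"
  shows "(\<lambda>\<sigma>. rot \<sigma> k i) \<in> borel_measurable (spheres n N)"
  unfolding rot_def using assms
  by (intro borel_measurable_sum borel_measurable_times spheres_component_measurable borel_measurable_const) auto

lemma coef_measurable:
  assumes "j \<in> {..<N + n} \<times> {..<N}"
  shows "coef N j \<in> borel_measurable (spheres n N)"
proof -
  obtain p i where "j = (p, i)" "p < N + n" "i < N" using assms by auto
  then show ?thesis
    by (cases "p < N") (auto simp: coef_def[abs_def] intro!: borel_measurable_divide borel_measurable_sum
        borel_measurable_times rot_measurable borel_measurable_const)
qed

lemma overlap_set_sphere:
  assumes "\<sigma> \<in> overlap_set n Q \<epsilon> N" "j < n"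
  shows "(\<Sum>i<N. (\<sigma> j i)\<^sup>2) = N" and "i < N \<Longrightarrow> \<bar>\<sigma> j i\<bar> \<le> sqrt N"
proof -
  have "sqrt (\<Sum>i<N. (\<sigma> j i)\<^sup>2) = sqrt N"
    using assms by (auto simp: overlap_set_def sphere_set_def L2_set_def PiE_iff)
  then show *: "(\<Sum>i<N. (\<sigma> j i)\<^sup>2) = N" by simp
  assume "i < N"
  then have "(\<sigma> j i)\<^sup>2 \<le> (\<Sum>i<N. (\<sigma> j i)\<^sup>2)"
    by (intro member_le_sum[where f = "\<lambda>i. (\<sigma> j i)\<^sup>2"]) auto
  then show "\<bar>\<sigma> j i\<bar> \<le> sqrt N" unfolding * by (rule real_le_rsqrt[of "\<bar>\<sigma> j i\<bar>", simplified])
qed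

text \<open>The constant \<open>K\<close> may depend on the dimension: in the comparison the number
  of exchange steps tends to infinity while the dimension is fixed, so \<open>K\<close> disappears
  from the result.\<close>

lemma coef_bounded:
  "\<exists>K\<ge>0. \<forall>\<sigma>\<in>overlap_set n Q \<epsilon> N. \<forall>j\<in>{..<N + n} \<times> {..<N}. \<bar>coef N j \<sigma>\<bar> \<le> K"
proof -
  define b where "b = (\<Sum>k<n. \<Sum>j<n. \<bar>u j k\<bar> * (sqrt (\<beta> j) * sqrt N))"
  define s where "s = (\<Sum>k<n. sqrt (q k))"
  define K where "K = (\<Sum>k<n. b * b) / (sqrt 2 * sqrt (real N)) + s * b"
  have sb: "0 \<le> sqrt (\<beta> j)" if "j < n" for j using \<beta>_pos[OF that] by simp
  have b0: "0 \<le> b" unfolding b_def using sb by (intro sum_nonneg mult_nonneg_nonneg) auto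
  have s0: "0 \<le> s" unfolding s_def using q_nonneg by (intro sum_nonneg) auto
  have rot: "\<bar>rot \<sigma> k i\<bar> \<le> b" if \<sigma>: "\<sigma> \<in> overlap_set n Q \<epsilon> N" and "k < n" "i < N" for \<sigma> k i
  proof -
    have "\<bar>rot \<sigma> k i\<bar> \<le> (\<Sum>j<n. \<bar>u j k\<bar> * (sqrt (\<beta> j) * \<bar>\<sigma> j i\<bar>))"
      unfolding rot_def using sb by (intro order_trans[OF sum_abs] sum_mono) (auto simp: abs_mult)
    also have "\<dots> \<le> (\<Sum>j<n. \<bar>u j k\<bar> * (sqrt (\<beta> j) * sqrt N))"
      using overlap_set_sphere(2)[OF \<sigma> _ \<open>i < N\<close>] sb by (intro sum_mono mult_left_mono) auto
    also have "\<dots> \<le> b"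
      unfolding b_def using \<open>k < n\<close> sb
      by (intro member_le_sum[where f = "\<lambda>k. \<Sum>j<n. \<bar>u j k\<bar> * (sqrt (\<beta> j) * sqrt N)"])
        (auto intro!: sum_nonneg mult_nonneg_nonneg)
    finally show ?thesis .
  qed
  have "\<bar>coef N j \<sigma>\<bar> \<le> K" if \<sigma>: "\<sigma> \<in> overlap_set n Q \<epsilon> N" and j: "j \<in> {..<N + n} \<times> {..<N}" for \<sigma> j
  proof -
    obtain p i where j: "j = (p, i)" "p < N + n" "i < N" using j by auto
    show ?thesis
    proof (cases "p < N")
      case True
      have "\<bar>\<Sum>k<n. rot \<sigma> k p * rot \<sigma> k i\<bar> \<le> (\<Sum>k<n. b * b)"
        using rot[OF \<sigma>] True j b0 by (intro order_trans[OF sum_abs] sum_mono) (auto simp: abs_mult intro!: mult_mono)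
      then have "\<bar>\<Sum>k<n. rot \<sigma> k p * rot \<sigma> k i\<bar> / (sqrt 2 * sqrt (real N)) \<le> (\<Sum>k<n. b * b) / (sqrt 2 * sqrt (real N))"
        by (intro divide_right_mono) auto
      then show ?thesis
        using True s0 b0 by (simp add: j coef_def K_def abs_mult) (smt (verit) mult_nonneg_nonneg)
    next
      case False
      have k: "p - N < n" using j False by auto
      have "sqrt (q (p - N)) \<le> s"
        unfolding s_def using k q_nonneg by (intro member_le_sum[where f = "\<lambda>k. sqrt (q k)"]) auto
      then have "sqrt (q (p - N)) * \<bar>rot \<sigma> (p - N) i\<bar> \<le> s * b"
        using rot[OF \<sigma> k j(3)] s0 by (intro mult_mono) auto
      moreover have "0 \<le> (\<Sum>k<n. b * b) / (sqrt 2 * sqrt (real N))"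
        using b0 by (intro divide_nonneg_nonneg sum_nonneg mult_nonneg_nonneg) auto
      ultimately have "sqrt (q (p - N)) * \<bar>rot \<sigma> (p - N) i\<bar> \<le> K"
        unfolding K_def by linarith
      then show ?thesis
        using False q_nonneg by (simp add: j coef_def abs_mult)
    qed
  qed
  moreover have "0 \<le> K"
    unfolding K_def using b0 s0 by (intro add_nonneg_nonneg divide_nonneg_nonneg sum_nonneg mult_nonneg_nonneg) auto
  ultimately show ?thesis by blast
qed

text \<open>The terms without \<epsilon> are the limiting rate. The others vanish as \<epsilon>
  tends to 0: they stem from the overlap tolerance, from the thickness of the shell in
  \<open>sphere_exp_moment_le\<close>, which is also taken to be \<epsilon>, and from the volume
  estimate there.\<close>

definition field_rate :: "(nat \<Rightarrow> real) \<Rightarrow> real \<Rightarrow> real" where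
  "field_rate \<theta> \<epsilon> = (\<Sum>k<n. \<theta> k * r k) / 2 - (\<Sum>k<n. ln (\<theta> k)) / 2 - n / 2 - (\<Sum>j<n. ln (\<beta> j)) / 2
    + \<epsilon> * overlap_const * (\<Sum>k<n. \<theta> k) / 2
    + (\<Sum>k<n. \<theta> k) * ((1 + \<epsilon>)\<^sup>2 - 1) * (\<Sum>j<n. \<beta> j) / 2 - n / 2 * ln (1 - \<epsilon>)"

text \<open>On the overlap set each \<open>\<parallel>rot \<sigma> k\<parallel>\<^sup>2\<close> is close to \<open>N * r k\<close>, so its indicator is at most
  \<open>exp (\<Sum>k. \<theta> k * (N * r k - \<parallel>rot \<sigma> k\<parallel>\<^sup>2) / 2)\<close> up to a small error. As \<open>\<Sum>k. \<parallel>rot \<sigma> k\<parallel>\<^sup>2\<close> is constant, the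
  quadratic form \<open>- \<theta> k\<close> may be replaced by \<open>T - \<theta> k \<ge> 0\<close> and then linearised by an auxiliary Gaussian
  average (Hubbard-Stratonovich), which leaves exponential moments of linear functionals.\<close>

lemma field_integral_le:
  assumes N: "0 < N" and n: "0 < n" and \<epsilon>: "0 < \<epsilon>" "\<epsilon> < 1" and \<theta>: "\<And>k. k < n \<Longrightarrow> 0 < \<theta> k"
  shows "(\<integral>\<^sup>+ \<sigma>. indicator (overlap_set n Q \<epsilon> N) \<sigma> *
      ennreal (exp (\<Sum>j\<in>{N..<N + n} \<times> {..<N}. z j * coef N j \<sigma>)) \<partial>spheres n N)
    \<le> ennreal (exp (N * field_rate \<theta> \<epsilon> + n * ln (2 / \<epsilon>\<^sup>2)
        + (\<Sum>k<n. \<Sum>i<N. q k * (z (N + k, i))\<^sup>2 / (2 * \<theta> k))))"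
proof -
  define A where "A = overlap_set n Q \<epsilon> N"
  define I where "I = {..<n} \<times> {..<N}"
  \<comment> \<open>\<open>T\<close> only has to dominate every \<open>\<theta> k\<close>. It
    cancels from the final exponent except in terms that vanish with \<epsilon>.\<close>
  define T where "T = (\<Sum>k<n. \<theta> k)"
  have fI: "finite I" by (simp add: I_def)
  have T: "0 < T" unfolding T_def using \<theta> n by (intro sum_pos) auto
  have \<theta>T: "\<theta> k \<le> T" if "k < n" for k
    unfolding T_def using \<theta> that by (intro member_le_sum) (auto intro: less_imp_le)
  define \<tau> where "\<tau> = (\<lambda>(k::nat, i::nat). sqrt (T - \<theta> k))"
  define b where "b = (\<lambda>(k, i). sqrt (q k) * z (N + k, i))"
  define \<Theta> where "\<Theta> = (\<lambda>(k::nat, i::nat). \<theta> k)"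
  define R where "R = (\<lambda>\<sigma> (k, i). rot \<sigma> k i)"
  have \<tau>2: "(\<tau> x)\<^sup>2 = T - \<Theta> x" and \<Theta>: "0 < \<Theta> x" "\<Theta> x \<le> T" if "x \<in> I" for x
    using \<theta>T \<theta> that by (auto simp: \<tau>_def \<Theta>_def I_def)
  define y where "y \<zeta> x = b x + \<tau> x * \<zeta> x" for \<zeta> x
  \<comment> \<open>The tilt at the largest norms that the overlap set permits, minus the constant
    by which raising every -\<theta> k to T - \<theta> k increases half the quadratic form on the
    spheres.\<close>
  define E0 where "E0 = (\<Sum>k<n. \<theta> k * (N * r k + N * (\<epsilon> * overlap_const))) / 2 - T * (N * (\<Sum>j<n. \<beta> j)) / 2"
  define F where "F \<sigma> \<zeta> = exp (\<Sum>x\<in>I. y \<zeta> x * R \<sigma> x)" for \<sigma> \<zeta>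
  interpret S: prob_space "spheres n N" by (rule prob_space_spheres)
  interpret \<gamma>: prob_space "gauss_PiM I" by (rule prob_space_gauss_PiM)
  interpret S\<gamma>: pair_sigma_finite "spheres n N" "gauss_PiM I" ..
  interpret sph: prob_space "sphere_measure N" by (rule prob_space_sphere_measure)
  interpret sphp: product_sigma_finite "\<lambda>_::nat. sphere_measure N" ..
  have Rm[measurable]: "x \<in> I \<Longrightarrow> (\<lambda>\<sigma>. R \<sigma> x) \<in> borel_measurable (spheres n N)" for x
    by (auto simp: R_def I_def intro: rot_measurable)
  have ym[measurable]: "x \<in> I \<Longrightarrow> (\<lambda>\<zeta>. y \<zeta> x) \<in> borel_measurable (gauss_PiM I)" for x
    unfolding y_def by measurable
  have up: "(\<Sum>j\<in>{N..<N + n} \<times> {..<N}. z j * coef N j \<sigma>) = (\<Sum>x\<in>I. b x * R \<sigma> x)" for \<sigma>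
    unfolding sum_upper I_def by (simp add: sum.cartesian_product' coef_def b_def R_def mult_ac)
  have F_int: "(\<integral>\<^sup>+ \<zeta>. ennreal (F \<sigma> \<zeta>) \<partial>gauss_PiM I) = ennreal (exp ((\<Sum>x\<in>I. b x * R \<sigma> x) + (\<Sum>x\<in>I. (T - \<Theta> x) * (R \<sigma> x)\<^sup>2) / 2))" for \<sigma>
  proof -
    have "(\<integral>\<^sup>+ \<zeta>. ennreal (F \<sigma> \<zeta>) \<partial>gauss_PiM I)
        = (\<integral>\<^sup>+ \<zeta>. ennreal (exp (\<Sum>x\<in>I. b x * R \<sigma> x)) * ennreal (exp (\<Sum>x\<in>I. (\<tau> x * R \<sigma> x) * \<zeta> x)) \<partial>gauss_PiM I)"
      unfolding F_def y_def
      by (simp only: distrib_right sum.distrib exp_add ennreal_mult exp_ge_zero mult.assoc)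
        (simp only: mult.left_commute mult.commute)
    also have "\<dots> = ennreal (exp (\<Sum>x\<in>I. b x * R \<sigma> x)) * ennreal (exp ((\<Sum>x\<in>I. (\<tau> x * R \<sigma> x)\<^sup>2) / 2))"
      by (subst nn_integral_cmult) (auto simp: nn_integral_exp_gauss_PiM[OF fI])
    also have "(\<Sum>x\<in>I. (\<tau> x * R \<sigma> x)\<^sup>2) = (\<Sum>x\<in>I. (T - \<Theta> x) * (R \<sigma> x)\<^sup>2)"
      by (intro sum.cong refl) (simp add: power_mult_distrib \<tau>2)
    finally show ?thesis by (simp add: ennreal_mult[symmetric] exp_add)
  qed
  have pw: "indicator A \<sigma> * ennreal (exp (\<Sum>j\<in>{N..<N + n} \<times> {..<N}. z j * coef N j \<sigma>))
      \<le> ennreal (exp E0) * (\<integral>\<^sup>+ \<zeta>. ennreal (F \<sigma> \<zeta>) \<partial>gauss_PiM I)" for \<sigma>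
  proof (cases "\<sigma> \<in> A")
    case True
    then have \<sigma>: "\<sigma> \<in> overlap_set n Q \<epsilon> N" by (simp add: A_def)
    define g where "g k = (\<Sum>i<N. (rot \<sigma> k i)\<^sup>2)" for k
    have "(\<Sum>k<n. g k) = (\<Sum>i<N. \<Sum>k<n. rot \<sigma> k i * rot \<sigma> k i)"
      unfolding g_def power2_eq_square by (rule sum.swap)
    also have "\<dots> = (\<Sum>j<n. \<Sum>i<N. \<beta> j * (\<sigma> j i * \<sigma> j i))"
      unfolding sum_rot by (rule sum.swap)
    also have "\<dots> = N * (\<Sum>j<n. \<beta> j)"
      using overlap_set_sphere(1)[OF \<sigma>] by (simp add: sum_distrib_left[symmetric] power2_eq_square[symmetric] mult.commute sum_distrib_right[symmetric])
    finally have gs: "(\<Sum>k<n. g k) = N * (\<Sum>j<n. \<beta> j)" .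
    have "(\<Sum>k<n. \<theta> k * g k) \<le> (\<Sum>k<n. \<theta> k * (N * r k + N * (\<epsilon> * overlap_const)))"
    proof (intro sum_mono mult_left_mono)
      fix k assume "k \<in> {..<n}"
      then have k: "k < n" by simp
      show "g k \<le> N * r k + N * (\<epsilon> * overlap_const)"
        using rot_inner[OF \<sigma> N k k] by (simp add: g_def power2_eq_square abs_le_iff)
    qed (use \<theta> in \<open>auto intro: less_imp_le\<close>)
    moreover have "(\<Sum>x\<in>I. (T - \<Theta> x) * (R \<sigma> x)\<^sup>2) = T * (N * (\<Sum>j<n. \<beta> j)) - (\<Sum>k<n. \<theta> k * g k)"
      unfolding gs[symmetric]
      by (simp add: I_def sum.cartesian_product' \<Theta>_def R_def g_def sum_distrib_left left_diff_distrib sum_subtractf)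
    ultimately have "0 \<le> E0 + (\<Sum>x\<in>I. (T - \<Theta> x) * (R \<sigma> x)\<^sup>2) / 2"
      unfolding E0_def by linarith
    then show ?thesis
      unfolding F_int up using True by (simp add: ennreal_mult[symmetric] exp_add[symmetric])
  qed simp
  \<comment> \<open>After linearisation the exponent is linear in the configurations. Regrouped by
    the original replicas instead of the rotated ones, it factorises over the product of
    spheres.\<close>
  define w where "w \<zeta> j i = sqrt (\<beta> j) * (\<Sum>k<n. u j k * y \<zeta> (k, i))" for \<zeta> j i
  have F_w: "F \<sigma> \<zeta> = (\<Prod>j<n. exp (\<Sum>i<N. w \<zeta> j i * \<sigma> j i))" for \<sigma> \<zeta>
  proof -
    have "(\<Sum>x\<in>I. y \<zeta> x * R \<sigma> x) = (\<Sum>k<n. \<Sum>i<N. \<Sum>j<n. y \<zeta> (k, i) * (u j k * (sqrt (\<beta> j) * \<sigma> j i)))"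
      by (simp add: I_def sum.cartesian_product' R_def rot_def sum_distrib_left)
    also have "\<dots> = (\<Sum>k<n. \<Sum>j<n. \<Sum>i<N. y \<zeta> (k, i) * (u j k * (sqrt (\<beta> j) * \<sigma> j i)))"
      by (intro sum.cong refl sum.swap)
    also have "\<dots> = (\<Sum>j<n. \<Sum>k<n. \<Sum>i<N. y \<zeta> (k, i) * (u j k * (sqrt (\<beta> j) * \<sigma> j i)))"
      by (rule sum.swap)
    also have "\<dots> = (\<Sum>j<n. \<Sum>i<N. \<Sum>k<n. y \<zeta> (k, i) * (u j k * (sqrt (\<beta> j) * \<sigma> j i)))"
      by (intro sum.cong refl sum.swap)
    also have "\<dots> = (\<Sum>j<n. \<Sum>i<N. w \<zeta> j i * \<sigma> j i)"
      by (simp add: w_def sum_distrib_left sum_distrib_right mult_ac)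
    finally show ?thesis by (simp add: F_def exp_sum)
  qed
  \<comment> \<open>The sphere bound is used with parameter \<open>T * \<beta> j\<close> for replica
    j. This choice cancels the weight \<beta> j in the squared coefficients, so orthogonality of
    \<open>u\<close> returns the rotated sum with one common denominator 2 T, as the Gaussian
    integral requires.\<close>
  have w2: "(\<Sum>j<n. (\<Sum>i<N. (w \<zeta> j i)\<^sup>2) / (2 * (T * \<beta> j))) = (\<Sum>x\<in>I. (y \<zeta> x)\<^sup>2) / (2 * T)" for \<zeta>
  proof -
    have "(\<Sum>j<n. (\<Sum>i<N. (w \<zeta> j i)\<^sup>2) / (2 * (T * \<beta> j)))
        = (\<Sum>j<n. \<Sum>i<N. ((\<Sum>k<n. u j k * y \<zeta> (k, i)) * (\<Sum>k<n. u j k * y \<zeta> (k, i))) / (2 * T))"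
    proof (intro sum.cong refl)
      fix j assume "j \<in> {..<n}"
      then have \<beta>: "0 < \<beta> j" using \<beta>_pos by simp
      have "(w \<zeta> j i)\<^sup>2 / (2 * (T * \<beta> j)) = (\<Sum>k<n. u j k * y \<zeta> (k, i)) * (\<Sum>k<n. u j k * y \<zeta> (k, i)) / (2 * T)" for i
        unfolding w_def power_mult_distrib using \<beta> T by (simp add: power2_eq_square)
      then show "(\<Sum>i<N. (w \<zeta> j i)\<^sup>2) / (2 * (T * \<beta> j))
          = (\<Sum>i<N. ((\<Sum>k<n. u j k * y \<zeta> (k, i)) * (\<Sum>k<n. u j k * y \<zeta> (k, i))) / (2 * T))"
        by (simp add: sum_divide_distrib)
    qed
    also have "\<dots> = (\<Sum>i<N. \<Sum>j<n. ((\<Sum>k<n. u j k * y \<zeta> (k, i)) * (\<Sum>k<n. u j k * y \<zeta> (k, i))) / (2 * T))"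
      by (rule sum.swap)
    also have "\<dots> = (\<Sum>i<N. (\<Sum>k<n. y \<zeta> (k, i) * y \<zeta> (k, i)) / (2 * T))"
      by (simp only: sum_divide_distrib[symmetric] sum_rotate(2))
    also have "\<dots> = (\<Sum>x\<in>I. (y \<zeta> x)\<^sup>2) / (2 * T)"
      unfolding I_def sum.cartesian_product' sum_divide_distrib power2_eq_square by (rule sum.swap)
    finally show ?thesis .
  qed
  define E1 where "E1 = (\<Sum>j<n. N / 2 * (T * \<beta> j * (1 + \<epsilon>)\<^sup>2 - 1 - ln (T * \<beta> j) - ln (1 - \<epsilon>)) + ln (2 / \<epsilon>\<^sup>2))"
  have FS: "(\<integral>\<^sup>+ \<sigma>. ennreal (F \<sigma> \<zeta>) \<partial>spheres n N) \<le> ennreal (exp E1) * ennreal (exp ((\<Sum>x\<in>I. (y \<zeta> x)\<^sup>2) / (2 * T)))" for \<zeta>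
  proof -
    have "(\<integral>\<^sup>+ \<sigma>. ennreal (F \<sigma> \<zeta>) \<partial>spheres n N) = (\<integral>\<^sup>+ \<sigma>. (\<Prod>j<n. ennreal (exp (\<Sum>i<N. w \<zeta> j i * \<sigma> j i))) \<partial>spheres n N)"
      unfolding F_w by (simp add: prod_ennreal)
    also have "\<dots> = (\<Prod>j<n. \<integral>\<^sup>+ \<sigma>. ennreal (exp (\<Sum>i<N. w \<zeta> j i * \<sigma> i)) \<partial>sphere_measure N)"
      by (rule sphp.product_nn_integral_prod[of "{..<n}" "\<lambda>j \<sigma>. ennreal (exp (\<Sum>i<N. w \<zeta> j i * \<sigma> i))"]) auto
    also have "\<dots> \<le> (\<Prod>j<n. ennreal (exp (N / 2 * (T * \<beta> j * (1 + \<epsilon>)\<^sup>2 - 1 - ln (T * \<beta> j) - ln (1 - \<epsilon>))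
        + (\<Sum>i<N. (w \<zeta> j i)\<^sup>2) / (2 * (T * \<beta> j)) + ln (2 / \<epsilon>\<^sup>2))))"
      using N T \<beta>_pos \<epsilon> by (intro prod_mono_ennreal sphere_exp_moment_le) auto
    also have "\<dots> = ennreal (\<Prod>j<n. exp (N / 2 * (T * \<beta> j * (1 + \<epsilon>)\<^sup>2 - 1 - ln (T * \<beta> j) - ln (1 - \<epsilon>))
        + (\<Sum>i<N. (w \<zeta> j i)\<^sup>2) / (2 * (T * \<beta> j)) + ln (2 / \<epsilon>\<^sup>2)))"
      by (rule prod_ennreal) simp
    also have "\<dots> = ennreal (exp (\<Sum>j<n. N / 2 * (T * \<beta> j * (1 + \<epsilon>)\<^sup>2 - 1 - ln (T * \<beta> j) - ln (1 - \<epsilon>))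
        + (\<Sum>i<N. (w \<zeta> j i)\<^sup>2) / (2 * (T * \<beta> j)) + ln (2 / \<epsilon>\<^sup>2)))"
      by (subst exp_sum) auto
    also have "(\<Sum>j<n. N / 2 * (T * \<beta> j * (1 + \<epsilon>)\<^sup>2 - 1 - ln (T * \<beta> j) - ln (1 - \<epsilon>))
        + (\<Sum>i<N. (w \<zeta> j i)\<^sup>2) / (2 * (T * \<beta> j)) + ln (2 / \<epsilon>\<^sup>2)) = E1 + (\<Sum>x\<in>I. (y \<zeta> x)\<^sup>2) / (2 * T)"
      unfolding w2[symmetric] E1_def by (simp only: sum.distrib)
    also have "ennreal (exp (E1 + (\<Sum>x\<in>I. (y \<zeta> x)\<^sup>2) / (2 * T))) = ennreal (exp E1) * ennreal (exp ((\<Sum>x\<in>I. (y \<zeta> x)\<^sup>2) / (2 * T)))"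
      by (simp add: exp_add ennreal_mult)
    finally show ?thesis .
  qed
  have Fm: "(\<lambda>(\<sigma>, \<zeta>). ennreal (F \<sigma> \<zeta>)) \<in> borel_measurable (spheres n N \<Otimes>\<^sub>M gauss_PiM I)"
    unfolding F_def split_beta'
    by (intro measurable_compose[OF _ measurable_ennreal] measurable_compose[OF _ borel_measurable_exp]
        borel_measurable_sum borel_measurable_times)
      (auto intro: measurable_compose[OF measurable_fst Rm] measurable_compose[OF measurable_snd ym])
  have "(\<integral>\<^sup>+ \<sigma>. indicator A \<sigma> * ennreal (exp (\<Sum>j\<in>{N..<N + n} \<times> {..<N}. z j * coef N j \<sigma>)) \<partial>spheres n N)
      \<le> (\<integral>\<^sup>+ \<sigma>. ennreal (exp E0) * (\<integral>\<^sup>+ \<zeta>. ennreal (F \<sigma> \<zeta>) \<partial>gauss_PiM I) \<partial>spheres n N)"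
    by (rule nn_integral_mono) (rule pw)
  also have "\<dots> = ennreal (exp E0) * (\<integral>\<^sup>+ \<sigma>. \<integral>\<^sup>+ \<zeta>. ennreal (F \<sigma> \<zeta>) \<partial>gauss_PiM I \<partial>spheres n N)"
    using Fm by (intro nn_integral_cmult \<gamma>.borel_measurable_nn_integral) simp
  also have "(\<integral>\<^sup>+ \<sigma>. \<integral>\<^sup>+ \<zeta>. ennreal (F \<sigma> \<zeta>) \<partial>gauss_PiM I \<partial>spheres n N)
      = (\<integral>\<^sup>+ \<zeta>. \<integral>\<^sup>+ \<sigma>. ennreal (F \<sigma> \<zeta>) \<partial>spheres n N \<partial>gauss_PiM I)"
    by (rule S\<gamma>.Fubini'[OF Fm, symmetric])
  also have "ennreal (exp E0) * (\<integral>\<^sup>+ \<zeta>. \<integral>\<^sup>+ \<sigma>. ennreal (F \<sigma> \<zeta>) \<partial>spheres n N \<partial>gauss_PiM I)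
      \<le> ennreal (exp E0) * (\<integral>\<^sup>+ \<zeta>. ennreal (exp E1) * ennreal (exp ((\<Sum>x\<in>I. (y \<zeta> x)\<^sup>2) / (2 * T))) \<partial>gauss_PiM I)"
    by (intro mult_left_mono nn_integral_mono FS) simp
  also have "(\<integral>\<^sup>+ \<zeta>. ennreal (exp E1) * ennreal (exp ((\<Sum>x\<in>I. (y \<zeta> x)\<^sup>2) / (2 * T))) \<partial>gauss_PiM I) = ennreal (exp E1) * (\<integral>\<^sup>+ \<zeta>. ennreal (exp ((\<Sum>x\<in>I. (y \<zeta> x)\<^sup>2) / (2 * T))) \<partial>gauss_PiM I)"
    by (rule nn_integral_cmult) measurable
  also have "(\<integral>\<^sup>+ \<zeta>. ennreal (exp ((\<Sum>x\<in>I. (y \<zeta> x)\<^sup>2) / (2 * T))) \<partial>gauss_PiM I)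
      = ennreal ((\<Prod>x\<in>I. sqrt (T / \<Theta> x)) * exp (\<Sum>x\<in>I. (b x)\<^sup>2 / (2 * \<Theta> x)))"
    unfolding y_def using \<tau>2 \<Theta> by (intro nn_integral_exp_square_gauss_PiM fI) auto
  also have "(\<Prod>x\<in>I. sqrt (T / \<Theta> x)) = exp (N / 2 * (\<Sum>k<n. ln T - ln (\<theta> k)))"
  proof -
    have "(\<Prod>x\<in>I. sqrt (T / \<Theta> x)) = (\<Prod>x\<in>I. exp (ln (sqrt (T / \<Theta> x))))"
      using T \<Theta> by (intro prod.cong refl) simp
    also have "\<dots> = exp (\<Sum>x\<in>I. (ln T - ln (\<Theta> x)) / 2)"
      unfolding exp_sum[OF fI, symmetric]
    proof (intro arg_cong[where f = exp] sum.cong refl)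
      fix x assume "x \<in> I"
      then have "0 < \<Theta> x" "0 < T / \<Theta> x" using T \<Theta> by auto
      then show "ln (sqrt (T / \<Theta> x)) = (ln T - ln (\<Theta> x)) / 2"
        using T by (subst ln_sqrt) (auto simp: ln_div)
    qed
    also have "(\<Sum>x\<in>I. (ln T - ln (\<Theta> x)) / 2) = N / 2 * (\<Sum>k<n. ln T - ln (\<theta> k))"
      by (simp add: I_def sum.cartesian_product' \<Theta>_def sum_distrib_left algebra_simps)
    finally show ?thesis .
  qed
  also have "(\<Sum>x\<in>I. (b x)\<^sup>2 / (2 * \<Theta> x)) = (\<Sum>k<n. \<Sum>i<N. q k * (z (N + k, i))\<^sup>2 / (2 * \<theta> k))"
    using q_nonneg by (simp add: I_def sum.cartesian_product' b_def \<Theta>_def power_mult_distrib)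
  also have "ennreal (exp E0) * (ennreal (exp E1) * ennreal (exp (N / 2 * (\<Sum>k<n. ln T - ln (\<theta> k)))
        * exp (\<Sum>k<n. \<Sum>i<N. q k * (z (N + k, i))\<^sup>2 / (2 * \<theta> k))))
      = ennreal (exp ((E0 + E1 + N / 2 * (\<Sum>k<n. ln T - ln (\<theta> k))) + (\<Sum>k<n. \<Sum>i<N. q k * (z (N + k, i))\<^sup>2 / (2 * \<theta> k))))"
    by (simp add: ennreal_mult[symmetric] exp_add[symmetric] add.assoc)
  also have "E0 + E1 + N / 2 * (\<Sum>k<n. ln T - ln (\<theta> k)) = N * field_rate \<theta> \<epsilon> + n * ln (2 / \<epsilon>\<^sup>2)"
  proof -
    have "E1 = (\<Sum>j<n. N / 2 * (T * \<beta> j * (1 + \<epsilon>)\<^sup>2 - 1 - (ln T + ln (\<beta> j)) - ln (1 - \<epsilon>)) + ln (2 / \<epsilon>\<^sup>2))"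
      unfolding E1_def
    proof (intro sum.cong refl)
      fix j assume "j \<in> {..<n}"
      then have "ln (T * \<beta> j) = ln T + ln (\<beta> j)" using T \<beta>_pos[of j] by (intro ln_mult_pos) auto
      then show "N / 2 * (T * \<beta> j * (1 + \<epsilon>)\<^sup>2 - 1 - ln (T * \<beta> j) - ln (1 - \<epsilon>)) + ln (2 / \<epsilon>\<^sup>2)
          = N / 2 * (T * \<beta> j * (1 + \<epsilon>)\<^sup>2 - 1 - (ln T + ln (\<beta> j)) - ln (1 - \<epsilon>)) + ln (2 / \<epsilon>\<^sup>2)"
        by simp
    qed
    also have "\<dots> = N / 2 * (T * (\<Sum>j<n. \<beta> j) * (1 + \<epsilon>)\<^sup>2 - n - n * ln T - (\<Sum>j<n. ln (\<beta> j)) - n * ln (1 - \<epsilon>)) + n * ln (2 / \<epsilon>\<^sup>2)"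
      by (simp add: sum.distrib sum_subtractf sum_distrib_left sum_distrib_right algebra_simps)
    finally have E1: "E1 = \<dots>" .
    have E0: "E0 = N / 2 * ((\<Sum>k<n. \<theta> k * r k) + \<epsilon> * overlap_const * T - T * (\<Sum>j<n. \<beta> j))"
    proof -
      have "(\<Sum>k<n. \<theta> k * (N * r k + N * (\<epsilon> * overlap_const))) = N * (\<Sum>k<n. \<theta> k * r k) + N * \<epsilon> * overlap_const * T"
        unfolding T_def by (simp add: sum.distrib sum_distrib_left sum_distrib_right algebra_simps)
      then show ?thesis unfolding E0_def by (simp add: field_simps)
    qed
    show ?thesis
      unfolding E0 E1 field_rate_def T_def[symmetric]
      by (simp add: sum_subtractf) (simp add: field_simps)
  qed
  finally show ?thesis unfolding A_def .
qed

end

section \<open>The upper bound\<close>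

lemma distr_iid_std_gaussian:
  assumes g: "iid_std_gaussian M g" and J: "J \<noteq> {}"
  shows "distr M (\<Pi>\<^sub>M j\<in>J. borel) (\<lambda>\<omega>. \<lambda>j\<in>J. g (fst j) (snd j) \<omega>) = gauss_PiM J"
    and "(\<lambda>\<omega>. \<lambda>j\<in>J. g (fst j) (snd j) \<omega>) \<in> M \<rightarrow>\<^sub>M (\<Pi>\<^sub>M j\<in>J. borel)"
proof -
  interpret prob_space M using g by (simp add: iid_std_gaussian_def)
  define X where "X = (\<lambda>(i, k). g i k)"
  have ind: "indep_vars (\<lambda>_. borel) X J"
    using g indep_vars_subset[of "\<lambda>_. borel" X UNIV J] by (simp add: iid_std_gaussian_def X_def)
  have dist: "distributed M lborel (X j) std_normal_density" for j
    using g by (cases j) (auto simp: iid_std_gaussian_def X_def)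
  have [measurable]: "X j \<in> borel_measurable M" for j
    using distributed_measurable[OF dist, of j] by simp
  have d: "distr M borel (X j) = std_gauss" for j
  proof -
    have "distr M borel (X j) = distr M lborel (X j)" by (rule distr_cong) auto
    also have "\<dots> = std_gauss"
      unfolding std_gauss_def by (rule distributed_distr_eq_density[OF dist])
    finally show ?thesis .
  qed
  have "distr M (\<Pi>\<^sub>M j\<in>J. borel) (\<lambda>\<omega>. \<lambda>j\<in>J. X j \<omega>) = (\<Pi>\<^sub>M j\<in>J. distr M borel (X j))"
    using ind by (subst (asm) indep_vars_iff_distr_eq_PiM'[OF J]) auto
  then show "distr M (\<Pi>\<^sub>M j\<in>J. borel) (\<lambda>\<omega>. \<lambda>j\<in>J. g (fst j) (snd j) \<omega>) = gauss_PiM J"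
    using d by (simp add: X_def split_beta')
  have "(\<lambda>\<omega>. \<lambda>j\<in>J. X j \<omega>) \<in> M \<rightarrow>\<^sub>M (\<Pi>\<^sub>M j\<in>J. borel)" by measurable
  then show "(\<lambda>\<omega>. \<lambda>j\<in>J. g (fst j) (snd j) \<omega>) \<in> M \<rightarrow>\<^sub>M (\<Pi>\<^sub>M j\<in>J. borel)"
    by (simp add: X_def split_beta')
qed

lemma eexpectation_ereal:
  assumes "integrable M X"
  shows "eexpectation M (\<lambda>\<omega>. ereal (X \<omega>)) = ereal (integral\<^sup>L M X)"
proof -
  have fin: "(\<integral>\<^sup>+ \<omega>. ennreal (X \<omega>) \<partial>M) \<noteq> \<infinity>" "(\<integral>\<^sup>+ \<omega>. ennreal (- X \<omega>) \<partial>M) \<noteq> \<infinity>"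
    using assms unfolding real_integrable_def by auto
  have "e2ennreal (ereal x) = ennreal x" for x by (simp add: ennreal.abs_eq e2ennreal_def ennreal_def)
  then have "eexpectation M (\<lambda>\<omega>. ereal (X \<omega>))
      = enn2ereal (\<integral>\<^sup>+ \<omega>. ennreal (X \<omega>) \<partial>M) - enn2ereal (\<integral>\<^sup>+ \<omega>. ennreal (- X \<omega>) \<partial>M)"
    by (simp add: eexpectation_def)
  also have "\<dots> = ereal (enn2real (\<integral>\<^sup>+ \<omega>. ennreal (X \<omega>) \<partial>M)) - ereal (enn2real (\<integral>\<^sup>+ \<omega>. ennreal (- X \<omega>) \<partial>M))"
    using fin by (cases "\<integral>\<^sup>+ \<omega>. ennreal (X \<omega>) \<partial>M"; cases "\<integral>\<^sup>+ \<omega>. ennreal (- X \<omega>) \<partial>M") (auto simp: enn2ereal_ennreal)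
  also have "\<dots> = ereal (integral\<^sup>L M X)"
    using assms by (simp add: real_lebesgue_integral_def)
  finally show ?thesis .
qed

lemma (in prob_space) eexpectation_minf: "eexpectation M (\<lambda>_. - \<infinity>) = - \<infinity>"
  by (simp add: eexpectation_def emeasure_space_1 e2ennreal_neg zero_ennreal.rep_eq)

context eigen_overlap
begin

lemma partition_function_eq:
  "partition_function n \<beta> N G (overlap_set n Q \<epsilon> N)
    = (\<integral>\<sigma>. exp (\<Sum>j\<in>{..<N} \<times> {..<N}. G (fst j) (snd j) * coef N j \<sigma>)
        \<partial>restrict_space (spheres n N) (overlap_set n Q \<epsilon> N))"
proof -
  have "(\<Sum>j<n. \<beta> j * hamiltonian N G (\<sigma> j)) = (\<Sum>j\<in>{..<N} \<times> {..<N}. G (fst j) (snd j) * coef N j \<sigma>)" for \<sigma>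
    unfolding hamiltonian_rot by (simp add: sum.cartesian_product' coef_def)
  then show ?thesis
    unfolding partition_function_def set_lebesgue_integral_def
    by (subst integral_restrict_space) (auto intro: overlap_set_measurable)
qed

text \<open>The three summands are the rate of the tilted linear field, the mean of its quadratic
  term in the disorder (where each \<open>z\<^sup>2\<close> averages to 1), and the comparison cost
  D / 4 per coordinate.\<close>

definition fe_bound :: "(nat \<Rightarrow> real) \<Rightarrow> real \<Rightarrow> real" where
  "fe_bound \<theta> \<epsilon> = field_rate \<theta> \<epsilon> + (\<Sum>k<n. q k / (2 * \<theta> k))
    + ((\<Sum>k<n. (min (r k) 1)\<^sup>2) + \<epsilon> * incr_const) / 4"

lemma free_energy_le:
  assumes g: "iid_std_gaussian M g" and N: "0 < N" and n: "0 < n" and \<epsilon>: "0 < \<epsilon>" "\<epsilon> < 1"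
    and \<theta>: "\<And>k. k < n \<Longrightarrow> 0 < \<theta> k"
  shows "free_energy M g n \<beta> N (overlap_set n Q \<epsilon> N) \<le> ereal (fe_bound \<theta> \<epsilon> + n * ln (2 / \<epsilon>\<^sup>2) / N)"
proof -
  define A where "A = overlap_set n Q \<epsilon> N"
  define \<mu> where "\<mu> = restrict_space (spheres n N) A"
  define J where "J = {..<N + n} \<times> {..<N}"
  interpret M: prob_space M using g by (simp add: iid_std_gaussian_def)
  interpret S: prob_space "spheres n N" by (rule prob_space_spheres)
  have A[measurable]: "A \<in> sets (spheres n N)" unfolding A_def by (rule overlap_set_measurable)
  have Asp: "A \<inter> space (spheres n N) = A" using sets.sets_into_space[OF A] by auto
  have sp: "space \<mu> = A" by (simp add: \<mu>_def space_restrict_space Asp)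
  have em: "emeasure \<mu> (space \<mu>) = emeasure (spheres n N) A"
    unfolding sp unfolding \<mu>_def by (rule emeasure_restrict_space) (auto simp: Asp)
  interpret \<mu>: finite_measure \<mu> by standard (simp add: em)
  have part: "partition_function n \<beta> N G A
      = (\<integral>\<sigma>. exp (\<Sum>j\<in>{..<N} \<times> {..<N}. G (fst j) (snd j) * coef N j \<sigma>) \<partial>\<mu>)" for G
    unfolding A_def \<mu>_def by (rule partition_function_eq)
  show ?thesis
  \<comment> \<open>A null overlap set makes the partition function 0 for every disorder, so the
    free energy is -\<infinity>. Otherwise the logarithm is finite everywhere and the extended
    expectation is an ordinary integral.\<close>
  proof (cases "measure \<mu> (space \<mu>) = 0")
    case True
    then have "space \<mu> \<in> null_sets \<mu>"
      by (auto intro!: null_setsI simp: \<mu>.emeasure_eq_measure)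
    then have ae: "AE x in \<mu>. P x" for P by (rule AE_I'[of _ _ P]) auto
    have "partition_function n \<beta> N G A = 0" for G
      unfolding part by (rule integral_eq_zero_AE) (rule ae)
    then have "free_energy M g n \<beta> N A = - \<infinity>"
      using N by (simp add: free_energy_def elog_def M.eexpectation_minf)
    then show ?thesis by (simp add: A_def)
  next
    case False
    obtain K where K: "0 \<le> K" "\<And>\<sigma> j. \<sigma> \<in> A \<Longrightarrow> j \<in> J \<Longrightarrow> \<bar>coef N j \<sigma>\<bar> \<le> K"
      using coef_bounded[of \<epsilon> N] unfolding A_def J_def by blast
    interpret \<mu>: gauss_field \<mu> "coef N" J K
    proof
      show "finite J" by (simp add: J_def)
      show "coef N j \<in> borel_measurable \<mu>" if "j \<in> J" for j
        unfolding \<mu>_def using coef_measurable that by (intro measurable_restrict_space1) (auto simp: J_def)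
      show "0 < measure \<mu> (space \<mu>)" using False by (simp add: zero_less_measure_iff)
    qed (use K sp in auto)
    define A0 B where "A0 = {..<N} \<times> {..<N}" and "B = {N..<N + n} \<times> {..<N}"
    have AJ: "A0 \<subseteq> J" and BJ: "B \<subseteq> J" by (auto simp: A0_def B_def J_def)
    have J0: "J \<noteq> {}" using N by (auto simp: J_def)
    define f where "f I z = \<mu>.fe (\<lambda>\<sigma>. \<Sum>j\<in>I. z j * coef N j \<sigma>)" for I z
    have f_int: "integrable (gauss_PiM J) (f I)" if "I \<subseteq> J" for I
      using \<mu>.fe_field_integrable[of "\<lambda>_. 0" 0 I "\<lambda>_. 1"] that by (simp add: f_def[abs_def])
    have f_meas: "f A0 \<in> borel_measurable (\<Pi>\<^sub>M j\<in>J. borel)"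
      using \<mu>.fe_field_measurable[of "\<lambda>_. 0" A0 "\<lambda>_. 1"] AJ by (simp add: f_def[abs_def])
    define X where "X \<omega> = f A0 (\<lambda>j\<in>J. g (fst j) (snd j) \<omega>)" for \<omega>
    note dg = distr_iid_std_gaussian[OF g J0]
    have X_int: "integrable M X"
    proof -
      have "integrable (distr M (\<Pi>\<^sub>M j\<in>J. borel) (\<lambda>\<omega>. \<lambda>j\<in>J. g (fst j) (snd j) \<omega>)) (f A0)"
        unfolding dg(1) by (rule f_int[OF AJ])
      then show ?thesis
        unfolding X_def[abs_def] by (subst (asm) integrable_distr_eq[OF dg(2) f_meas])
    qed
    have X_E: "integral\<^sup>L M X = integral\<^sup>L (gauss_PiM J) (f A0)"
      unfolding X_def[abs_def] dg(1)[symmetric] using f_meas dg(2) by (subst integral_distr) auto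
    have elog: "elog (partition_function n \<beta> N (\<lambda>i k. g i k \<omega>) A) = ereal (X \<omega>)" for \<omega>
    proof -
      define W where "W \<sigma> = (\<Sum>j\<in>A0. g (fst j) (snd j) \<omega> * coef N j \<sigma>)" for \<sigma>
      have "X \<omega> = \<mu>.fe W"
        unfolding X_def f_def W_def using AJ by (intro arg_cong[where f = \<mu>.fe] ext sum.cong) auto
      moreover have "0 < (\<integral>\<sigma>. exp (W \<sigma>) \<partial>\<mu>)"
      proof (rule \<mu>.integral_exp_bounds(4))
        show "W \<in> borel_measurable \<mu>"
          using \<mu>.field_measurable[OF AJ, of "\<lambda>_. 1" "\<lambda>j. g (fst j) (snd j) \<omega>"] by (simp add: W_def[abs_def])
        show "\<bar>W \<sigma>\<bar> \<le> 1 * K * (\<Sum>j\<in>J. \<bar>g (fst j) (snd j) \<omega>\<bar>)" if "\<sigma> \<in> space \<mu>" for \<sigma>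
          using \<mu>.field_abs_le[OF AJ _ that, of "\<lambda>_. 1" 1 "\<lambda>j. g (fst j) (snd j) \<omega>"] by (simp add: W_def)
      qed
      ultimately show ?thesis
        unfolding part elog_def \<mu>.fe_def W_def A0_def by simp
    qed
    \<comment> \<open>The bound on the logarithm for one fixed disorder. It is quadratic in
      \<open>z\<close>, so its expectation is explicit and no exchange of logarithm and expectation
      is needed.\<close>
    define \<Lambda> where "\<Lambda> z = N * field_rate \<theta> \<epsilon> + n * ln (2 / \<epsilon>\<^sup>2)
        + (\<Sum>k<n. \<Sum>i<N. q k * (z (N + k, i))\<^sup>2 / (2 * \<theta> k))" for z :: "nat \<times> nat \<Rightarrow> real"
    have f_le: "f B z \<le> \<Lambda> z" for z
    proof -
      define W where "W \<sigma> = (\<Sum>j\<in>B. z j * coef N j \<sigma>)" for \<sigma>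
      have W: "W \<in> borel_measurable \<mu>"
        using \<mu>.field_measurable[OF BJ, of "\<lambda>_. 1" z] by (simp add: W_def[abs_def])
      have Wb: "\<bar>W \<sigma>\<bar> \<le> 1 * K * (\<Sum>j\<in>J. \<bar>z j\<bar>)" if "\<sigma> \<in> space \<mu>" for \<sigma>
        using \<mu>.field_abs_le[OF BJ _ that, of "\<lambda>_. 1" 1 z] by (simp add: W_def)
      note b = \<mu>.integral_exp_bounds[OF W Wb]
      have "ennreal (\<integral>\<sigma>. exp (W \<sigma>) \<partial>\<mu>) = (\<integral>\<^sup>+ \<sigma>. ennreal (exp (W \<sigma>)) \<partial>\<mu>)"
        using b(1) by (intro nn_integral_eq_integral[symmetric]) auto
      also have "\<dots> = (\<integral>\<^sup>+ \<sigma>. indicator A \<sigma> * ennreal (exp (W \<sigma>)) \<partial>spheres n N)"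
        unfolding \<mu>_def by (subst nn_integral_restrict_space) (auto simp: Asp mult.commute)
      also have "\<dots> \<le> ennreal (exp (\<Lambda> z))"
        unfolding A_def W_def B_def \<Lambda>_def by (rule field_integral_le[OF N n \<epsilon> \<theta>])
      finally have "(\<integral>\<sigma>. exp (W \<sigma>) \<partial>\<mu>) \<le> exp (\<Lambda> z)" by simp
      then have "ln (\<integral>\<sigma>. exp (W \<sigma>) \<partial>\<mu>) \<le> \<Lambda> z" using b(4) by (simp add: ln_le_cancel_iff[of _ "exp _", simplified])
      then show ?thesis by (simp add: f_def W_def[abs_def] \<mu>.fe_def)
    qed
    interpret \<gamma>: prob_space "gauss_PiM J" by (rule prob_space_gauss_PiM)
    have m2: "integrable (gauss_PiM J) (\<lambda>z. (z (N + k, i))\<^sup>2)" "(\<integral>z. (z (N + k, i))\<^sup>2 \<partial>gauss_PiM J) = 1"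
      if "k < n" "i < N" for k i
      using gauss_PiM_second_moments[of J "(N + k, i)" "(N + k, i)"] that
      by (auto simp: J_def power2_eq_square)
    have sum_int: "integrable (gauss_PiM J) (\<lambda>z. \<Sum>k<n. \<Sum>i<N. q k * (z (N + k, i))\<^sup>2 / (2 * \<theta> k))"
      using m2 by (intro Bochner_Integration.integrable_sum integrable_divide integrable_mult_right) auto
    have \<Lambda>_int: "integrable (gauss_PiM J) \<Lambda>"
      unfolding \<Lambda>_def[abs_def] using sum_int by (intro Bochner_Integration.integrable_add) auto
    have "(\<integral>z. (\<Sum>k<n. \<Sum>i<N. q k * (z (N + k, i))\<^sup>2 / (2 * \<theta> k)) \<partial>gauss_PiM J)
        = (\<Sum>k<n. \<integral>z. (\<Sum>i<N. q k * (z (N + k, i))\<^sup>2 / (2 * \<theta> k)) \<partial>gauss_PiM J)"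
      using m2 by (intro Bochner_Integration.integral_sum Bochner_Integration.integrable_sum
          integrable_divide integrable_mult_right) auto
    also have "\<dots> = (\<Sum>k<n. \<Sum>i<N. \<integral>z. q k * (z (N + k, i))\<^sup>2 / (2 * \<theta> k) \<partial>gauss_PiM J)"
      using m2 by (intro sum.cong refl Bochner_Integration.integral_sum integrable_divide integrable_mult_right) auto
    also have "\<dots> = N * (\<Sum>k<n. q k / (2 * \<theta> k))"
      using m2 by (simp add: sum_distrib_left)
    finally have \<Lambda>_E: "integral\<^sup>L (gauss_PiM J) \<Lambda> = N * field_rate \<theta> \<epsilon> + n * ln (2 / \<epsilon>\<^sup>2) + N * (\<Sum>k<n. q k / (2 * \<theta> k))"
      unfolding \<Lambda>_def[abs_def] using sum_int
      by (subst Bochner_Integration.integral_add) (auto simp: \<gamma>.prob_space)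
    have "integral\<^sup>L M X \<le> integral\<^sup>L (gauss_PiM J) (f B) + N * ((\<Sum>k<n. (min (r k) 1)\<^sup>2) + \<epsilon> * incr_const) / 4"
      unfolding X_E f_def[abs_def]
    proof (rule \<mu>.gaussian_comparison[OF AJ BJ])
      fix \<sigma> \<tau> assume "\<sigma> \<in> space \<mu>" "\<tau> \<in> space \<mu>"
      then show "(\<Sum>j\<in>A0. (coef N j \<sigma> - coef N j \<tau>)\<^sup>2) \<le> (\<Sum>j\<in>B. (coef N j \<sigma> - coef N j \<tau>)\<^sup>2)
          + N * ((\<Sum>k<n. (min (r k) 1)\<^sup>2) + \<epsilon> * incr_const)"
        unfolding A0_def B_def sp A_def using N \<epsilon> by (intro coef_increments) auto
    qed
    also have "integral\<^sup>L (gauss_PiM J) (f B) \<le> integral\<^sup>L (gauss_PiM J) \<Lambda>"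
      using f_int[OF BJ] \<Lambda>_int f_le by (intro integral_mono) auto
    also have "integral\<^sup>L (gauss_PiM J) \<Lambda> + N * ((\<Sum>k<n. (min (r k) 1)\<^sup>2) + \<epsilon> * incr_const) / 4
        = N * (fe_bound \<theta> \<epsilon> + n * ln (2 / \<epsilon>\<^sup>2) / N)"
      using N unfolding \<Lambda>_E fe_bound_def by (simp add: field_simps)
    finally have "integral\<^sup>L M X \<le> N * (fe_bound \<theta> \<epsilon> + n * ln (2 / \<epsilon>\<^sup>2) / N)" by simp
    then have "integral\<^sup>L M X / N \<le> fe_bound \<theta> \<epsilon> + n * ln (2 / \<epsilon>\<^sup>2) / N"
      using N by (metis pos_divide_le_eq mult.commute of_nat_0_less_iff)
    then have "1 / N * integral\<^sup>L M X \<le> fe_bound \<theta> \<epsilon> + n * ln (2 / \<epsilon>\<^sup>2) / N" by simp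
    moreover have "free_energy M g n \<beta> N A = ereal (1 / N * integral\<^sup>L M X)"
      unfolding free_energy_def elog eexpectation_ereal[OF X_int] by simp
    ultimately show ?thesis by (simp add: A_def)
  qed
qed

text \<open>The order of the limits matters: the summand n ln (2 / \<epsilon>^2) / N blows up as
  \<epsilon> tends to 0 with N fixed, but vanishes as N tends to infinity with \<epsilon> fixed.
  What remains is continuous at \<epsilon> = 0.\<close>

lemma limsup_free_energy_le:
  assumes g: "iid_std_gaussian M g" and n: "0 < n" and \<theta>: "\<And>k. k < n \<Longrightarrow> 0 < \<theta> k"
  shows "Limsup (at_right 0) (\<lambda>\<epsilon>. limsup (\<lambda>N. free_energy M g n \<beta> N (overlap_set n Q \<epsilon> N))) \<le> ereal (fe_bound \<theta> 0)"
proof -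
  have 1: "limsup (\<lambda>N. free_energy M g n \<beta> N (overlap_set n Q \<epsilon> N)) \<le> ereal (fe_bound \<theta> \<epsilon>)"
    if \<epsilon>: "0 < \<epsilon>" "\<epsilon> < 1" for \<epsilon>
  proof -
    have "limsup (\<lambda>N. free_energy M g n \<beta> N (overlap_set n Q \<epsilon> N))
        \<le> limsup (\<lambda>N. ereal (fe_bound \<theta> \<epsilon> + n * ln (2 / \<epsilon>\<^sup>2) / real N))"
      using free_energy_le[OF g _ n \<epsilon> \<theta>]
      by (intro Limsup_mono eventually_mono[OF eventually_gt_at_top[of 0]]) auto
    also have "\<dots> = ereal (fe_bound \<theta> \<epsilon>)"
    proof (rule lim_imp_Limsup)
      have "(\<lambda>N. n * ln (2 / \<epsilon>\<^sup>2) / real N) \<longlonglongrightarrow> 0" by real_asymp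
      then have "(\<lambda>N. fe_bound \<theta> \<epsilon> + n * ln (2 / \<epsilon>\<^sup>2) / real N) \<longlonglongrightarrow> fe_bound \<theta> \<epsilon> + 0"
        by (intro tendsto_add tendsto_const)
      then show "(\<lambda>N. ereal (fe_bound \<theta> \<epsilon> + n * ln (2 / \<epsilon>\<^sup>2) / real N)) \<longlonglongrightarrow> ereal (fe_bound \<theta> \<epsilon>)"
        by simp
    qed simp
    finally show ?thesis .
  qed
  have "Limsup (at_right 0) (\<lambda>\<epsilon>. limsup (\<lambda>N. free_energy M g n \<beta> N (overlap_set n Q \<epsilon> N)))
      \<le> Limsup (at_right 0) (\<lambda>\<epsilon>. ereal (fe_bound \<theta> \<epsilon>))"
    using 1 by (intro Limsup_mono eventually_mono[OF eventually_at_right_real[of 0 1]]) auto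
  also have "\<dots> = ereal (fe_bound \<theta> 0)"
  proof (rule lim_imp_Limsup)
    have "isCont (fe_bound \<theta>) 0"
      unfolding fe_bound_def[abs_def] field_rate_def by (auto intro!: continuous_intros)
    then have "(fe_bound \<theta> \<longlongrightarrow> fe_bound \<theta> 0) (at_right 0)"
      unfolding isCont_def by (rule filterlim_mono[OF _ order_refl at_le]) simp
    then show "((\<lambda>\<epsilon>. ereal (fe_bound \<theta> \<epsilon>)) \<longlongrightarrow> ereal (fe_bound \<theta> 0)) (at_right 0)" by simp
  qed simp
  finally show ?thesis .
qed

lemma fe_bound_0:
  "fe_bound \<theta> 0 = (\<Sum>k<n. \<theta> k * r k / 2 - ln (\<theta> k) / 2 - 1 / 2 + q k / (2 * \<theta> k) + (min (r k) 1)\<^sup>2 / 4 - ln (\<beta> k) / 2)"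
  by (simp add: fe_bound_def field_rate_def sum.distrib sum_subtractf sum_divide_distrib)

theorem Limsup_free_energy_le:
  assumes g: "iid_std_gaussian M g" and n: "0 < n"
  shows "Limsup (at_right 0) (\<lambda>\<epsilon>. limsup (\<lambda>N. free_energy M g n \<beta> N (overlap_set n Q \<epsilon> N)))
    \<le> ereal (1 / 2) * (\<Sum>j<n. spin_f (r j) - ereal (ln (\<beta> j)))" (is "?L \<le> _")
proof (cases "\<forall>k<n. 0 < r k")
  case True
  define \<theta> where "\<theta> k = (if r k < 1 then 1 / r k else 1)" for k
  have sf: "spin_f (r k) - ereal (ln (\<beta> k)) = ereal (2 * (\<theta> k * r k / 2 - ln (\<theta> k) / 2 - 1 / 2 + q k / (2 * \<theta> k)
      + (min (r k) 1)\<^sup>2 / 4 - ln (\<beta> k) / 2))" if "k < n" for k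
    using True that by (auto simp: spin_f_def \<theta>_def q_def ln_div field_simps)
  have "(\<Sum>j<n. spin_f (r j) - ereal (ln (\<beta> j))) = ereal (2 * fe_bound \<theta> 0)"
    unfolding fe_bound_0 sum_distrib_left using sf by simp
  moreover have "?L \<le> ereal (fe_bound \<theta> 0)"
    using True by (intro limsup_free_energy_le[OF g n]) (auto simp: \<theta>_def)
  ultimately show ?thesis by simp
next
  case False
  then obtain m where m: "m < n" "r m = 0" using r_nonneg by (auto simp: not_less intro: antisym)
  define C where "C = fe_bound (\<lambda>_. 1) 0"
  have "?L \<le> ereal B" for B
  proof -
    \<comment> \<open>In the direction \<open>m\<close> both r and q vanish, so raising
      \<open>\<theta> m\<close> from 1 to exp t changes only the term -(ln \<theta>) / 2 and lowers
      the bound by t / 2. This \<open>t\<close> brings it below the arbitrary level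
      \<open>B\<close>.\<close>
    define t where "t = max 0 (2 * (C - B))"
    define \<theta> where "\<theta> k = (if k = m then exp t else 1)" for k
    have "fe_bound \<theta> 0 = C - t / 2"
      unfolding C_def fe_bound_0 using m
      by (simp add: sum.remove[of "{..<n}" m] \<theta>_def q_def)
    also have "\<dots> \<le> B" by (simp add: t_def max_def field_simps)
    finally have "ereal (fe_bound \<theta> 0) \<le> ereal B" by simp
    moreover have "?L \<le> ereal (fe_bound \<theta> 0)"
      by (rule limsup_free_energy_le[OF g n]) (simp add: \<theta>_def)
    ultimately show ?thesis by (rule order_trans[rotated])
  qed
  then have "?L = - \<infinity>" by (rule ereal_bot)
  then show ?thesis by simp
qed

section \<open>The strict inequality\<close>

lemma sum_eigenvalues: "(\<Sum>k<n. r k) = (\<Sum>j<n. \<beta> j * Q $$ (j, j))"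
proof -
  have "(\<Sum>k<n. r k) = (\<Sum>k<n. \<Sum>i<n. \<Sum>j<n. (u i k * u j k) * (sqrt (\<beta> i * \<beta> j) * Q $$ (i, j)))"
    using u_diag by (simp add: mult_ac)
  also have "\<dots> = (\<Sum>i<n. \<Sum>j<n. \<Sum>k<n. (u i k * u j k) * (sqrt (\<beta> i * \<beta> j) * Q $$ (i, j)))"
    by (subst sum.swap, rule sum.cong[OF refl], rule sum.swap)
  also have "\<dots> = (\<Sum>i<n. \<Sum>j<n. (if i = j then 1 else 0) * (sqrt (\<beta> i * \<beta> j) * Q $$ (i, j)))"
    by (intro sum.cong refl) (simp add: sum_distrib_right[symmetric] u_rows)
  also have "\<dots> = (\<Sum>i<n. \<beta> i * Q $$ (i, i))"
    using \<beta>_pos by (intro sum.cong refl) (simp add: if_distrib[of "\<lambda>x. x * _"] less_imp_le cong: if_cong)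
  finally show ?thesis .
qed

text \<open>Replacing f by its tangent line is strict at the eigenvalue below 1. The linear bound
  depends only on the sum of the eigenvalues, which is the trace \<Sum>j \<beta> j because the
  diagonal of \<open>Q\<close> is 1; so it adds up to exactly twice the sum of the
  \<open>parisi (\<beta> j)\<close>.\<close>

lemma spin_f_sum_less:
  assumes m: "m < n" "r m < 1" and Q: "\<And>j. j < n \<Longrightarrow> Q $$ (j, j) = 1"
  shows "ereal (1 / 2) * (\<Sum>j<n. spin_f (r j) - ereal (ln (\<beta> j))) < ereal (\<Sum>j<n. parisi (\<beta> j))"
proof -
  define d where "d j = 2 * r j - 3 / 2 - ln (\<beta> j)" for j
  have "spin_f (r m) - ereal (ln (\<beta> m)) < ereal (d m)"
    using spin_f_less(1)[OF m(2)] by (cases "spin_f (r m)") (auto simp: d_def)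
  moreover have "(\<Sum>j\<in>{..<n} - {m}. spin_f (r j) - ereal (ln (\<beta> j))) \<le> (\<Sum>j\<in>{..<n} - {m}. ereal (d j))"
  proof (rule sum_mono)
    fix j show "spin_f (r j) - ereal (ln (\<beta> j)) \<le> ereal (d j)"
      using spin_f_less(2)[of "r j"] by (cases "spin_f (r j)") (auto simp: d_def)
  qed
  then have "(\<Sum>j\<in>{..<n} - {m}. spin_f (r j) - ereal (ln (\<beta> j))) \<le> ereal (\<Sum>j\<in>{..<n} - {m}. d j)" by simp
  \<comment> \<open>The left-hand summands may be -\<infinity> while the bounds on the right are
    real, so the strict and the weak inequality are added by cases.\<close>
  ultimately have "(spin_f (r m) - ereal (ln (\<beta> m))) + (\<Sum>j\<in>{..<n} - {m}. spin_f (r j) - ereal (ln (\<beta> j)))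
      < ereal (d m + (\<Sum>j\<in>{..<n} - {m}. d j))"
    by (cases "spin_f (r m) - ereal (ln (\<beta> m))";
        cases "\<Sum>j\<in>{..<n} - {m}. spin_f (r j) - ereal (ln (\<beta> j))") auto
  then have "(\<Sum>j<n. spin_f (r j) - ereal (ln (\<beta> j))) < ereal (\<Sum>j<n. d j)"
    using m by (simp add: sum.remove[of "{..<n}" m])
  then have "ereal (1 / 2) * (\<Sum>j<n. spin_f (r j) - ereal (ln (\<beta> j))) < ereal (1 / 2 * (\<Sum>j<n. d j))"
    by (cases "\<Sum>j<n. spin_f (r j) - ereal (ln (\<beta> j))") auto
  also have "1 / 2 * (\<Sum>j<n. d j) = (\<Sum>j<n. parisi (\<beta> j))"
  proof -
    have "(\<Sum>j<n. d j) = 2 * (\<Sum>j<n. r j) - (\<Sum>j<n. 3 / 2) - (\<Sum>j<n. ln (\<beta> j))"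
      unfolding d_def by (simp only: sum_subtractf sum_distrib_left)
    also have "(\<Sum>j<n. r j) = (\<Sum>j<n. \<beta> j)"
      using sum_eigenvalues Q by simp
    also have "2 * (\<Sum>j<n. \<beta> j) - (\<Sum>j<n. 3 / 2) - (\<Sum>j<n. ln (\<beta> j)) = (\<Sum>j<n. 2 * \<beta> j - 3 / 2 - ln (\<beta> j))"
      by (simp only: sum_subtractf sum_distrib_left)
    finally show ?thesis by (simp only: parisi_def sum_distrib_left)
  qed
  finally show ?thesis .
qed

end

theorem theorem1:
  fixes M :: "'a measure" and g :: "nat \<Rightarrow> nat \<Rightarrow> 'a \<Rightarrow> real"
    and n :: nat and \<beta> r :: "nat \<Rightarrow> real" and Q Qt :: "real mat"
  assumes "iid_std_gaussian M g"
    and "n \<ge> 1"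
    and "\<forall>j<n. \<beta> j > 1"
    and "Q \<in> carrier_mat n n"
    and "transpose_mat Q = Q"
    and "nonneg_definite Q"
    and "\<forall>j<n. \<forall>k<n. Q $$ (j, k) \<in> {-1..1}"
    and "\<forall>j<n. Q $$ (j, j) = 1"
    and "Qt = Matrix.mat n n (\<lambda>(j, k). sqrt (\<beta> j * \<beta> k) * Q $$ (j, k))"
    and "char_poly Qt = (\<Prod>j<n. [:- r j, 1:])"
  shows "Limsup (at_right 0) (\<lambda>\<epsilon>. limsup (\<lambda>N. free_energy M g n \<beta> N (overlap_set n Q \<epsilon> N)))
           \<le> ereal (1 / 2) * (\<Sum>j<n. spin_f (r j) - ereal (ln (\<beta> j)))
       \<and> (Min (r ` {..<n}) < 1 \<longrightarrow>
           ereal (1 / 2) * (\<Sum>j<n. spin_f (r j) - ereal (ln (\<beta> j))) < ereal (\<Sum>j<n. parisi (\<beta> j)))"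
proof -
  have Qsym: "Q $$ (i, j) = Q $$ (j, i)" if "i < n" "j < n" for i j
    using arg_cong[OF assms(5), of "\<lambda>M. M $$ (i, j)"] assms(4) that by simp
  have Qt: "Qt \<in> carrier_mat n n" by (simp add: assms(9))
  have "Qt\<^sup>T = Qt"
    unfolding assms(9) using Qsym by (intro eq_matI) (auto simp: mult.commute)
  then obtain u where u: "\<And>k l. k < n \<Longrightarrow> l < n \<Longrightarrow> (\<Sum>i<n. u i k * u i l) = (if k = l then 1 else 0)"
    "\<And>i j. i < n \<Longrightarrow> j < n \<Longrightarrow> (\<Sum>k<n. u i k * u j k) = (if i = j then 1 else 0)"
    "\<And>k l. k < n \<Longrightarrow> l < n \<Longrightarrow> (\<Sum>i<n. \<Sum>j<n. u i k * Qt $$ (i, j) * u j l) = (if k = l then r k else 0)"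
    using symmetric_mat_eigenbasis[OF Qt _ assms(10)] by blast
  have diag: "(\<Sum>i<n. \<Sum>j<n. u i k * (sqrt (\<beta> i * \<beta> j) * Q $$ (i, j)) * u j l) = (if k = l then r k else 0)"
    if "k < n" "l < n" for k l
    using u(3)[OF that] by (simp add: assms(9))
  interpret eigen_overlap n \<beta> r Q u
  proof
    show "0 < \<beta> j" if "j < n" for j using assms(3) that by force
    fix k assume k: "k < n"
    \<comment> \<open>Absorbing the factors sqrt (\<beta> i) into the eigenvector makes
      \<open>r k\<close> the value of the quadratic form of \<open>Q\<close> itself at
      \<open>v\<close>, which is nonnegative.\<close>
    define v where "v = vec n (\<lambda>i. sqrt (\<beta> i) * u i k)"
    have "r k = (\<Sum>i<n. \<Sum>j<n. u i k * (sqrt (\<beta> i * \<beta> j) * Q $$ (i, j)) * u j k)"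
      using diag[OF k k] by simp
    also have "\<dots> = v \<bullet> (Q *\<^sub>v v)"
      using assms(4) by (simp add: v_def scalar_prod_def atLeast0LessThan sum_distrib_left real_sqrt_mult mult_ac)
    also have "\<dots> \<ge> 0"
      using assms(4,6) by (auto simp: nonneg_definite_def v_def)
    finally show "0 \<le> r k" .
  qed (use u diag in auto)
  show ?thesis
  proof (intro conjI impI)
    show "Limsup (at_right 0) (\<lambda>\<epsilon>. limsup (\<lambda>N. free_energy M g n \<beta> N (overlap_set n Q \<epsilon> N)))
        \<le> ereal (1 / 2) * (\<Sum>j<n. spin_f (r j) - ereal (ln (\<beta> j)))"
      using assms(1,2) by (intro Limsup_free_energy_le) auto
    assume min: "Min (r ` {..<n}) < 1"
    have "Min (r ` {..<n}) \<in> r ` {..<n}" using assms(2) by (intro Min_in) (auto simp: lessThan_empty_iff)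
    then obtain m where "m < n" "r m < 1" using min by auto
    then show "ereal (1 / 2) * (\<Sum>j<n. spin_f (r j) - ereal (ln (\<beta> j))) < ereal (\<Sum>j<n. parisi (\<beta> j))"
      using assms(8) by (intro spin_f_sum_less) auto
  qed
qed

end
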